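(* Let $Y$ be a semisimple unital complex Banach algebra with $\dim(Y)>1$. Then there is a semisimple unital complex Banach algebra $A$ with the following properties: (a) $A$ is a norm-preserving and spectrum-preserving extension of $Y$; that is, $Y$ is (identified via an isometric algebra embedding with) a subalgebra of $A$, and $\sigma_A(y)=\sigma_Y(y)$ for every $y\in Y$. (b) $A$ contains a closed inessential ideal $I$ such that $A/I$ is isometrically isomorphic to $Y$. (c) For each $a\in Y$ such that $\sigma(a)$ separates the complex plane there is $w\in I$ such that $a+w$ is a point of spectral discontinuity in $A$.
   Context: For a unital Banach algebra $B$ and $x\in B$, $\sigma_B(x)=\{\lambda\in\mathbb C:\lambda\mathbf 1-x\text{ is not invertible in }B\}$. A two-sided ideal $I$ of a Banach algebra $A$ is inessential if, for each $x\in I$, $\sigma_A(x)$ is either finite or its elements form a sequence converging to $0$. A compact set $K\subset\mathbb C$ separates the plane if $\mathbb C\setminus K$ has at least one bounded connected component. A point $z\in A$ is a point of spectral discontinuity in $A$ if the map $x\mapsto\sigma_A(x)$, from $A$ with its norm to the nonempty compact subsets of $\mathbb C$ with the Hausdorff metric, is discontinuous at $z$. The quotient $A/I$ carries the quotient norm. *)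

theory Defs
  imports
    "HOL-Analysis.Analysis"
    "HOL-Algebra.QuotRing"
    "HOL-Algebra.Module"
    "HOL-Algebra.Embedded_Algebras"
    "HOL-Algebra.Algebraic_Closure_Type"
begin

section \<open>Unital complex Banach algebras with explicit carrier\<close>

abbreviation complex_field :: "complex ring"
  where "complex_field \<equiv> ring_of_type_algebra"

record 'a normed_alg = "(complex, 'a) module" +
  nrm :: "'a \<Rightarrow> real"

text \<open>
  The locale \<^locale>\<open>algebra\<close> of HOL-Algebra describes commutative algebras only, so we start
  from rings and modules.
\<close>
locale complex_algebra =
  Module.module complex_field A + ring A for A (structure) +
  assumes smult_mult_left:
      "\<lbrakk>x \<in> carrier A; y \<in> carrier A\<rbrakk> \<Longrightarrow> (c \<odot> x) \<otimes> y = c \<odot> (x \<otimes> y)"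
    and smult_mult_right:
      "\<lbrakk>x \<in> carrier A; y \<in> carrier A\<rbrakk> \<Longrightarrow> x \<otimes> (c \<odot> y) = c \<odot> (x \<otimes> y)"

text \<open>
  The value outside the carrier is irrelevant; it is set to 0 because the locale
  \<^locale>\<open>Metric_space\<close> requires nonnegativity and symmetry on the whole type.
\<close>
definition alg_dist :: "'a normed_alg \<Rightarrow> 'a \<Rightarrow> 'a \<Rightarrow> real"
  where "alg_dist A x y =
    (if x \<in> carrier A \<and> y \<in> carrier A then nrm A (x \<ominus>\<^bsub>A\<^esub> y) else 0)"

locale complex_normed_algebra = complex_algebra A for A :: "'a normed_alg" (structure) +
  assumes nrm_nonneg: "x \<in> carrier A \<Longrightarrow> 0 \<le> nrm A x"
    and nrm_eq_0_iff: "x \<in> carrier A \<Longrightarrow> nrm A x = 0 \<longleftrightarrow> x = \<zero>"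
    and nrm_triangle:
      "\<lbrakk>x \<in> carrier A; y \<in> carrier A\<rbrakk> \<Longrightarrow> nrm A (x \<oplus> y) \<le> nrm A x + nrm A y"
    and nrm_smult: "x \<in> carrier A \<Longrightarrow> nrm A (c \<odot> x) = cmod c * nrm A x"
    and nrm_mult:
      "\<lbrakk>x \<in> carrier A; y \<in> carrier A\<rbrakk> \<Longrightarrow> nrm A (x \<otimes> y) \<le> nrm A x * nrm A y"
begin

lemma nrm_minus: "x \<in> carrier A \<Longrightarrow> nrm A (\<ominus> x) = nrm A x"
proof -
  assume x: "x \<in> carrier A"
  have cf: "(- 1 :: complex) \<in> carrier complex_field" "(1 :: complex) \<in> carrier complex_field"
    by (simp_all add: ring_of_type_algebra_def)
  have "(- 1) \<odot> x \<oplus> x = ((- 1) \<oplus>\<^bsub>complex_field\<^esub> 1) \<odot> x"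
    using smult_l_distr[OF cf x] smult_one[OF x] by (simp add: ring_of_type_algebra_def)
  also have "\<dots> = \<zero>"
    using smult_l_null[OF x] by (simp add: ring_of_type_algebra_def)
  finally have "(- 1) \<odot> x = \<ominus> x"
    using x cf(1) by (simp add: minus_equality)
  then show ?thesis
    using nrm_smult[OF x, of "- 1"] by simp
qed

sublocale Metric_space "carrier A" "alg_dist A"
proof
  fix x y z
  show "0 \<le> alg_dist A x y"
    by (simp add: alg_dist_def nrm_nonneg)
  show "alg_dist A x y = alg_dist A y x"
  proof (cases "x \<in> carrier A \<and> y \<in> carrier A")
    case True
    then have "y \<ominus> x = \<ominus> (x \<ominus> y)"
      by (simp add: a_minus_def minus_add a_comm)
    with True show ?thesis
      by (simp add: alg_dist_def nrm_minus)
  qed (auto simp: alg_dist_def)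
  assume x: "x \<in> carrier A" and y: "y \<in> carrier A"
  show "alg_dist A x y = 0 \<longleftrightarrow> x = y"
    using x y by (simp add: alg_dist_def nrm_eq_0_iff)
  assume z: "z \<in> carrier A"
  have "x \<ominus> z = (x \<ominus> y) \<oplus> (y \<ominus> z)"
    using x y z by (simp add: a_minus_def a_assoc r_neg1)
  then show "alg_dist A x z \<le> alg_dist A x y + alg_dist A y z"
    using x y z nrm_triangle[of "x \<ominus> y" "y \<ominus> z"] by (simp add: alg_dist_def)
qed

end

text \<open>
  The unit is not required to have norm 1. Isometric embeddings (below) preserve the unit, so an
  isometric extension of an algebra whose unit has norm 1 has a unit of norm 1 as well.
\<close>
locale complex_banach_algebra = complex_normed_algebra +
  assumes complete: "Metric_space.mcomplete (carrier A) (alg_dist A)"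

abbreviation alg_topology :: "'a normed_alg \<Rightarrow> 'a topology"
  where "alg_topology A \<equiv> Metric_space.mtopology (carrier A) (alg_dist A)"

text \<open>
  The complex dimension exceeds \<open>n\<close> iff some linearly independent list is longer than \<open>n\<close>;
  this also covers infinite dimension. The scalar field is embedded as the multiples of the unit.
\<close>
definition cdim_greater :: "'a normed_alg \<Rightarrow> nat \<Rightarrow> bool"
  where "cdim_greater A n \<longleftrightarrow>
    (\<exists>us. ring.independent A (range (\<lambda>c. c \<odot>\<^bsub>A\<^esub> \<one>\<^bsub>A\<^esub>)) us \<and> n < length us)"

section \<open>Semisimplicity\<close>

definition left_ideal :: "'a set \<Rightarrow> ('a, 'm) ring_scheme \<Rightarrow> bool"
  where "left_ideal L R \<longleftrightarrow>
    additive_subgroup L R \<and> (\<forall>x\<in>carrier R. \<forall>l\<in>L. x \<otimes>\<^bsub>R\<^esub> l \<in> L)"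

definition maximal_left_ideal :: "'a set \<Rightarrow> ('a, 'm) ring_scheme \<Rightarrow> bool"
  where "maximal_left_ideal L R \<longleftrightarrow>
    left_ideal L R \<and> L \<noteq> carrier R \<and>
    (\<forall>J. left_ideal J R \<and> L \<subseteq> J \<longrightarrow> J = L \<or> J = carrier R)"

definition jacobson_radical :: "('a, 'm) ring_scheme \<Rightarrow> 'a set"
  where "jacobson_radical R = {x \<in> carrier R. \<forall>L. maximal_left_ideal L R \<longrightarrow> x \<in> L}"

definition semisimple :: "('a, 'm) ring_scheme \<Rightarrow> bool"
  where "semisimple R \<longleftrightarrow> jacobson_radical R = {\<zero>\<^bsub>R\<^esub>}"

section \<open>Spectrum\<close>

definition spectrum :: "'a normed_alg \<Rightarrow> 'a \<Rightarrow> complex set"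
  where "spectrum A x = {z. z \<odot>\<^bsub>A\<^esub> \<one>\<^bsub>A\<^esub> \<ominus>\<^bsub>A\<^esub> x \<notin> Units A}"

definition separates_plane :: "complex set \<Rightarrow> bool"
  where "separates_plane K \<longleftrightarrow> (\<exists>C\<in>components (- K). bounded C)"

definition hausdorff_dist :: "'a::metric_space set \<Rightarrow> 'a set \<Rightarrow> real"
  where "hausdorff_dist S T = max (SUP x\<in>S. infdist x T) (SUP y\<in>T. infdist y S)"

definition spectral_discontinuity :: "'a normed_alg \<Rightarrow> 'a \<Rightarrow> bool"
  where "spectral_discontinuity A z \<longleftrightarrow> z \<in> carrier A \<and>
    \<not> (\<forall>\<epsilon>>0. \<exists>\<delta>>0. \<forall>x\<in>carrier A.
          alg_dist A x z < \<delta> \<longrightarrow> hausdorff_dist (spectrum A x) (spectrum A z) < \<epsilon>)"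

definition inessential_ideal :: "'a set \<Rightarrow> 'a normed_alg \<Rightarrow> bool"
  where "inessential_ideal I A \<longleftrightarrow> ideal I A \<and>
    (\<forall>x\<in>I. finite (spectrum A x) \<or>
      (\<exists>s :: nat \<Rightarrow> complex. range s = spectrum A x \<and> s \<longlonglongrightarrow> 0))"

section \<open>Quotients and isometric homomorphisms\<close>

text \<open>
  The ring structure is that of \<^const>\<open>FactRing\<close>. The scalar multiple of a coset is written as
  for products of cosets in \<^const>\<open>rcoset_mult\<close>, so that it is again a coset for scalar 0.
  The norm of a coset is the infimum of the norms of its elements.
\<close>
definition quotient_alg :: "'a normed_alg \<Rightarrow> 'a set \<Rightarrow> 'a set normed_alg"
  where "quotient_alg A I =
    \<lparr>carrier = carrier (A Quot I), mult = mult (A Quot I), one = one (A Quot I),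
     zero = zero (A Quot I), add = add (A Quot I),
     smult = (\<lambda>c K. \<Union>x\<in>K. I +>\<^bsub>A\<^esub> (c \<odot>\<^bsub>A\<^esub> x)),
     nrm = (\<lambda>K. INF x\<in>K. nrm A x)\<rparr>"

definition isometric_embedding :: "'a normed_alg \<Rightarrow> 'b normed_alg \<Rightarrow> ('a \<Rightarrow> 'b) \<Rightarrow> bool"
  where "isometric_embedding A B \<phi> \<longleftrightarrow> \<phi> \<in> ring_hom A B \<and>
    (\<forall>x\<in>carrier A. (\<forall>c. \<phi> (c \<odot>\<^bsub>A\<^esub> x) = c \<odot>\<^bsub>B\<^esub> \<phi> x) \<and> nrm B (\<phi> x) = nrm A x)"

definition isometrically_isomorphic :: "'a normed_alg \<Rightarrow> 'b normed_alg \<Rightarrow> bool"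
  where "isometrically_isomorphic A B \<longleftrightarrow>
    (\<exists>\<phi>. isometric_embedding A B \<phi> \<and> bij_betw \<phi> (carrier A) (carrier B))"

end

theory Submission
  imports Defs "HOL-Complex_Analysis.Conformal_Mappings"
begin

text \<open>
  Let \<open>L\<close> be the left regular representation of \<open>Y\<close> and \<open>J\<close> the norm closure of the finite-rank
  operators on the Banach space \<open>Y\<close>. Take \<open>A = {(y, T). T - L y \<in> J}\<close> with the maximum norm, embed
  \<open>Y\<close> by \<open>y \<mapsto> (y, L y)\<close> and put \<open>I = {0} \<times> J\<close>. The spectrum of \<open>(y, T)\<close> is the union of the spectra
  of \<open>y\<close> and \<open>T\<close>. As \<open>J\<close> contains all rank-one operators, \<open>A\<close> acts irreducibly on \<open>Y\<close> through \<open>T\<close>, hence it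
  is semisimple; analytic Fredholm theory shows that \<open>I\<close> is inessential.

  For (c), let \<open>l\<close> lie in a hole of the spectrum of \<open>a\<close> and put \<open>b = (a - l)\<^sup>-\<^sup>1\<close>. By the maximum
  principle \<open>b\<close> is not in the closed span of \<open>b\<^sup>2, b\<^sup>3, \<dots>\<close>, so some functional \<open>f\<close> has \<open>f b = 1\<close> and
  vanishes on that span; then \<open>f ((a - z)\<^sup>-\<^sup>1) = 1\<close> for \<open>z\<close> near \<open>l\<close>. The rank-one operator
  \<open>W y = f y \<cdot> 1\<close> makes \<open>l\<close> a spectral value of \<open>L a - W\<close>, but for real \<open>t \<noteq> 1\<close> a fixed
  neighbourhood of \<open>l\<close> is free of the spectrum of \<open>L a - t W\<close>.
\<close>

section \<open>Units and spectra in carrier-based Banach algebras\<close>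

text \<open>Pairs are used rather than the operators \<open>L y + K\<close> with \<open>K\<close> in
  \<open>J\<close>, because \<open>L y\<close> may itself lie in \<open>J\<close>, for instance when
  \<open>Y\<close> is finite-dimensional; the first component still remembers \<open>y\<close>, so
  that the quotient is \<open>Y\<close>. With the maximum norm, contractivity of \<open>L\<close>
  alone makes the embedding isometric, and the fibre over \<open>y\<close> attains its least norm at
  \<open>(y, L y)\<close>.

  \<open>J\<close> is the closure of the finite-rank operators, so each of its members is a small
  operator plus a finite-rank one, and rank-one updates suffice for the Fredholm argument.

  The conditions on \<open>f\<close> are forced. For invertible \<open>e = a - z\<close>, the
  operator \<open>L e - t W\<close> is a rank-one perturbation of \<open>L e\<close>, and it is
  invertible if \<open>t * f (e^-1)\<close> is not 1. If \<open>t = 1\<close> is to be the only bad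
  parameter for all \<open>z\<close> near \<open>l\<close>, the function
  \<open>f ((a - z)^-1)\<close> must be constantly 1 there. Its Taylor coefficients at
  \<open>l\<close> are the values of \<open>f\<close> at \<open>b, b^2, b^3, ...\<close>, hence the
  demand on the higher powers. In the unbounded component no such \<open>f\<close> exists: the
  resolvent tends to 0 at infinity, which contradicts analytic continuation of the constant
  1.\<close>

context complex_algebra
begin

lemma scalar_simps [simp]:
  "carrier complex_field = UNIV"
  "a \<oplus>\<^bsub>complex_field\<^esub> b = a + b" "a \<otimes>\<^bsub>complex_field\<^esub> b = a * b"
  "\<zero>\<^bsub>complex_field\<^esub> = 0" "\<one>\<^bsub>complex_field\<^esub> = 1"
  by (simp_all add: ring_of_type_algebra_def)

lemma scale_closed [simp, intro]: "x \<in> carrier A \<Longrightarrow> c \<odot> x \<in> carrier A"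
  using smult_closed by simp

lemma scale_add_left: "x \<in> carrier A \<Longrightarrow> (c + d) \<odot> x = c \<odot> x \<oplus> d \<odot> x"
  using smult_l_distr[of c d x] by simp

lemma scale_add_right:
  "x \<in> carrier A \<Longrightarrow> y \<in> carrier A \<Longrightarrow> c \<odot> (x \<oplus> y) = c \<odot> x \<oplus> c \<odot> y"
  using smult_r_distr[of c x y] by simp

lemma scale_scale [simp]: "x \<in> carrier A \<Longrightarrow> c \<odot> (d \<odot> x) = (c * d) \<odot> x"
  using smult_assoc1[of c d x] by simp

lemma scale_one [simp]: "x \<in> carrier A \<Longrightarrow> 1 \<odot> x = x"
  using smult_one[of x] by simp

lemma scale_zero_left [simp]: "x \<in> carrier A \<Longrightarrow> 0 \<odot> x = \<zero>"
  using smult_l_null[of x] by simp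

lemma scale_zero_right [simp]: "c \<odot> \<zero> = \<zero>"
  using smult_r_null[of c] by simp

lemma scale_minus_right [simp]: "x \<in> carrier A \<Longrightarrow> c \<odot> (\<ominus> x) = \<ominus> (c \<odot> x)"
  using smult_r_minus[of c x] by simp

lemma scale_minus_left [simp]: "x \<in> carrier A \<Longrightarrow> (- c) \<odot> x = \<ominus> (c \<odot> x)"
  by (metis add.left_inverse minus_equality scale_add_left scale_closed scale_zero_left)

lemma scale_diff_right:
  "x \<in> carrier A \<Longrightarrow> y \<in> carrier A \<Longrightarrow> c \<odot> (x \<ominus> y) = c \<odot> x \<ominus> c \<odot> y"
  by (simp add: a_minus_def scale_add_right)

lemma scale_diff_left: "x \<in> carrier A \<Longrightarrow> (c - d) \<odot> x = c \<odot> x \<ominus> d \<odot> x"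
  using scale_add_left[of x c "- d"] by (simp add: a_minus_def)

lemma diff_self [simp]: "x \<in> carrier A \<Longrightarrow> x \<ominus> x = \<zero>"
  by (simp add: a_minus_def r_neg)

lemma diff_zero [simp]: "x \<in> carrier A \<Longrightarrow> x \<ominus> \<zero> = x"
  by (simp add: a_minus_def)

lemma diff_distrib_left:
  "x \<in> carrier A \<Longrightarrow> y \<in> carrier A \<Longrightarrow> z \<in> carrier A \<Longrightarrow> x \<otimes> (y \<ominus> z) = x \<otimes> y \<ominus> x \<otimes> z"
  by (simp add: a_minus_def r_distr r_minus)

lemma diff_distrib_right:
  "x \<in> carrier A \<Longrightarrow> y \<in> carrier A \<Longrightarrow> z \<in> carrier A \<Longrightarrow> (x \<ominus> y) \<otimes> z = x \<otimes> z \<ominus> y \<otimes> z"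
  by (simp add: a_minus_def l_distr l_minus)

lemma diff_add_diff:
  "x \<in> carrier A \<Longrightarrow> y \<in> carrier A \<Longrightarrow> z \<in> carrier A \<Longrightarrow> (x \<ominus> y) \<oplus> (y \<ominus> z) = x \<ominus> z"
  by (simp add: a_minus_def a_assoc r_neg1)

lemma add_diff_interchange:
  "\<lbrakk>x \<in> carrier A; y \<in> carrier A; z \<in> carrier A; w \<in> carrier A\<rbrakk>
    \<Longrightarrow> (x \<oplus> y) \<ominus> (z \<oplus> w) = (x \<ominus> z) \<oplus> (y \<ominus> w)"
  by (simp add: a_minus_def minus_add a_ac)

lemma diff_add_cancel [simp]:
  "x \<in> carrier A \<Longrightarrow> y \<in> carrier A \<Longrightarrow> (x \<ominus> y) \<oplus> y = x"
  by (simp add: a_minus_def a_assoc l_neg)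

lemma diff_eq_iff:
  "\<lbrakk>x \<in> carrier A; y \<in> carrier A; z \<in> carrier A\<rbrakk> \<Longrightarrow> x \<ominus> y = z \<longleftrightarrow> x = z \<oplus> y"
  by (metis diff_add_cancel a_minus_def add.inv_solve_right)

lemma minus_diff: "x \<in> carrier A \<Longrightarrow> y \<in> carrier A \<Longrightarrow> \<ominus> (x \<ominus> y) = y \<ominus> x"
  by (simp add: a_minus_def minus_add a_comm)

lemma Units_I: "\<lbrakk>x \<in> carrier A; y \<in> carrier A; x \<otimes> y = \<one>; y \<otimes> x = \<one>\<rbrakk> \<Longrightarrow> x \<in> Units A"
  by (auto simp: Units_def)

lemma scale_Units: "x \<in> Units A \<Longrightarrow> c \<noteq> 0 \<Longrightarrow> c \<odot> x \<in> Units A"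
  by (rule Units_I[of _ "inverse c \<odot> inv x"]) (simp_all add: smult_mult_left smult_mult_right Units_closed)

lemma minus_Units: "x \<in> Units A \<Longrightarrow> \<ominus> x \<in> Units A"
  using scale_Units[of x "- 1"] by (simp add: Units_closed)

text \<open>An inverse of the commuting product yields a right and a left inverse of
  \<open>x\<close>, and these must coincide. Later this passes invertibility from
  \<open>p u - p b\<close> to the linear factor \<open>u - b\<close>.\<close>

lemma Units_of_commuting_factor:
  assumes "x \<in> carrier A" "y \<in> carrier A" "x \<otimes> y = y \<otimes> x" "x \<otimes> y \<in> Units A"
  shows "x \<in> Units A"
proof -
  let ?i = "inv (x \<otimes> y)"
  have i: "?i \<in> carrier A" using assms by simp
  have 1: "x \<otimes> (y \<otimes> ?i) = \<one>"
    using assms i by (metis m_assoc Units_r_inv)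
  have 2: "(?i \<otimes> y) \<otimes> x = \<one>"
    using assms i by (metis m_assoc Units_l_inv)
  have "y \<otimes> ?i = ?i \<otimes> y"
    using inv_unique[OF 2 1] assms i by simp
  with 1 2 show ?thesis
    using assms i by (intro Units_I[of _ "y \<otimes> ?i"]) auto
qed

end

section \<open>Completeness and closed sets in terms of norms of differences\<close>

context complex_normed_algebra
begin

lemma nrm_zero [simp]: "nrm A \<zero> = 0"
  by (simp add: nrm_eq_0_iff)

lemma nrm_diff_commute: "x \<in> carrier A \<Longrightarrow> y \<in> carrier A \<Longrightarrow> nrm A (x \<ominus> y) = nrm A (y \<ominus> x)"
  using nrm_minus[of "x \<ominus> y"] by (simp add: minus_diff)

lemma nrm_diff_triangle:
  assumes "x \<in> carrier A" "y \<in> carrier A" "z \<in> carrier A"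
  shows "nrm A (x \<ominus> z) \<le> nrm A (x \<ominus> y) + nrm A (y \<ominus> z)"
  using nrm_triangle[of "x \<ominus> y" "y \<ominus> z"] assms by (simp add: diff_add_diff)

lemma nrm_diff_le: "x \<in> carrier A \<Longrightarrow> y \<in> carrier A \<Longrightarrow> nrm A (x \<ominus> y) \<le> nrm A x + nrm A y"
  using nrm_triangle[of x "\<ominus> y"] by (simp add: a_minus_def nrm_minus)

lemma nrm_reverse_triangle:
  "x \<in> carrier A \<Longrightarrow> y \<in> carrier A \<Longrightarrow> \<bar>nrm A x - nrm A y\<bar> \<le> nrm A (x \<ominus> y)"
  using nrm_triangle[of "x \<ominus> y" y] nrm_triangle[of "y \<ominus> x" x] nrm_diff_commute[of x y] by auto

text \<open>Frees the later completeness proofs from the case distinction in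
  \<open>alg_dist\<close>: it remains to find norm limits of norm-Cauchy sequences.\<close>

lemma mcomplete_iff_nrm:
  "mcomplete \<longleftrightarrow> (\<forall>s. (\<forall>n. s n \<in> carrier A) \<and>
      (\<forall>\<epsilon>>0. \<exists>N. \<forall>m\<ge>N. \<forall>n\<ge>N. nrm A (s m \<ominus> s n) < \<epsilon>) \<longrightarrow>
      (\<exists>l\<in>carrier A. (\<lambda>n. nrm A (s n \<ominus> l)) \<longlonglongrightarrow> 0))" (is "?L \<longleftrightarrow> ?R")
proof -
  have lim: "(\<exists>l. limitin mtopology s l sequentially) \<longleftrightarrow>
      (\<exists>l\<in>carrier A. (\<lambda>n. nrm A (s n \<ominus> l)) \<longlonglongrightarrow> 0)" if "\<forall>n. s n \<in> carrier A" for s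
    using that by (auto simp: limitin_metric_dist_null alg_dist_def Bex_def cong: conj_cong)
  have cau: "MCauchy s \<longleftrightarrow> (\<forall>n. s n \<in> carrier A) \<and>
      (\<forall>\<epsilon>>0. \<exists>N. \<forall>m\<ge>N. \<forall>n\<ge>N. nrm A (s m \<ominus> s n) < \<epsilon>)" for s
  proof (cases "\<forall>n. s n \<in> carrier A")
    case True
    then have "alg_dist A (s m) (s n) = nrm A (s m \<ominus> s n)" for m n by (simp add: alg_dist_def)
    then show ?thesis using True by (auto simp: MCauchy_def)
  qed (auto simp: MCauchy_def)
  show ?thesis
    unfolding mcomplete_def
  proof (rule all_cong1)
    fix s
    show "(MCauchy s \<longrightarrow> (\<exists>l. limitin mtopology s l sequentially)) \<longleftrightarrow>
        ((\<forall>n. s n \<in> carrier A) \<and>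
          (\<forall>\<epsilon>>0. \<exists>N. \<forall>m\<ge>N. \<forall>n\<ge>N. nrm A (s m \<ominus> s n) < \<epsilon>) \<longrightarrow>
          (\<exists>l\<in>carrier A. (\<lambda>n. nrm A (s n \<ominus> l)) \<longlonglongrightarrow> 0))"
      unfolding cau by (rule imp_cong[OF refl], rule lim) (erule conjunct1)
  qed
qed

lemma closedin_iff_nrm:
  "closedin mtopology S \<longleftrightarrow> S \<subseteq> carrier A \<and>
    (\<forall>s. \<forall>l\<in>carrier A. (\<forall>n. s n \<in> S) \<and> (\<lambda>n. nrm A (s n \<ominus> l)) \<longlonglongrightarrow> 0 \<longrightarrow> l \<in> S)"
proof (cases "S \<subseteq> carrier A")
  case True
  have "range s \<subseteq> S \<and> limitin mtopology s l sequentially \<longleftrightarrow>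
      l \<in> carrier A \<and> (\<forall>n. s n \<in> S) \<and> (\<lambda>n. nrm A (s n \<ominus> l)) \<longlonglongrightarrow> 0" for s l
  proof (cases "\<forall>n. s n \<in> S")
    case S: True
    with True have "s n \<in> carrier A" for n by blast
    with S show ?thesis
      by (auto simp: limitin_metric_dist_null alg_dist_def)
  qed auto
  then show ?thesis
    using True unfolding metric_closedin_iff_sequentially_closed
    by (simp add: Ball_def imp_conjL) (rule iffI; iprover)
qed (simp add: metric_closedin_iff_sequentially_closed)

lemma closedin_limit:
  assumes "closedin mtopology S" "\<And>n. s n \<in> S" "l \<in> carrier A" "(\<lambda>n. nrm A (s n \<ominus> l)) \<longlonglongrightarrow> 0"
  shows "l \<in> S"
proof -
  have "\<forall>s. \<forall>l\<in>carrier A. (\<forall>n. s n \<in> S) \<and> (\<lambda>n. nrm A (s n \<ominus> l)) \<longlonglongrightarrow> 0 \<longrightarrow> l \<in> S"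
    using assms(1) unfolding closedin_iff_nrm by (rule conjunct2)
  from this[THEN spec, THEN bspec, OF assms(3), THEN mp, OF conjI] show ?thesis
    using assms(2,4) by blast
qed

end

section \<open>Neumann inversion and compactness of the spectrum\<close>

context complex_banach_algebra
begin

text \<open>The two-sided inverse of \<open>\<one> \<ominus> x\<close> is the fixed point of \<open>s \<mapsto> \<one> \<oplus> x \<otimes> s\<close>
  and also of \<open>s \<mapsto> \<one> \<oplus> s \<otimes> x\<close>.\<close>
lemma one_minus_Units:
  assumes x: "x \<in> carrier A" and lt: "nrm A x < 1"
  shows "\<one> \<ominus> x \<in> Units A"
proof -
  \<comment> \<open>Banach's fixed point theorem with contraction constant \<open>nrm A x\<close>
    takes the place of summing the geometric series.\<close>
  have key: "\<exists>s\<in>carrier A. f s = s"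
    if f: "\<And>s. s \<in> carrier A \<Longrightarrow> f s \<in> carrier A"
      and d: "\<And>s t. s \<in> carrier A \<Longrightarrow> t \<in> carrier A \<Longrightarrow> nrm A (f s \<ominus> f t) \<le> nrm A x * nrm A (s \<ominus> t)"
    for f
  proof -
    have ne: "carrier A \<noteq> {}" by blast
    have con: "alg_dist A (f s) (f t) \<le> nrm A x * alg_dist A s t"
      if "s \<in> carrier A" "t \<in> carrier A" for s t
      using d[OF that] f that by (simp add: alg_dist_def)
    obtain s where "s \<in> carrier A" "f s = s"
      using Banach_fixedpoint_thm[OF complete ne _ lt con] f by auto
    then show ?thesis by blast
  qed
  have e1: "(\<one> \<oplus> u) \<ominus> (\<one> \<oplus> v) = u \<ominus> v" if "u \<in> carrier A" "v \<in> carrier A" for u v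
    using that by (simp add: add_diff_interchange)
  have "\<exists>s\<in>carrier A. \<one> \<oplus> x \<otimes> s = s"
    by (rule key) (use x nrm_mult in \<open>auto simp: e1 diff_distrib_left[symmetric]\<close>)
  then obtain s where s: "s \<in> carrier A" "\<one> \<oplus> x \<otimes> s = s" by blast
  have "\<exists>s\<in>carrier A. \<one> \<oplus> s \<otimes> x = s"
    by (rule key) (use x nrm_mult[OF _ x] in \<open>auto simp: e1 diff_distrib_right[symmetric] mult.commute[of "nrm A x"]\<close>)
  then obtain t where t: "t \<in> carrier A" "\<one> \<oplus> t \<otimes> x = t" by blast
  have 1: "(\<one> \<ominus> x) \<otimes> s = \<one>"
    using s x by (simp add: diff_distrib_right diff_eq_iff)
  have 2: "t \<otimes> (\<one> \<ominus> x) = \<one>"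
    using t x by (simp add: diff_distrib_left diff_eq_iff)
  have "t = s"
    using inv_unique[OF 2 1] s t x by simp
  with 1 2 s x show ?thesis
    by (intro Units_I[of _ s]) auto
qed

text \<open>Factor out \<open>u\<close>: the other factor is
  \<open>\<one> \<ominus> inv u \<otimes> x\<close>, which is within distance less than 1 of the
  unit.\<close>

lemma Units_perturb:
  assumes u: "u \<in> Units A" and x: "x \<in> carrier A" and lt: "nrm A (inv u) * nrm A x < 1"
  shows "u \<ominus> x \<in> Units A"
proof -
  have uc: "u \<in> carrier A" "inv u \<in> carrier A" using u by auto
  have "\<one> \<ominus> inv u \<otimes> x \<in> Units A"
    using uc x lt nrm_mult[of "inv u" x] by (intro one_minus_Units) auto
  then have "u \<otimes> (\<one> \<ominus> inv u \<otimes> x) \<in> Units A"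
    using u by blast
  moreover have "u \<otimes> (\<one> \<ominus> inv u \<otimes> x) = u \<ominus> x"
    using uc x u by (simp add: diff_distrib_left m_assoc[symmetric])
  ultimately show ?thesis by simp
qed

lemma scalar_minus_Units:
  assumes x: "x \<in> carrier A" and lt: "nrm A x < cmod c"
  shows "c \<odot> \<one> \<ominus> x \<in> Units A"
proof -
  have c: "c \<noteq> 0" using lt nrm_nonneg[OF x] by auto
  have "\<one> \<ominus> inverse c \<odot> x \<in> Units A"
    using x lt c by (intro one_minus_Units) (auto simp: nrm_smult norm_inverse norm_divide field_simps)
  then have "c \<odot> (\<one> \<ominus> inverse c \<odot> x) \<in> Units A"
    using c by (rule scale_Units)
  then show ?thesis
    using x c by (simp add: scale_diff_right)
qed

lemma spectrum_norm_le: "x \<in> carrier A \<Longrightarrow> z \<in> spectrum A x \<Longrightarrow> cmod z \<le> nrm A x"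
  using scalar_minus_Units[of x z] unfolding spectrum_def by fastforce

lemma bounded_spectrum: "x \<in> carrier A \<Longrightarrow> bounded (spectrum A x)"
  unfolding bounded_iff using spectrum_norm_le by blast

lemma closed_spectrum:
  assumes x: "x \<in> carrier A"
  shows "closed (spectrum A x)"
proof -
  have "\<exists>e>0. ball z e \<subseteq> - spectrum A x" if z: "z \<in> - spectrum A x" for z
  proof -
    define u where "u = z \<odot> \<one> \<ominus> x"
    have u: "u \<in> Units A" using z by (simp add: spectrum_def u_def)
    \<comment> \<open>The ball of radius \<open>1 / K\<close> about \<open>z\<close> will avoid the
      spectrum: there \<open>(z - w) \<odot> \<one>\<close> is a small enough perturbation of
      \<open>u\<close>. The added 1 keeps \<open>K\<close> positive.\<close>
    define K where "K = nrm A (inv u) * nrm A \<one> + 1"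
    have "0 \<le> nrm A (inv u)" "0 \<le> nrm A \<one>" using u nrm_nonneg by auto
    then have K: "K > 0" unfolding K_def by (smt (verit) mult_nonneg_nonneg)
    have "w \<in> - spectrum A x" if w: "w \<in> ball z (1 / K)" for w
    proof -
      have d: "cmod (z - w) * K < 1"
        using w K by (simp add: dist_norm field_simps)
      have "nrm A (inv u) * (cmod (z - w) * nrm A \<one>) \<le> cmod (z - w) * K"
        unfolding K_def by (simp add: algebra_simps)
      then have "nrm A (inv u) * nrm A ((z - w) \<odot> \<one>) < 1"
        using d by (simp add: nrm_smult)
      then have "u \<ominus> (z - w) \<odot> \<one> \<in> Units A"
        using u by (intro Units_perturb) auto
      moreover have "u \<ominus> (z - w) \<odot> \<one> = w \<odot> \<one> \<ominus> x"
        unfolding u_def using x by (simp add: scale_diff_left a_minus_def minus_add a_ac r_neg r_neg1 r_neg2)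
      ultimately show ?thesis by (simp add: spectrum_def)
    qed
    then show ?thesis using K by (intro exI[of _ "1 / K"]) auto
  qed
  then show ?thesis
    unfolding closed_def open_contains_ball by blast
qed

end

section \<open>The Hahn--Banach theorem\<close>

text \<open>Homogeneity is an inequality only; rescaling by the reciprocal gives the reverse one.
  The value 0 off the carrier lets the pointwise order on the full function type serve in Zorn's
  lemma, with minimality expressed as equality of functions.\<close>

definition (in complex_algebra) sublinear :: "('a \<Rightarrow> real) \<Rightarrow> bool"
  where "sublinear q \<longleftrightarrow>
    (\<forall>x\<in>carrier A. \<forall>y\<in>carrier A. q (x \<oplus> y) \<le> q x + q y) \<and>
    (\<forall>x\<in>carrier A. \<forall>t>0. q (complex_of_real t \<odot> x) \<le> t * q x) \<and>
    (\<forall>x. x \<notin> carrier A \<longrightarrow> q x = 0)"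

context complex_algebra
begin

lemma sublinearD:
  assumes "sublinear q"
  shows "\<lbrakk>x \<in> carrier A; y \<in> carrier A\<rbrakk> \<Longrightarrow> q (x \<oplus> y) \<le> q x + q y"
    and "\<lbrakk>x \<in> carrier A; t > 0\<rbrakk> \<Longrightarrow> q (complex_of_real t \<odot> x) \<le> t * q x"
    and "x \<notin> carrier A \<Longrightarrow> q x = 0"
  using assms unfolding sublinear_def by auto

text \<open>Scaling \<open>\<zero>\<close> by 2 bounds the value from below, scaling by 1/2 from
  above.\<close>

lemma sublinear_zero: "sublinear q \<Longrightarrow> q \<zero> = 0"
  using sublinearD(2)[of q \<zero> 2] sublinearD(2)[of q \<zero> "1/2"] by simp

lemma sublinear_minus: "sublinear q \<Longrightarrow> x \<in> carrier A \<Longrightarrow> - q (\<ominus> x) \<le> q x"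
  using sublinearD(1)[of q x "\<ominus> x"] by (simp add: r_neg sublinear_zero)

lemma sublinear_scale_ge:
  assumes q: "sublinear q" and x: "x \<in> carrier A" and t: "t \<ge> 0"
  shows "t * q x \<le> q (complex_of_real t \<odot> x)"
proof (cases "t = 0")
  case False
  then have "q x \<le> inverse t * q (complex_of_real t \<odot> x)"
    using sublinearD(2)[OF q, of "complex_of_real t \<odot> x" "inverse t"] x t
    by (simp flip: of_real_mult)
  then show ?thesis
    using t False by (simp add: field_simps)
qed (use x sublinear_zero[OF q] in auto)

text \<open>Zorn's lemma for the reversed order. A chain has a pointwise infimum since
  \<open>- p (\<ominus> x)\<close> bounds all values at \<open>x\<close> from below.\<close>

lemma minimal_sublinear_exists:
  assumes p: "sublinear p"
  shows "\<exists>q. sublinear q \<and> q \<le> p \<and> (\<forall>r. sublinear r \<and> r \<le> q \<longrightarrow> r = q)"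
proof -
  define S where "S = {q. sublinear q \<and> q \<le> p}"
  have lower: "- p (\<ominus> x) \<le> q x" if "q \<in> S" "x \<in> carrier A" for q x
  proof -
    have "q (\<ominus> x) \<le> p (\<ominus> x)" using that by (simp add: S_def le_fun_def)
    then show ?thesis using sublinear_minus[of q x] that by (simp add: S_def)
  qed
  have "\<exists>m\<in>S. \<forall>a\<in>S. a \<le> m \<longrightarrow> a = m"
  proof (rule predicate_Zorn[of S "\<lambda>q q'. q' \<le> q"])
    show "partial_order_on S (relation_of (\<lambda>q q'. q' \<le> q) S)"
      by (rule partial_order_on_relation_ofI) auto
  next
    fix C assume "C \<in> Chains (relation_of (\<lambda>q q'. q' \<le> q) S)"
    then have CS: "C \<subseteq> S" and total: "\<And>q q'. q \<in> C \<Longrightarrow> q' \<in> C \<Longrightarrow> q \<le> q' \<or> q' \<le> q"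
      unfolding Chains_def relation_of_def by auto
    show "\<exists>u\<in>S. \<forall>q\<in>C. u \<le> q"
    proof (cases "C = {}")
      case True
      then show ?thesis using p by (auto simp: S_def)
    next
      case False
      define u where "u = (\<lambda>x. INF q\<in>C. q x)"
      have bdd: "bdd_below ((\<lambda>q. q x) ` C)" for x
      proof (cases "x \<in> carrier A")
        case True
        then show ?thesis using lower CS by (intro bdd_belowI[of _ "- p (\<ominus> x)"]) auto
      next
        case False
        then show ?thesis using CS sublinearD(3) by (intro bdd_belowI[of _ 0]) (force simp: S_def)
      qed
      have le: "u x \<le> q x" if "q \<in> C" for q x
        unfolding u_def using bdd that by (rule cINF_lower)
      have ge: "m \<le> u x" if "\<And>q. q \<in> C \<Longrightarrow> m \<le> q x" for m x
        unfolding u_def using False that by (intro cINF_greatest)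
      have sub: "sublinear q" if "q \<in> C" for q using CS that by (auto simp: S_def)
      have add: "u (x \<oplus> y) \<le> u x + u y" if x: "x \<in> carrier A" and y: "y \<in> carrier A" for x y
      proof -
        have "u (x \<oplus> y) \<le> q x + q' y" if q: "q \<in> C" and q': "q' \<in> C" for q q'
        proof -
          \<comment> \<open>Subadditivity passes to the infimum because \<open>C\<close> is a chain:
            the smaller of \<open>q\<close> and \<open>q'\<close> serves for both summands.\<close>
          obtain r where r: "r \<in> C" "r \<le> q" "r \<le> q'" using total[OF q q'] q q' by blast
          have "u (x \<oplus> y) \<le> r x + r y"
            using le[OF r(1)] sublinearD(1)[OF sub[OF r(1)] x y] by (meson order_trans)
          also have "\<dots> \<le> q x + q' y" using r(2,3) by (simp add: le_fun_def add_mono)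
          finally show ?thesis .
        qed
        then have "u (x \<oplus> y) - q' y \<le> u x" if "q' \<in> C" for q'
          using that by (intro ge) (simp add: algebra_simps)
        then have "u (x \<oplus> y) - u x \<le> u y"
          by (intro ge) (simp add: algebra_simps)
        then show ?thesis by simp
      qed
      have scale: "u (complex_of_real t \<odot> x) \<le> t * u x" if x: "x \<in> carrier A" and t: "t > 0" for x t
      proof -
        have "u (complex_of_real t \<odot> x) / t \<le> q x" if "q \<in> C" for q
          using le[OF that, of "complex_of_real t \<odot> x"] sublinearD(2)[OF sub[OF that] x t] t
          by (simp add: field_simps)
        then have "u (complex_of_real t \<odot> x) / t \<le> u x" by (rule ge)
        then show ?thesis using t by (simp add: field_simps)
      qed
      have "u x = 0" if "x \<notin> carrier A" for x
      proof -
        have "u x = (INF q\<in>C. 0)"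
          unfolding u_def using sublinearD(3)[OF sub that] by (intro INF_cong) auto
        then show ?thesis using False by simp
      qed
      then have "sublinear u" unfolding sublinear_def using add scale by blast
      moreover obtain q where "q \<in> C" using False by blast
      then have "u \<le> q" "q \<le> p" using le CS by (auto simp: S_def le_fun_def)
      then have "u \<le> p" by (rule order_trans)
      ultimately show ?thesis using le by (auto simp: S_def le_fun_def)
    qed
  qed
  then show ?thesis
    unfolding S_def by (metis (no_types, lifting) mem_Collect_eq order_trans)
qed

text \<open>A modification of \<open>q\<close> that detects nonlinearity along \<open>y\<close>: at
  \<open>\<ominus> y\<close> the choice \<open>t = 1\<close> gives at most \<open>- q y\<close>, so
  the result lies strictly below \<open>q\<close> unless
  \<open>q (\<ominus> y) = - q y\<close>.\<close>

definition shift_functional :: "('a \<Rightarrow> real) \<Rightarrow> 'a \<Rightarrow> 'a \<Rightarrow> real"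
  where "shift_functional q y x =
    (if x \<in> carrier A then INF t\<in>{0..}. q (x \<oplus> complex_of_real t \<odot> y) - t * q y else 0)"

lemma shift_functional:
  assumes q: "sublinear q" and y: "y \<in> carrier A"
  shows "sublinear (shift_functional q y)"
    and "shift_functional q y \<le> q"
    and "\<lbrakk>x \<in> carrier A; t \<ge> 0\<rbrakk> \<Longrightarrow>
      shift_functional q y x \<le> q (x \<oplus> complex_of_real t \<odot> y) - t * q y"
proof -
  let ?f = "\<lambda>x t. q (x \<oplus> complex_of_real t \<odot> y) - t * q y"
  let ?s = "shift_functional q y"
  \<comment> \<open>A lower bound that does not depend on \<open>t\<close>, so that the infimum is a
    genuine one. It comes from writing \<open>t y\<close> as \<open>(x + t y) - x\<close>.\<close>
  have lower: "- q (\<ominus> x) \<le> ?f x t" if x: "x \<in> carrier A" and t: "t \<ge> 0" for x t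
  proof -
    let ?ty = "complex_of_real t \<odot> y"
    have "t * q y \<le> q ((x \<oplus> ?ty) \<oplus> \<ominus> x)"
      using sublinear_scale_ge[OF q y t] x y by (simp add: a_ac r_neg2)
    also have "\<dots> \<le> q (x \<oplus> ?ty) + q (\<ominus> x)"
      using x y by (intro sublinearD(1)[OF q]) auto
    finally show ?thesis by simp
  qed
  show le: "?s x \<le> ?f x t" if x: "x \<in> carrier A" and t: "t \<ge> 0" for x t
    unfolding shift_functional_def using x t lower[OF x]
    by (auto intro!: cINF_lower bdd_belowI[of _ "- q (\<ominus> x)"])
  have ge: "m \<le> ?s x" if "x \<in> carrier A" "\<And>t. t \<ge> 0 \<Longrightarrow> m \<le> ?f x t" for m x
    unfolding shift_functional_def using that by (auto intro!: cINF_greatest)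
  show "?s \<le> q"
  proof (rule le_funI)
    fix x show "?s x \<le> q x"
      using le[of x 0] y sublinearD(3)[OF q, of x] by (cases "x \<in> carrier A") (auto simp: shift_functional_def)
  qed
  have "?s (x \<oplus> x') \<le> ?s x + ?s x'" if x: "x \<in> carrier A" and x': "x' \<in> carrier A" for x x'
  proof -
    have "?s (x \<oplus> x') \<le> ?f x t + ?f x' t'" if t: "t \<ge> 0" "t' \<ge> 0" for t t'
    proof -
      have "?s (x \<oplus> x') \<le> ?f (x \<oplus> x') (t + t')"
        using x x' t by (intro le) auto
      also have "x \<oplus> x' \<oplus> complex_of_real (t + t') \<odot> y
          = (x \<oplus> complex_of_real t \<odot> y) \<oplus> (x' \<oplus> complex_of_real t' \<odot> y)"
        using x x' y by (simp add: scale_add_left a_ac)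
      also have "q \<dots> - (t + t') * q y \<le> ?f x t + ?f x' t'"
        using sublinearD(1)[OF q, of "x \<oplus> complex_of_real t \<odot> y" "x' \<oplus> complex_of_real t' \<odot> y"] x x' y
        by (simp add: algebra_simps)
      finally show ?thesis .
    qed
    then have "?s (x \<oplus> x') - ?f x' t' \<le> ?s x" if "t' \<ge> 0" for t'
      using that x by (intro ge) (auto simp: algebra_simps)
    then have "?s (x \<oplus> x') - ?s x \<le> ?s x'"
      using x' by (intro ge) (auto simp: algebra_simps)
    then show ?thesis by simp
  qed
  moreover have "?s (complex_of_real r \<odot> x) \<le> r * ?s x" if x: "x \<in> carrier A" and r: "r > 0" for x r
  proof -
    have "?s (complex_of_real r \<odot> x) / r \<le> ?f x t" if t: "t \<ge> 0" for t
    proof -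
      have "?s (complex_of_real r \<odot> x) \<le> ?f (complex_of_real r \<odot> x) (r * t)"
        using x r t by (intro le) auto
      also have "complex_of_real r \<odot> x \<oplus> complex_of_real (r * t) \<odot> y
          = complex_of_real r \<odot> (x \<oplus> complex_of_real t \<odot> y)"
        using x y by (simp add: scale_add_right)
      also have "q \<dots> - r * t * q y \<le> r * ?f x t"
        using sublinearD(2)[OF q _ r, of "x \<oplus> complex_of_real t \<odot> y"] x y by (simp add: algebra_simps)
      finally show ?thesis by (subst pos_divide_le_eq[OF r]) (simp only: mult.commute)
    qed
    then have "?s (complex_of_real r \<odot> x) / r \<le> ?s x"
      using x by (intro ge) auto
    then show ?thesis by (simp only: pos_divide_le_eq[OF r] mult.commute)
  qed
  moreover have "?s x = 0" if "x \<notin> carrier A" for x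
    using that by (simp add: shift_functional_def)
  ultimately show "sublinear ?s" unfolding sublinear_def by blast
qed

text \<open>A minimal sublinear functional coincides with each of its \<^const>\<open>shift_functional\<close>s, which
  makes it superadditive.\<close>
lemma minimal_sublinear_linear:
  assumes q: "sublinear q" and min: "\<forall>r. sublinear r \<and> r \<le> q \<longrightarrow> r = q"
  shows "\<lbrakk>x \<in> carrier A; y \<in> carrier A\<rbrakk> \<Longrightarrow> q (x \<oplus> y) = q x + q y"
    and "x \<in> carrier A \<Longrightarrow> q (\<ominus> x) = - q x"
    and "x \<in> carrier A \<Longrightarrow> q (complex_of_real t \<odot> x) = t * q x"
proof -
  show add: "q (x \<oplus> y) = q x + q y" if x: "x \<in> carrier A" and y: "y \<in> carrier A" for x y
  proof -
    have "shift_functional q y = q"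
      using min shift_functional(1,2)[OF q y] by blast
    then have "q x \<le> q (x \<oplus> y) - q y"
      using shift_functional(3)[OF q y x, of 1] y by simp
    then show ?thesis using sublinearD(1)[OF q x y] by simp
  qed
  show neg: "q (\<ominus> x) = - q x" if "x \<in> carrier A" for x
    using add[of x "\<ominus> x"] that sublinear_zero[OF q] by (simp add: r_neg)
  have pos: "q (complex_of_real t \<odot> x) = t * q x" if "x \<in> carrier A" "t \<ge> 0" for x t
    using sublinear_scale_ge[OF q that] sublinearD(2)[OF q that(1), of t] that sublinear_zero[OF q]
    by (cases "t = 0") auto
  show "q (complex_of_real t \<odot> x) = t * q x" if "x \<in> carrier A" for x t
    using pos[of x t] pos[of x "- t"] that neg[of "complex_of_real t \<odot> x"] by (cases "t \<ge> 0") auto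
qed

text \<open>Minimality below the \<^const>\<open>shift_functional\<close> of \<open>p\<close> in the direction \<open>b\<close> forces the value \<open>p b\<close> at \<open>b\<close>.\<close>
theorem Hahn_Banach_real:
  assumes p: "sublinear p" and b: "b \<in> carrier A"
  obtains f where "\<And>x. f x \<le> p x" "f b = p b" "\<And>x. x \<notin> carrier A \<Longrightarrow> f x = 0"
    "\<And>x y. \<lbrakk>x \<in> carrier A; y \<in> carrier A\<rbrakk> \<Longrightarrow> f (x \<oplus> y) = f x + f y"
    "\<And>t x. x \<in> carrier A \<Longrightarrow> f (complex_of_real t \<odot> x) = t * f x"
proof -
  obtain q where q: "sublinear q" "q \<le> shift_functional p b"
    and min: "\<forall>r. sublinear r \<and> r \<le> q \<longrightarrow> r = q"
    using minimal_sublinear_exists[OF shift_functional(1)[OF p b]] by blast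
  note lin = minimal_sublinear_linear[OF q(1) min]
  have le: "q x \<le> p x" for x
    using q(2) shift_functional(2)[OF p b] by (meson le_fun_def order_trans)
  have "q (\<ominus> b) \<le> - p b"
    using q(2) shift_functional(3)[OF p b, of "\<ominus> b" 1] b sublinear_zero[OF p]
    by (simp add: le_fun_def l_neg) (meson order_trans)
  then have "q b = p b" using lin(2)[OF b] le[of b] by simp
  then show thesis
    using that[of q] le lin sublinearD(3)[OF q(1)] by blast
qed

end

text \<open>Functionals vanish outside the carrier, so that rank-one operators built from them do, too.\<close>
definition dual :: "'a normed_alg \<Rightarrow> ('a \<Rightarrow> complex) set"
  where "dual A = {f. (\<forall>x. x \<notin> carrier A \<longrightarrow> f x = 0) \<and>
    (\<forall>x\<in>carrier A. \<forall>y\<in>carrier A. f (x \<oplus>\<^bsub>A\<^esub> y) = f x + f y) \<and>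
    (\<forall>x\<in>carrier A. \<forall>c. f (c \<odot>\<^bsub>A\<^esub> x) = c * f x) \<and>
    (\<exists>K. \<forall>x\<in>carrier A. cmod (f x) \<le> K * nrm A x)}"

section \<open>Bounded complex functionals and separation from a subspace\<close>

context complex_normed_algebra
begin

lemma dualD:
  assumes "f \<in> dual A"
  shows "x \<notin> carrier A \<Longrightarrow> f x = 0"
    and "\<lbrakk>x \<in> carrier A; y \<in> carrier A\<rbrakk> \<Longrightarrow> f (x \<oplus> y) = f x + f y"
    and "x \<in> carrier A \<Longrightarrow> f (c \<odot> x) = c * f x"
  using assms unfolding dual_def by auto

lemma dualI:
  assumes "\<And>x. x \<notin> carrier A \<Longrightarrow> f x = 0"
    and "\<And>x y. \<lbrakk>x \<in> carrier A; y \<in> carrier A\<rbrakk> \<Longrightarrow> f (x \<oplus> y) = f x + f y"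
    and "\<And>c x. x \<in> carrier A \<Longrightarrow> f (c \<odot> x) = c * f x"
    and "\<And>x. x \<in> carrier A \<Longrightarrow> cmod (f x) \<le> K * nrm A x"
  shows "f \<in> dual A"
  using assms unfolding dual_def by blast

lemma dual_bound:
  assumes "f \<in> dual A"
  obtains K where "K \<ge> 0" "\<And>x. x \<in> carrier A \<Longrightarrow> cmod (f x) \<le> K * nrm A x"
proof -
  obtain K where K: "\<forall>x\<in>carrier A. cmod (f x) \<le> K * nrm A x"
    using assms unfolding dual_def by auto
  have "cmod (f x) \<le> max K 0 * nrm A x" if "x \<in> carrier A" for x
    using K that mult_right_mono[of K "max K 0" "nrm A x"] nrm_nonneg[OF that] by fastforce
  then show thesis using that[of "max K 0"] by simp
qed

lemma dual_zero: "f \<in> dual A \<Longrightarrow> f \<zero> = 0"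
  using dualD(3)[of f \<zero> 0] by simp

lemma dual_minus: "f \<in> dual A \<Longrightarrow> x \<in> carrier A \<Longrightarrow> f (\<ominus> x) = - f x"
  using dualD(3)[of f x "- 1"] by simp

lemma dual_diff: "f \<in> dual A \<Longrightarrow> x \<in> carrier A \<Longrightarrow> y \<in> carrier A \<Longrightarrow> f (x \<ominus> y) = f x - f y"
  by (simp add: a_minus_def dualD dual_minus)

lemma dual_scale: "f \<in> dual A \<Longrightarrow> (\<lambda>x. c * f x) \<in> dual A"
proof -
  assume f: "f \<in> dual A"
  obtain K where "K \<ge> 0" "\<And>x. x \<in> carrier A \<Longrightarrow> cmod (f x) \<le> K * nrm A x"
    using dual_bound[OF f] by blast
  then have "cmod (c * f x) \<le> (cmod c * K) * nrm A x" if "x \<in> carrier A" for x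
    using that by (simp add: norm_mult mult_left_mono mult.assoc)
  then show ?thesis
    using dualD[OF f] by (intro dualI[where K = "cmod c * K"]) (simp_all add: algebra_simps)
qed

text \<open>The real Hahn-Banach theorem is applied to the distance from \<open>M\<close>. Being
  dominated by this seminorm forces a functional both to vanish on \<open>M\<close> and to be
  bounded, while the distance of \<open>b\<close> keeps its value at \<open>b\<close>
  nonzero.\<close>

theorem separating_functional:
  assumes M: "M \<subseteq> carrier A" "\<zero> \<in> M" "\<And>m n. m \<in> M \<Longrightarrow> n \<in> M \<Longrightarrow> m \<oplus> n \<in> M"
      "\<And>c m. m \<in> M \<Longrightarrow> c \<odot> m \<in> M"
    and b: "b \<in> carrier A" and \<delta>: "\<delta> > 0" "\<And>m. m \<in> M \<Longrightarrow> \<delta> \<le> nrm A (b \<ominus> m)"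
  obtains f where "f \<in> dual A" "f b = 1" "\<And>m. m \<in> M \<Longrightarrow> f m = 0"
proof -
  define p where "p x = (if x \<in> carrier A then INF m\<in>M. nrm A (x \<ominus> m) else 0)" for x
  have Mc: "m \<in> carrier A" if "m \<in> M" for m using M(1) that by blast
  have p_le: "p x \<le> nrm A (x \<ominus> m)" if "x \<in> carrier A" "m \<in> M" for x m
    unfolding p_def using that Mc by (auto intro!: cINF_lower bdd_belowI[of _ 0] nrm_nonneg)
  have p_ge: "k \<le> p x" if "x \<in> carrier A" "\<And>m. m \<in> M \<Longrightarrow> k \<le> nrm A (x \<ominus> m)" for k x
    unfolding p_def using that M(2) by (auto intro!: cINF_greatest)
  have p_nonneg: "0 \<le> p x" if "x \<in> carrier A" for x
    using that Mc by (intro p_ge nrm_nonneg) auto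
  have p_nrm: "p x \<le> nrm A x" if "x \<in> carrier A" for x
    using p_le[OF that M(2)] that by simp
  have add: "p (x \<oplus> y) \<le> p x + p y" if x: "x \<in> carrier A" and y: "y \<in> carrier A" for x y
  proof -
    have "p (x \<oplus> y) \<le> nrm A (x \<ominus> m) + nrm A (y \<ominus> n)" if mn: "m \<in> M" "n \<in> M" for m n
    proof -
      have "p (x \<oplus> y) \<le> nrm A ((x \<oplus> y) \<ominus> (m \<oplus> n))"
        using x y mn M(3) by (intro p_le) auto
      also have "\<dots> = nrm A ((x \<ominus> m) \<oplus> (y \<ominus> n))"
        using x y mn Mc by (simp add: add_diff_interchange)
      also have "\<dots> \<le> nrm A (x \<ominus> m) + nrm A (y \<ominus> n)"
        using x y mn Mc by (intro nrm_triangle) auto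
      finally show ?thesis .
    qed
    then have "p (x \<oplus> y) - nrm A (y \<ominus> n) \<le> p x" if "n \<in> M" for n
      using that x by (intro p_ge) (auto simp: algebra_simps)
    then have "p (x \<oplus> y) - p x \<le> p y"
      using y by (intro p_ge) (auto simp: algebra_simps)
    then show ?thesis by simp
  qed
  have scale: "p (c \<odot> x) \<le> cmod c * p x" if x: "x \<in> carrier A" and c: "c \<noteq> 0" for x c
  proof -
    have "p (c \<odot> x) / cmod c \<le> nrm A (x \<ominus> m)" if m: "m \<in> M" for m
    proof -
      have "p (c \<odot> x) \<le> nrm A (c \<odot> x \<ominus> c \<odot> m)"
        using x m M(4) by (intro p_le) auto
      also have "\<dots> = cmod c * nrm A (x \<ominus> m)"
        using x m Mc by (simp add: nrm_smult flip: scale_diff_right)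
      finally show ?thesis using c by (simp add: field_simps)
    qed
    then have "p (c \<odot> x) / cmod c \<le> p x" using x by (intro p_ge) auto
    then show ?thesis using c by (simp add: field_simps)
  qed
  have "p (complex_of_real t \<odot> x) \<le> t * p x" if "x \<in> carrier A" "t > 0" for x t
    using scale[OF that(1), of "complex_of_real t"] that(2) by simp
  moreover have "p x = 0" if "x \<notin> carrier A" for x
    using that by (simp add: p_def)
  ultimately have "sublinear p"
    unfolding sublinear_def using add by blast
  then obtain g where g: "\<And>x. g x \<le> p x" "g b = p b" "\<And>x. x \<notin> carrier A \<Longrightarrow> g x = 0"
    "\<And>x y. \<lbrakk>x \<in> carrier A; y \<in> carrier A\<rbrakk> \<Longrightarrow> g (x \<oplus> y) = g x + g y"
    "\<And>t x. x \<in> carrier A \<Longrightarrow> g (complex_of_real t \<odot> x) = t * g x"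
    using Hahn_Banach_real[OF _ b] by blast
  have g_neg: "g (\<ominus> x) = - g x" if "x \<in> carrier A" for x
    using g(5)[OF that, of "- 1"] that by simp
  have g_abs: "\<bar>g x\<bar> \<le> p x" if x: "x \<in> carrier A" for x
    using g(1)[of x] g(1)[of "\<ominus> x"] g_neg[OF x] scale[OF x, of "- 1"] x by auto
  \<comment> \<open>The complex functional with real part \<open>g\<close>: complex homogeneity
    dictates the imaginary part.\<close>
  define h where "h x = (if x \<in> carrier A then Complex (g x) (- g (\<i> \<odot> x)) else 0)" for x
  have h_add: "h (x \<oplus> y) = h x + h y" if "x \<in> carrier A" "y \<in> carrier A" for x y
    using that by (simp add: h_def scale_add_right g(4) complex_eq_iff)
  have h_scale: "h (c \<odot> x) = c * h x" if x: "x \<in> carrier A" for c x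
  proof -
    have e: "g (c \<odot> x) = Re c * g x + Im c * g (\<i> \<odot> x)" if "x \<in> carrier A" for c x
    proof -
      have "c \<odot> x = complex_of_real (Re c) \<odot> x \<oplus> complex_of_real (Im c) \<odot> (\<i> \<odot> x)"
        using that complex_eq[of c] by (simp add: mult.commute flip: scale_add_left)
      then show ?thesis using that g(4,5) by (simp del: scale_scale)
    qed
    have "\<i> \<odot> (c \<odot> x) = c \<odot> (\<i> \<odot> x)" using x by (simp add: mult.commute)
    then show ?thesis
      using x e[of x c] e[of "\<i> \<odot> x" c] g_neg[OF x]
      by (simp add: h_def complex_eq_iff algebra_simps)
  qed
  \<comment> \<open>The factor 2 comes from adding the bounds of real and imaginary part; it is
    harmless for boundedness and for vanishing on \<open>M\<close>.\<close>
  have h_abs: "cmod (h x) \<le> 2 * p x" if x: "x \<in> carrier A" for x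
    using cmod_le[of "h x"] g_abs[OF x] g_abs[of "\<i> \<odot> x"] scale[OF x, of \<i>] x by (simp add: h_def)
  have "p b \<ge> \<delta>" using \<delta> b by (intro p_ge)
  then have hb: "h b \<noteq> 0" using b g(2) \<delta>(1) by (auto simp: h_def complex_eq_iff)
  have "h \<in> dual A"
  proof (rule dualI[where K = 2])
    show "cmod (h x) \<le> 2 * nrm A x" if "x \<in> carrier A" for x
      using h_abs[OF that] p_nrm[OF that] by linarith
  qed (use h_add h_scale in \<open>auto simp: h_def\<close>)
  then have "(\<lambda>x. inverse (h b) * h x) \<in> dual A" by (rule dual_scale)
  moreover have "h m = 0" if m: "m \<in> M" for m
  proof -
    have "p m \<le> 0" using p_le[OF Mc[OF m] m] Mc[OF m] by simp
    then have "cmod (h m) \<le> 0" using h_abs[OF Mc[OF m]] by linarith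
    then show ?thesis by simp
  qed
  ultimately show thesis using that hb by simp
qed

corollary normalizing_functional:
  assumes "b \<in> carrier A" "b \<noteq> \<zero>"
  obtains f where "f \<in> dual A" "f b = 1"
proof -
  have "nrm A b > 0" using assms nrm_nonneg[of b] nrm_eq_0_iff[of b] by linarith
  then show thesis
    using separating_functional[of "{\<zero>}" b "nrm A b"] assms that by auto
qed

end

section \<open>Functionals attached to a hole of the spectrum\<close>

text \<open>\<open>V\<close> is the complement of \<open>C\<close> seen from infinity, with 0
  standing for infinity. Boundedness of \<open>C\<close> makes 0 interior to \<open>V\<close>, and
  \<open>0 \<in> C\<close> makes \<open>V\<close> bounded. A maximum point on the frontier of
  \<open>V\<close> is carried back to the frontier of \<open>C\<close>.\<close>

lemma maximum_modulus_inversion: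
  assumes C: "open C" "bounded C" "0 \<in> C" and f: "f holomorphic_on UNIV"
  obtains z where "z \<in> frontier C" "z \<noteq> 0" "cmod (f 0) \<le> cmod (f (inverse z))"
proof -
  define V where "V = {u::complex. u = 0 \<or> inverse u \<notin> C}"
  have op: "open {u. u \<noteq> 0 \<and> inverse u \<in> S}" if "open S" for S :: "complex set"
  proof -
    have "{u. u \<noteq> 0 \<and> inverse u \<in> S} = (- {0}) \<inter> inverse -` S" by auto
    moreover have "continuous_on (- {0}) (inverse :: complex \<Rightarrow> complex)"
      by (intro continuous_on_inverse continuous_on_id) simp
    ultimately show ?thesis
      using continuous_open_preimage[of "- {0}" inverse S] that by (simp add: open_Compl)
  qed
  obtain e where e: "e > 0" "ball 0 e \<subseteq> C" using C(1,3) open_contains_ball by blast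
  have "cmod u \<le> inverse e" if u: "u \<in> V" for u
  proof (cases "u = 0")
    case False
    then have "inverse u \<notin> ball 0 e" using u e by (auto simp: V_def)
    then have "e \<le> inverse (cmod u)" by (simp add: norm_inverse)
    then show ?thesis using e False by (simp add: field_simps)
  qed (use e in auto)
  then have bV: "bounded V" by (auto simp: bounded_iff)
  obtain R where R: "R > 0" "\<And>z. z \<in> C \<Longrightarrow> cmod z \<le> R" using C(2) bounded_pos by blast
  have "ball 0 (inverse R) \<subseteq> V"
  proof
    fix u :: complex assume u: "u \<in> ball 0 (inverse R)"
    show "u \<in> V"
    proof (cases "u = 0")
      case False
      then have "R < inverse (cmod u)" using u R(1) by (simp add: field_simps)
      then show ?thesis using R(2)[of "inverse u"] by (auto simp: V_def norm_inverse)
    qed (simp add: V_def)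
  qed
  then have 0: "0 \<in> interior V" using R(1) by (intro interiorI[of "ball 0 (inverse R)"]) auto
  have cont: "continuous_on S f" for S
    using f holomorphic_on_imp_continuous_on holomorphic_on_subset by blast
  have mm: "cmod (f 0) \<le> B" if "\<And>z. z \<in> frontier V \<Longrightarrow> cmod (f z) \<le> B" for B
    using 0 interior_subset by (intro maximum_modulus_frontier[OF _ cont bV that])
      (auto intro: holomorphic_on_subset[OF f])
  \<comment> \<open>With an empty frontier, \<open>mm\<close> would hold vacuously for the negative
    bound -1.\<close>
  have "frontier V \<noteq> {}"
  proof
    assume "frontier V = {}"
    then have "cmod (f 0) \<le> - 1" by (intro mm) auto
    then show False using norm_ge_zero[of "f 0"] by linarith
  qed
  then obtain u where u: "u \<in> frontier V" "\<And>z. z \<in> frontier V \<Longrightarrow> cmod (f z) \<le> cmod (f u)"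
    using continuous_attains_sup[OF compact_frontier_bounded[OF bV]] continuous_on_norm[OF cont] by metis
  have u0: "u \<noteq> 0" using u(1) 0 by (auto simp: frontier_def)
  have "inverse u \<notin> C"
  proof
    assume "inverse u \<in> C"
    then have "u \<in> interior (- V)"
      using u0 by (intro interiorI[OF op[OF C(1)]]) (auto simp: V_def)
    then show False using u(1) by (simp add: frontier_def interior_complement)
  qed
  moreover have "inverse u \<in> closure C"
  proof (rule ccontr)
    assume "inverse u \<notin> closure C"
    then have "u \<in> interior V"
      using u0 closure_subset by (intro interiorI[OF op[of "- closure C"]]) (auto simp: V_def)
    then show False using u(1) by (simp add: frontier_def)
  qed
  ultimately have "inverse u \<in> frontier C"
    using C(1) by (simp add: frontier_def interior_open)
  then show thesis using that[of "inverse u"] mm[OF u(2)] u0 by simp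
qed

section \<open>Polynomials in one element\<close>

context complex_algebra
begin

text \<open>\<open>polynomial_pair b f x\<close>: for some polynomial \<open>p\<close>, \<open>f\<close> is the function \<open>p\<close> on the plane and \<open>x = p b\<close>.\<close>
inductive polynomial_pair :: "'a \<Rightarrow> (complex \<Rightarrow> complex) \<Rightarrow> 'a \<Rightarrow> bool" for b where
  const: "polynomial_pair b (\<lambda>_. c) (c \<odot> \<one>)"
| add: "polynomial_pair b f x \<Longrightarrow> polynomial_pair b g y \<Longrightarrow> polynomial_pair b (\<lambda>u. f u + g u) (x \<oplus> y)"
| shift: "polynomial_pair b f x \<Longrightarrow> polynomial_pair b (\<lambda>u. u * f u) (b \<otimes> x)"

lemma polynomial_pair_closed:
  "polynomial_pair b f x \<Longrightarrow> b \<in> carrier A \<Longrightarrow> x \<in> carrier A"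
  by (induction rule: polynomial_pair.induct) auto

lemma polynomial_pair_commute:
  assumes "polynomial_pair b f x" "b \<in> carrier A"
  shows "b \<otimes> x = x \<otimes> b"
  using assms
proof (induction rule: polynomial_pair.induct)
  case (shift f x)
  then have "x \<in> carrier A" using polynomial_pair_closed by blast
  with shift show ?case by (metis m_assoc)
qed (auto simp: smult_mult_left smult_mult_right l_distr r_distr polynomial_pair_closed)

lemma polynomial_pair_scale:
  assumes "polynomial_pair b f x" "b \<in> carrier A"
  shows "polynomial_pair b (\<lambda>u. c * f u) (c \<odot> x)"
  using assms
proof (induction rule: polynomial_pair.induct)
  case (const d)
  then show ?case using polynomial_pair.const[of b "c * d"] by simp
next
  case (add f x g y)
  then show ?case
    using polynomial_pair.add[of b "\<lambda>u. c * f u" "c \<odot> x" "\<lambda>u. c * g u" "c \<odot> y"]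
    by (simp add: scale_add_right polynomial_pair_closed distrib_left)
next
  case (shift f x)
  then show ?case
    using polynomial_pair.shift[of b "\<lambda>u. c * f u" "c \<odot> x"]
    by (simp add: smult_mult_right polynomial_pair_closed mult.left_commute)
qed

lemma polynomial_pair_holomorphic: "polynomial_pair b f x \<Longrightarrow> f holomorphic_on UNIV"
  by (induction rule: polynomial_pair.induct) (auto intro!: holomorphic_intros)

text \<open>The witness is the difference quotient of the polynomial, evaluated at \<open>b\<close>.
  That it commutes with \<open>b\<close> is recorded for \<open>Units_of_commuting_factor\<close>;
  together they give the inclusion of the spectral mapping theorem that sends spectral values of
  \<open>b\<close> to those of \<open>p b\<close>.\<close>

lemma polynomial_pair_factor:
  assumes "polynomial_pair b f x" "b \<in> carrier A"
  shows "\<exists>w\<in>carrier A. b \<otimes> w = w \<otimes> b \<and> f u \<odot> \<one> \<ominus> x = (u \<odot> \<one> \<ominus> b) \<otimes> w"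
  using assms
proof (induction rule: polynomial_pair.induct)
  case (const c)
  then show ?case by (intro bexI[of _ \<zero>]) auto
next
  case (add f x g y)
  obtain v where v: "v \<in> carrier A" "b \<otimes> v = v \<otimes> b" "f u \<odot> \<one> \<ominus> x = (u \<odot> \<one> \<ominus> b) \<otimes> v"
    using add by auto
  obtain w where w: "w \<in> carrier A" "b \<otimes> w = w \<otimes> b" "g u \<odot> \<one> \<ominus> y = (u \<odot> \<one> \<ominus> b) \<otimes> w"
    using add by auto
  have "(f u + g u) \<odot> \<one> \<ominus> (x \<oplus> y) = (f u \<odot> \<one> \<ominus> x) \<oplus> (g u \<odot> \<one> \<ominus> y)"
    using add polynomial_pair_closed by (simp add: scale_add_left add_diff_interchange)
  also have "\<dots> = (u \<odot> \<one> \<ominus> b) \<otimes> (v \<oplus> w)"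
    using v w add.prems by (simp add: r_distr)
  finally show ?case
    using v w add.prems by (intro bexI[of _ "v \<oplus> w"]) (auto simp: l_distr r_distr)
next
  case (shift f x)
  have x: "x \<in> carrier A" using shift polynomial_pair_closed by auto
  have b: "b \<in> carrier A" by fact
  obtain w where w: "w \<in> carrier A" "b \<otimes> w = w \<otimes> b" "f u \<odot> \<one> \<ominus> x = (u \<odot> \<one> \<ominus> b) \<otimes> w"
    using shift by auto
  \<comment> \<open>Product rule for differences:
    \<open>u p(u) - b p(b) = u (p(u) - p(b)) + (u - b) p(b)\<close>.\<close>
  have "(u * f u) \<odot> \<one> \<ominus> b \<otimes> x = (u \<odot> (f u \<odot> \<one>) \<ominus> u \<odot> x) \<oplus> (u \<odot> x \<ominus> b \<otimes> x)"
    using x b by (simp add: diff_add_diff)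
  also have "u \<odot> (f u \<odot> \<one>) \<ominus> u \<odot> x = u \<odot> ((u \<odot> \<one> \<ominus> b) \<otimes> w)"
    using x w(3) by (simp only: scale_diff_right[symmetric] one_closed scale_closed)
  also have "\<dots> \<oplus> (u \<odot> x \<ominus> b \<otimes> x) = (u \<odot> \<one> \<ominus> b) \<otimes> (u \<odot> w \<oplus> x)"
    using x w b by (simp add: r_distr smult_mult_right diff_distrib_right smult_mult_left)
  finally show ?case
    using x w b polynomial_pair_commute[OF shift.hyps b]
    by (intro bexI[of _ "u \<odot> w \<oplus> x"]) (auto simp: l_distr r_distr smult_mult_left smult_mult_right)
qed

end

section \<open>Resolvents near a point of a hole\<close>

context complex_banach_algebra
begin

lemma Units_of_zero_notin_spectrum:
  assumes "c \<in> carrier A" "0 \<notin> spectrum A c"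
  shows "c \<in> Units A"
proof -
  have "\<ominus> c \<in> Units A" using assms by (simp add: spectrum_def a_minus_def)
  then have "(- 1) \<odot> (\<ominus> c) \<in> Units A" by (rule scale_Units) simp
  then show ?thesis using assms(1) by (simp del: scale_minus_right)
qed

text \<open>With \<open>p u = 1 - u * f u\<close> we have \<open>p 0 = 1\<close>. As \<open>z \<mapsto> inverse z\<close> turns the complement of the
  hole into a bounded neighbourhood of \<open>0\<close>, the maximum principle makes the spectral radius of
  \<open>p (inv c)\<close> at least \<open>1\<close>.\<close>
lemma hole_distance:
  assumes c: "c \<in> Units A" and C: "C \<in> components (- spectrum A c)" "bounded C" "0 \<in> C"
    and fx: "polynomial_pair (inv c) f x"
  shows "1 \<le> nrm A (\<one> \<ominus> inv c \<otimes> x)"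
proof (rule ccontr)
  let ?b = "inv c"
  assume lt: "\<not> 1 \<le> nrm A (\<one> \<ominus> ?b \<otimes> x)"
  have cc: "c \<in> carrier A" and b: "?b \<in> carrier A" using c by auto
  have x: "x \<in> carrier A" using polynomial_pair_closed[OF fx b] .
  \<comment> \<open>The polynomial \<open>p\<close> of the comment above, spelled so that the rules
    for \<open>polynomial_pair\<close> apply literally.\<close>
  define g where "g u = 1 + (- 1) * (u * f u)" for u
  have gp: "polynomial_pair ?b g (1 \<odot> \<one> \<oplus> (- 1) \<odot> (?b \<otimes> x))"
    unfolding g_def by (intro polynomial_pair.add polynomial_pair.const polynomial_pair_scale polynomial_pair.shift fx b)
  have e: "1 \<odot> \<one> \<oplus> (- 1) \<odot> (?b \<otimes> x) = \<one> \<ominus> ?b \<otimes> x"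
    using b x by (simp add: a_minus_def)
  have cl: "closed (spectrum A c)" using closed_spectrum[OF cc] .
  then have "open C" using C(1) open_components by blast
  then obtain z where z: "z \<in> frontier C" "z \<noteq> 0" "cmod (g 0) \<le> cmod (g (inverse z))"
    using maximum_modulus_inversion[OF _ C(2,3) polynomial_pair_holomorphic[OF gp]] by blast
  have zs: "z \<in> spectrum A c"
    using z(1) frontier_of_components_closed_complement[OF cl C(1)] by blast
  \<comment> \<open>Here \<open>g 0 = 1\<close> enters: the negated claim puts the norm below
    \<open>cmod (g 0)\<close>.\<close>
  have "nrm A (\<one> \<ominus> ?b \<otimes> x) < cmod (g (inverse z))"
    using lt z(3) by (simp add: g_def)
  then have U: "g (inverse z) \<odot> \<one> \<ominus> (\<one> \<ominus> ?b \<otimes> x) \<in> Units A"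
    using b x by (intro scalar_minus_Units) auto
  obtain w where w: "w \<in> carrier A" "?b \<otimes> w = w \<otimes> ?b"
      "g (inverse z) \<odot> \<one> \<ominus> (\<one> \<ominus> ?b \<otimes> x) = (inverse z \<odot> \<one> \<ominus> ?b) \<otimes> w"
    using polynomial_pair_factor[OF gp b, of "inverse z"] unfolding e by blast
  have "inverse z \<odot> \<one> \<ominus> ?b \<in> Units A"
  proof (rule Units_of_commuting_factor[of _ w])
    show "(inverse z \<odot> \<one> \<ominus> ?b) \<otimes> w = w \<otimes> (inverse z \<odot> \<one> \<ominus> ?b)"
      using w b by (simp add: diff_distrib_left diff_distrib_right smult_mult_left smult_mult_right)
  qed (use U w b in auto)
  \<comment> \<open>Multiplication by \<open>- z\<close> and by \<open>c\<close> turns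
    \<open>1/z - b\<close> into \<open>z - c\<close>. This contradicts that \<open>z\<close>, a
    boundary point of the hole, is a spectral value of \<open>c\<close>.\<close>
  then have "(- z) \<odot> (inverse z \<odot> \<one> \<ominus> ?b) \<otimes> c \<in> Units A"
    using c z(2) by (intro Units_m_closed scale_Units) auto
  also have "(- z) \<odot> (inverse z \<odot> \<one> \<ominus> ?b) \<otimes> c = z \<odot> \<one> \<ominus> c"
    using b c cc z(2)
    by (simp add: smult_mult_left scale_add_right l_distr l_minus minus_add a_minus_def a_comm)
  finally show False using zs by (simp add: spectrum_def)
qed

text \<open>Iterating the fixed-point equation expands \<open>s\<close> in powers of
  \<open>b\<close>, as \<open>b + \<mu> b^2 + ...\<close>. Every term of
  \<open>b \<otimes> s\<close> carries the factor \<open>b^2\<close>, and the remainder decays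
  geometrically when \<open>cmod \<mu> * nrm A b < 1\<close>. In the application \<open>b\<close> is
  the inverse of \<open>c\<close> and \<open>s\<close> that of
  \<open>c \<ominus> \<mu> \<odot> \<one>\<close>.\<close>

lemma resolvent_approximation:
  assumes b: "b \<in> carrier A" and s: "s \<in> carrier A" and eq: "s = b \<oplus> \<mu> \<odot> (b \<otimes> s)"
  shows "\<exists>f x r. polynomial_pair b f x \<and> r \<in> carrier A \<and> b \<otimes> s = b \<otimes> (b \<otimes> x) \<oplus> r \<and>
    nrm A r \<le> (cmod \<mu> * nrm A b) ^ n * nrm A (b \<otimes> s)"
proof (induction n)
  case 0
  show ?case
    using polynomial_pair.const[of b 0] b s by (intro exI[of _ "\<lambda>_. 0"] exI[of _ \<zero>] exI[of _ "b \<otimes> s"]) auto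
next
  case (Suc n)
  then obtain f x r where fx: "polynomial_pair b f x" and r: "r \<in> carrier A"
    "b \<otimes> s = b \<otimes> (b \<otimes> x) \<oplus> r" "nrm A r \<le> (cmod \<mu> * nrm A b) ^ n * nrm A (b \<otimes> s)"
    by blast
  have x: "x \<in> carrier A" using polynomial_pair_closed[OF fx b] .
  let ?y = "1 \<odot> \<one> \<oplus> \<mu> \<odot> (b \<otimes> x)"
  have yp: "polynomial_pair b (\<lambda>u. 1 + \<mu> * (u * f u)) ?y"
    by (intro polynomial_pair.add polynomial_pair.const polynomial_pair_scale polynomial_pair.shift fx b)
  have "b \<otimes> s = b \<otimes> (b \<oplus> \<mu> \<odot> (b \<otimes> s))" using eq by simp
  also have "\<dots> = b \<otimes> (b \<oplus> \<mu> \<odot> (b \<otimes> (b \<otimes> x) \<oplus> r))" using r(2) by simp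
  also have "\<dots> = b \<otimes> (b \<otimes> ?y) \<oplus> \<mu> \<odot> (b \<otimes> r)"
    using b x r(1) by (simp add: r_distr scale_add_right smult_mult_right a_assoc)
  finally have e: "b \<otimes> s = b \<otimes> (b \<otimes> ?y) \<oplus> \<mu> \<odot> (b \<otimes> r)" .
  have "nrm A (\<mu> \<odot> (b \<otimes> r)) \<le> cmod \<mu> * (nrm A b * nrm A r)"
    using b r(1) nrm_mult by (simp add: nrm_smult mult_left_mono)
  also have "\<dots> \<le> cmod \<mu> * (nrm A b * ((cmod \<mu> * nrm A b) ^ n * nrm A (b \<otimes> s)))"
    using r(3) nrm_nonneg[OF b] by (intro mult_left_mono) auto
  finally have "nrm A (\<mu> \<odot> (b \<otimes> r)) \<le> (cmod \<mu> * nrm A b) ^ Suc n * nrm A (b \<otimes> s)"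
    by (simp add: mult_ac)
  with yp e b r(1) show ?case
    by (intro exI[of _ "\<lambda>u. 1 + \<mu> * (u * f u)"] exI[of _ ?y] exI[of _ "\<mu> \<odot> (b \<otimes> r)"] conjI) auto
qed

text \<open>Multiplication by \<open>c\<close> sends \<open>b - b^2 p(b)\<close> to
  \<open>1 - b p(b)\<close>, which has norm at least 1 by \<open>hole_distance\<close>. Hence
  \<open>b\<close> has positive distance from the space \<open>M\<close> of all
  \<open>b^2 p(b)\<close>, and separation applies.\<close>

theorem hole_functional:
  assumes c: "c \<in> carrier A" and C: "C \<in> components (- spectrum A c)" "bounded C" "0 \<in> C"
  obtains f where "c \<in> Units A" "f \<in> dual A" "f (inv c) = 1"
    "\<And>\<mu> s. \<lbrakk>cmod \<mu> * nrm A (inv c) < 1; s \<in> carrier A; (c \<ominus> \<mu> \<odot> \<one>) \<otimes> s = \<one>\<rbrakk> \<Longrightarrow> f s = 1"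
proof -
  have "C \<subseteq> - spectrum A c" using C(1) by (rule in_components_subset)
  then have cu: "c \<in> Units A" using C(3) c by (intro Units_of_zero_notin_spectrum) auto
  define b where "b = inv c"
  have b: "b \<in> carrier A" "c \<otimes> b = \<one>" "b \<otimes> c = \<one>" using cu by (auto simp: b_def)
  define M where "M = {b \<otimes> (b \<otimes> x) |f x. polynomial_pair b f x}"
  have M: "\<exists>f x. m = b \<otimes> (b \<otimes> x) \<and> polynomial_pair b f x \<and> x \<in> carrier A" if "m \<in> M" for m
    using that polynomial_pair_closed b(1) unfolding M_def by blast
  have MI: "b \<otimes> (b \<otimes> x) \<in> M" if "polynomial_pair b f x" for f x
    using that unfolding M_def by blast
  obtain f where f: "f \<in> dual A" "f b = 1" "\<And>m. m \<in> M \<Longrightarrow> f m = 0"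
  \<comment> \<open>The distance is at least the reciprocal of \<open>nrm A c\<close>; the added 1
    keeps the denominator positive.\<close>
  proof (rule separating_functional[of M b "inverse (nrm A c + 1)"])
    show "M \<subseteq> carrier A" using M b(1) by blast
    show "\<zero> \<in> M" using MI[OF polynomial_pair.const[of b 0]] b(1) by simp
    show "m \<oplus> n \<in> M" if mn: "m \<in> M" "n \<in> M" for m n
    proof -
      obtain f x where "m = b \<otimes> (b \<otimes> x)" "polynomial_pair b f x" "x \<in> carrier A"
        using M[OF mn(1)] by blast
      moreover obtain g y where "n = b \<otimes> (b \<otimes> y)" "polynomial_pair b g y" "y \<in> carrier A"
        using M[OF mn(2)] by blast
      ultimately show ?thesis using MI[OF polynomial_pair.add[of b f x g y]] b(1) by (simp add: r_distr)
    qed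
    show "k \<odot> m \<in> M" if m: "m \<in> M" for k m
    proof -
      obtain f x where "m = b \<otimes> (b \<otimes> x)" "polynomial_pair b f x" "x \<in> carrier A"
        using M[OF m] by blast
      then show ?thesis using MI[OF polynomial_pair_scale[of b f x k]] b(1) by (simp add: smult_mult_right)
    qed
    show "b \<in> carrier A" by (rule b)
    have n0: "nrm A c \<ge> 0" using c by (rule nrm_nonneg)
    then show "inverse (nrm A c + 1) > 0" by simp
    show "inverse (nrm A c + 1) \<le> nrm A (b \<ominus> m)" if "m \<in> M" for m
    proof -
      obtain f x where m: "m = b \<otimes> (b \<otimes> x)" and fx: "polynomial_pair b f x" and x: "x \<in> carrier A"
        using M[OF \<open>m \<in> M\<close>] by blast
      have mc: "m \<in> carrier A" using m b(1) x by simp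
      have "c \<otimes> m = b \<otimes> x" using m b(1,2) x c by (simp flip: m_assoc)
      then have "\<one> \<ominus> b \<otimes> x = c \<otimes> (b \<ominus> m)"
        using b c mc by (simp add: diff_distrib_left)
      then have "1 \<le> nrm A (c \<otimes> (b \<ominus> m))"
        using hole_distance[OF cu C, of f x] fx by (simp add: b_def)
      also have "\<dots> \<le> nrm A c * nrm A (b \<ominus> m)" using b(1) c mc by (intro nrm_mult) auto
      also have "\<dots> \<le> (nrm A c + 1) * nrm A (b \<ominus> m)"
        using nrm_nonneg[of "b \<ominus> m"] b(1) mc by (intro mult_right_mono) auto
      finally show ?thesis using n0 by (simp add: field_simps)
    qed
  qed blast
  have "f s = 1" if l: "cmod \<mu> * nrm A b < 1" and s: "s \<in> carrier A" and inv: "(c \<ominus> \<mu> \<odot> \<one>) \<otimes> s = \<one>" for \<mu> s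
  proof -
    have "c \<otimes> s = \<one> \<oplus> \<mu> \<odot> s"
      using inv s c by (simp add: diff_distrib_right smult_mult_left diff_eq_iff)
    then have "b \<otimes> (c \<otimes> s) = b \<otimes> (\<one> \<oplus> \<mu> \<odot> s)" by simp
    then have eq: "s = b \<oplus> \<mu> \<odot> (b \<otimes> s)"
      using b c s by (simp add: r_distr smult_mult_right flip: m_assoc)
    obtain K where K: "K \<ge> 0" "\<And>x. x \<in> carrier A \<Longrightarrow> cmod (f x) \<le> K * nrm A x"
      using dual_bound[OF f(1)] by blast
    let ?q = "cmod \<mu> * nrm A b"
    \<comment> \<open>\<open>b \<otimes> s\<close> is a limit of elements of \<open>M\<close>, where
      \<open>f\<close> vanishes, so only the geometric remainder is left. Then
      \<open>f s = f b\<close> follows from \<open>eq\<close>.\<close>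
    have "cmod (f (b \<otimes> s)) \<le> K * (?q ^ n * nrm A (b \<otimes> s))" for n
    proof -
      obtain g x r where r: "polynomial_pair b g x" "r \<in> carrier A" "b \<otimes> s = b \<otimes> (b \<otimes> x) \<oplus> r"
          "nrm A r \<le> ?q ^ n * nrm A (b \<otimes> s)"
        using resolvent_approximation[OF b(1) s eq, of n] by blast
      have "f (b \<otimes> s) = f r"
        using r b(1) polynomial_pair_closed[OF r(1) b(1)] dualD(2)[OF f(1)] f(3)[OF MI[OF r(1)]] by simp
      then show ?thesis
        using order_trans[OF K(2)[OF r(2)] mult_left_mono[OF r(4) K(1)]] by simp
    qed
    moreover have "(\<lambda>n. K * (?q ^ n * nrm A (b \<otimes> s))) \<longlonglongrightarrow> K * (0 * nrm A (b \<otimes> s))"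
      using l nrm_nonneg[OF b(1)] by (intro tendsto_intros LIMSEQ_power_zero) (simp add: abs_mult)
    ultimately have "cmod (f (b \<otimes> s)) \<le> K * (0 * nrm A (b \<otimes> s))"
      by (intro LIMSEQ_le_const) auto
    then have "f (b \<otimes> s) = 0" by simp
    moreover have "f s = f b + \<mu> * f (b \<otimes> s)"
      using arg_cong[OF eq, of f] dualD[OF f(1)] b(1) s by simp
    ultimately show ?thesis using f(2) by simp
  qed
  then show thesis using that[OF cu f(1)] f(2) by (simp add: b_def)
qed

end

section \<open>The algebra of bounded operators\<close>

lemma complex_normed_algebraI:
  fixes A (structure)
  assumes "ring A"
    and "\<And>c x. x \<in> carrier A \<Longrightarrow> c \<odot> x \<in> carrier A"
    and "\<And>c d x. x \<in> carrier A \<Longrightarrow> (c + d) \<odot> x = c \<odot> x \<oplus> d \<odot> x"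
    and "\<And>c x y. \<lbrakk>x \<in> carrier A; y \<in> carrier A\<rbrakk> \<Longrightarrow> c \<odot> (x \<oplus> y) = c \<odot> x \<oplus> c \<odot> y"
    and "\<And>c d x. x \<in> carrier A \<Longrightarrow> (c * d) \<odot> x = c \<odot> (d \<odot> x)"
    and "\<And>x. x \<in> carrier A \<Longrightarrow> 1 \<odot> x = x"
    and "\<And>c x y. \<lbrakk>x \<in> carrier A; y \<in> carrier A\<rbrakk> \<Longrightarrow> (c \<odot> x) \<otimes> y = c \<odot> (x \<otimes> y)"
    and "\<And>c x y. \<lbrakk>x \<in> carrier A; y \<in> carrier A\<rbrakk> \<Longrightarrow> x \<otimes> (c \<odot> y) = c \<odot> (x \<otimes> y)"
    and "\<And>x. x \<in> carrier A \<Longrightarrow> 0 \<le> nrm A x"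
    and "\<And>x. x \<in> carrier A \<Longrightarrow> nrm A x = 0 \<longleftrightarrow> x = \<zero>"
    and "\<And>x y. \<lbrakk>x \<in> carrier A; y \<in> carrier A\<rbrakk> \<Longrightarrow> nrm A (x \<oplus> y) \<le> nrm A x + nrm A y"
    and "\<And>c x. x \<in> carrier A \<Longrightarrow> nrm A (c \<odot> x) = cmod c * nrm A x"
    and "\<And>x y. \<lbrakk>x \<in> carrier A; y \<in> carrier A\<rbrakk> \<Longrightarrow> nrm A (x \<otimes> y) \<le> nrm A x * nrm A y"
  shows "complex_normed_algebra A"
proof -
  interpret ring A by fact
  have "module complex_field A"
    by (rule moduleI) (use assms abelian_group_axioms in \<open>auto simp: ring_of_type_algebra_def
        intro: cring_from_type_algebra[unfolded ring_of_type_algebra_def]\<close>)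
  then interpret Module.module complex_field A .
  show ?thesis
    by unfold_locales (use assms in auto)
qed

definition op_bound :: "'a normed_alg \<Rightarrow> ('a \<Rightarrow> 'a) \<Rightarrow> real \<Rightarrow> bool"
  where "op_bound A T K \<longleftrightarrow> 0 \<le> K \<and> (\<forall>x\<in>carrier A. nrm A (T x) \<le> K * nrm A x)"

text \<open>An infimum of admissible bounds instead of a supremum of quotients: the set is bounded
  below by definition and nonempty for every bounded operator, also on the zero space.\<close>

definition op_norm :: "'a normed_alg \<Rightarrow> ('a \<Rightarrow> 'a) \<Rightarrow> real"
  where "op_norm A T = Inf {K. op_bound A T K}"

definition bounded_ops :: "'a normed_alg \<Rightarrow> ('a \<Rightarrow> 'a) set"
  where "bounded_ops A = {T. (\<forall>x. T x \<in> carrier A) \<and> (\<forall>x. x \<notin> carrier A \<longrightarrow> T x = \<zero>\<^bsub>A\<^esub>) \<and>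
    (\<forall>x\<in>carrier A. \<forall>y\<in>carrier A. T (x \<oplus>\<^bsub>A\<^esub> y) = T x \<oplus>\<^bsub>A\<^esub> T y) \<and>
    (\<forall>x\<in>carrier A. \<forall>c. T (c \<odot>\<^bsub>A\<^esub> x) = c \<odot>\<^bsub>A\<^esub> T x) \<and> (\<exists>K. op_bound A T K)}"

text \<open>Operators are set to \<open>\<zero>\<close> outside the carrier. This makes them unique as functions, and the
  pointwise operations need no restriction to the carrier.\<close>
definition op_alg :: "'a normed_alg \<Rightarrow> ('a \<Rightarrow> 'a) normed_alg"
  where "op_alg A =
    \<lparr>carrier = bounded_ops A, mult = (\<circ>), one = (\<lambda>x. if x \<in> carrier A then x else \<zero>\<^bsub>A\<^esub>),
     zero = (\<lambda>_. \<zero>\<^bsub>A\<^esub>), add = (\<lambda>S T x. S x \<oplus>\<^bsub>A\<^esub> T x),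
     smult = (\<lambda>c T x. c \<odot>\<^bsub>A\<^esub> T x), nrm = op_norm A\<rparr>"

lemma op_alg_simps [simp]:
  "carrier (op_alg A) = bounded_ops A" "S \<otimes>\<^bsub>op_alg A\<^esub> T = S \<circ> T"
  "\<one>\<^bsub>op_alg A\<^esub> = (\<lambda>x. if x \<in> carrier A then x else \<zero>\<^bsub>A\<^esub>)" "\<zero>\<^bsub>op_alg A\<^esub> = (\<lambda>_. \<zero>\<^bsub>A\<^esub>)"
  "S \<oplus>\<^bsub>op_alg A\<^esub> T = (\<lambda>x. S x \<oplus>\<^bsub>A\<^esub> T x)" "c \<odot>\<^bsub>op_alg A\<^esub> T = (\<lambda>x. c \<odot>\<^bsub>A\<^esub> T x)"
  "nrm (op_alg A) = op_norm A"
  by (simp_all add: op_alg_def)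

context complex_normed_algebra
begin

lemma bounded_opsI:
  assumes "\<And>x. T x \<in> carrier A" "\<And>x. x \<notin> carrier A \<Longrightarrow> T x = \<zero>"
    and "\<And>x y. \<lbrakk>x \<in> carrier A; y \<in> carrier A\<rbrakk> \<Longrightarrow> T (x \<oplus> y) = T x \<oplus> T y"
    and "\<And>c x. x \<in> carrier A \<Longrightarrow> T (c \<odot> x) = c \<odot> T x"
    and "0 \<le> K" "\<And>x. x \<in> carrier A \<Longrightarrow> nrm A (T x) \<le> K * nrm A x"
  shows "T \<in> bounded_ops A"
  using assms unfolding bounded_ops_def op_bound_def by blast

lemma bounded_opsD:
  assumes "T \<in> bounded_ops A"
  shows "T x \<in> carrier A" and "x \<notin> carrier A \<Longrightarrow> T x = \<zero>"
    and "\<lbrakk>x \<in> carrier A; y \<in> carrier A\<rbrakk> \<Longrightarrow> T (x \<oplus> y) = T x \<oplus> T y"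
    and "x \<in> carrier A \<Longrightarrow> T (c \<odot> x) = c \<odot> T x"
  using assms unfolding bounded_ops_def by auto

lemma bounded_ops_zero [simp]: "T \<in> bounded_ops A \<Longrightarrow> T \<zero> = \<zero>"
  using bounded_opsD(4)[of T \<zero> 0] bounded_opsD(1)[of T \<zero>] by simp

lemma bounded_ops_minus: "T \<in> bounded_ops A \<Longrightarrow> x \<in> carrier A \<Longrightarrow> T (\<ominus> x) = \<ominus> T x"
  using bounded_opsD(4)[of T x "- 1"] bounded_opsD(1)[of T x] by simp

lemma op_bound_op_norm:
  assumes "T \<in> bounded_ops A"
  shows "op_bound A T (op_norm A T)"
proof -
  obtain K where K: "op_bound A T K" using assms unfolding bounded_ops_def by blast
  then have ne: "{K. op_bound A T K} \<noteq> {}" by blast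
  have 0: "0 \<le> op_norm A T"
    unfolding op_norm_def using ne by (intro cInf_greatest) (auto simp: op_bound_def)
  have "nrm A (T x) \<le> op_norm A T * nrm A x" if x: "x \<in> carrier A" for x
  proof (cases "nrm A x = 0")
    case True
    then show ?thesis using K x by (auto simp: op_bound_def)
  next
    case False
    then have pos: "nrm A x > 0" using nrm_nonneg[OF x] by simp
    have "nrm A (T x) / nrm A x \<le> op_norm A T"
      unfolding op_norm_def using ne x by (intro cInf_greatest) (auto simp: op_bound_def pos_divide_le_eq[OF pos])
    then show ?thesis by (simp add: pos_divide_le_eq[OF pos])
  qed
  with 0 show ?thesis by (simp add: op_bound_def)
qed

lemma nrm_op_le:
  assumes "T \<in> bounded_ops A" "x \<in> carrier A"
  shows "nrm A (T x) \<le> op_norm A T * nrm A x"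
  using op_bound_op_norm[OF assms(1)] assms(2) by (simp add: op_bound_def)

lemma op_norm_nonneg: "T \<in> bounded_ops A \<Longrightarrow> 0 \<le> op_norm A T"
  using op_bound_op_norm by (simp add: op_bound_def)

lemma op_norm_le:
  assumes "0 \<le> K" "\<And>x. x \<in> carrier A \<Longrightarrow> nrm A (T x) \<le> K * nrm A x"
  shows "op_norm A T \<le> K"
  unfolding op_norm_def using assms by (intro cInf_lower bdd_belowI[of _ 0]) (auto simp: op_bound_def)

lemma bounded_ops_add:
  assumes S: "S \<in> bounded_ops A" and T: "T \<in> bounded_ops A"
  shows "(\<lambda>x. S x \<oplus> T x) \<in> bounded_ops A"
    and "op_norm A (\<lambda>x. S x \<oplus> T x) \<le> op_norm A S + op_norm A T"
proof -
  have le: "nrm A (S x \<oplus> T x) \<le> (op_norm A S + op_norm A T) * nrm A x" if "x \<in> carrier A" for x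
    using nrm_triangle[OF bounded_opsD(1)[OF S] bounded_opsD(1)[OF T], of x x]
      nrm_op_le[OF S that] nrm_op_le[OF T that] by (simp add: distrib_right)
  have 0: "0 \<le> op_norm A S + op_norm A T" using S T by (simp add: op_norm_nonneg)
  show "(\<lambda>x. S x \<oplus> T x) \<in> bounded_ops A"
    by (rule bounded_opsI[OF _ _ _ _ 0 le])
      (use S T in \<open>auto simp: bounded_opsD scale_add_right a_ac\<close>)
  show "op_norm A (\<lambda>x. S x \<oplus> T x) \<le> op_norm A S + op_norm A T"
    by (rule op_norm_le[OF 0 le])
qed

lemma bounded_ops_scale:
  assumes T: "T \<in> bounded_ops A"
  shows "(\<lambda>x. c \<odot> T x) \<in> bounded_ops A" and "op_norm A (\<lambda>x. c \<odot> T x) \<le> cmod c * op_norm A T"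
proof -
  have le: "nrm A (c \<odot> T x) \<le> (cmod c * op_norm A T) * nrm A x" if "x \<in> carrier A" for x
    using nrm_op_le[OF T that] T by (simp add: nrm_smult bounded_opsD mult_left_mono mult.assoc)
  have 0: "0 \<le> cmod c * op_norm A T" using T by (simp add: op_norm_nonneg)
  show "(\<lambda>x. c \<odot> T x) \<in> bounded_ops A"
    by (rule bounded_opsI[OF _ _ _ _ 0 le])
      (use T in \<open>auto simp: bounded_opsD scale_add_right mult.commute\<close>)
  show "op_norm A (\<lambda>x. c \<odot> T x) \<le> cmod c * op_norm A T"
    by (rule op_norm_le[OF 0 le])
qed

lemma bounded_ops_comp:
  assumes S: "S \<in> bounded_ops A" and T: "T \<in> bounded_ops A"
  shows "S \<circ> T \<in> bounded_ops A" and "op_norm A (S \<circ> T) \<le> op_norm A S * op_norm A T"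
proof -
  have le: "nrm A ((S \<circ> T) x) \<le> (op_norm A S * op_norm A T) * nrm A x" if "x \<in> carrier A" for x
    using order_trans[OF nrm_op_le[OF S bounded_opsD(1)[OF T]]
        mult_left_mono[OF nrm_op_le[OF T that] op_norm_nonneg[OF S]]] by (simp add: mult.assoc)
  have 0: "0 \<le> op_norm A S * op_norm A T" using S T by (simp add: op_norm_nonneg)
  show "S \<circ> T \<in> bounded_ops A"
    by (rule bounded_opsI[OF _ _ _ _ 0 le]) (use S T in \<open>auto simp: bounded_opsD\<close>)
  show "op_norm A (S \<circ> T) \<le> op_norm A S * op_norm A T"
    by (rule op_norm_le[OF 0 le])
qed

lemma op_alg_normed: "complex_normed_algebra (op_alg A)"
proof (rule complex_normed_algebraI)
  have ident: "(\<lambda>x. if x \<in> carrier A then x else \<zero>) \<in> bounded_ops A"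
    by (rule bounded_opsI[where K = 1]) auto
  have zero: "(\<lambda>_. \<zero>) \<in> bounded_ops A"
    by (rule bounded_opsI[where K = 0]) auto
  show "ring (op_alg A)"
  proof (rule ringI)
    show "abelian_group (op_alg A)"
    proof (rule abelian_groupI)
      show "\<exists>S\<in>carrier (op_alg A). S \<oplus>\<^bsub>op_alg A\<^esub> T = \<zero>\<^bsub>op_alg A\<^esub>" if "T \<in> carrier (op_alg A)" for T
        using that bounded_ops_scale(1)[of T "- 1"]
        by (intro bexI[of _ "\<lambda>x. (- 1) \<odot> T x"]) (auto simp: bounded_opsD l_neg)
    qed (auto simp: bounded_ops_add zero bounded_opsD a_ac)
    show "monoid (op_alg A)"
      by (rule monoidI) (auto simp: bounded_ops_comp ident bounded_opsD comp_assoc fun_eq_iff)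
  qed (auto simp: bounded_opsD fun_eq_iff)
  show nz: "nrm (op_alg A) T = 0 \<longleftrightarrow> T = \<zero>\<^bsub>op_alg A\<^esub>" if "T \<in> carrier (op_alg A)" for T
  proof
    have T: "T \<in> bounded_ops A" using that by simp
    assume "nrm (op_alg A) T = 0"
    then have "nrm A (T x) \<le> 0" if "x \<in> carrier A" for x
      using nrm_op_le[OF T that] by simp
    then have "T x = \<zero>" for x
      using nrm_nonneg[OF bounded_opsD(1)[OF T]] nrm_eq_0_iff[OF bounded_opsD(1)[OF T]] bounded_opsD(2)[OF T, of x]
      by (metis order_antisym)
    then show "T = \<zero>\<^bsub>op_alg A\<^esub>" by auto
  next
    assume "T = \<zero>\<^bsub>op_alg A\<^esub>"
    then show "nrm (op_alg A) T = 0"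
      using op_norm_le[of 0 "\<lambda>_. \<zero>"] op_norm_nonneg[OF zero] by simp
  qed
  show "nrm (op_alg A) (c \<odot>\<^bsub>op_alg A\<^esub> T) = cmod c * nrm (op_alg A) T" if "T \<in> carrier (op_alg A)" for c T
  proof (cases "c = 0")
    case True
    then show ?thesis using that nz zero by (simp add: bounded_opsD)
  next
    case False
    have T: "T \<in> bounded_ops A" using that by simp
    \<comment> \<open>So far scaling is only known to satisfy an inequality; undoing it with
      \<open>inverse c\<close> gives the reverse.\<close>
    have "op_norm A (\<lambda>x. inverse c \<odot> (c \<odot> T x)) \<le> cmod (inverse c) * op_norm A (\<lambda>x. c \<odot> T x)"
      using bounded_ops_scale[OF bounded_ops_scale(1)[OF T]] by blast
    then have "cmod c * op_norm A T \<le> op_norm A (\<lambda>x. c \<odot> T x)"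
      using T False by (simp add: bounded_opsD norm_inverse norm_divide field_simps)
    then show ?thesis using bounded_ops_scale(2)[OF T, of c] by simp
  qed
qed (auto simp: bounded_opsD bounded_ops_add bounded_ops_scale bounded_ops_comp scale_add_left scale_add_right
    op_norm_nonneg fun_eq_iff)

text \<open>Subtraction in \<open>op_alg A\<close> goes through the abstract additive inverse.
  Rewriting it as addition of the multiple by -1 makes it pointwise, the form in which
  \<open>op_norm_le\<close> estimates differences.\<close>

lemma op_alg_diff:
  assumes "S \<in> bounded_ops A" "T \<in> bounded_ops A"
  shows "S \<ominus>\<^bsub>op_alg A\<^esub> T = (\<lambda>x. S x \<ominus> T x)"
proof -
  interpret B: complex_normed_algebra "op_alg A" by (rule op_alg_normed)
  have "(\<lambda>x. S x \<ominus> T x) = S \<oplus>\<^bsub>op_alg A\<^esub> (- 1) \<odot>\<^bsub>op_alg A\<^esub> T"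
    using assms by (simp add: a_minus_def bounded_opsD)
  also have "\<dots> = S \<ominus>\<^bsub>op_alg A\<^esub> T"
    using assms by (simp add: B.scale_minus_left a_minus_def del: op_alg_simps(4-6))
  finally show ?thesis by simp
qed

end

context complex_banach_algebra
begin

lemma op_alg_banach: "complex_banach_algebra (op_alg A)"
proof -
  interpret B: complex_normed_algebra "op_alg A" by (rule op_alg_normed)
  have "\<exists>T\<in>carrier (op_alg A). (\<lambda>n. nrm (op_alg A) (s n \<ominus>\<^bsub>op_alg A\<^esub> T)) \<longlonglongrightarrow> 0"
    if s: "\<forall>n. s n \<in> carrier (op_alg A)"
      and cauchy: "\<forall>\<epsilon>>0. \<exists>N. \<forall>m\<ge>N. \<forall>n\<ge>N. nrm (op_alg A) (s m \<ominus>\<^bsub>op_alg A\<^esub> s n) < \<epsilon>" for s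
  proof -
    have sB: "s n \<in> bounded_ops A" for n using s by simp
    have diff: "nrm A (s m x \<ominus> s n x) \<le> nrm (op_alg A) (s m \<ominus>\<^bsub>op_alg A\<^esub> s n) * nrm A x"
      if "x \<in> carrier A" for m n x
    proof -
      have "s m \<ominus>\<^bsub>op_alg A\<^esub> s n \<in> bounded_ops A"
        using B.minus_closed[of "s m" "s n"] sB by simp
      from nrm_op_le[OF this that] show ?thesis
        by (simp add: op_alg_diff[OF sB sB])
    qed
    have "\<exists>l\<in>carrier A. (\<lambda>n. nrm A (s n x \<ominus> l)) \<longlonglongrightarrow> 0" for x
    proof (cases "x \<in> carrier A")
      case True
      have "\<exists>N. \<forall>m\<ge>N. \<forall>n\<ge>N. nrm A (s m x \<ominus> s n x) < \<epsilon>" if "\<epsilon> > 0" for \<epsilon>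
      proof -
        have p: "\<epsilon> / (nrm A x + 1) > 0" using that nrm_nonneg[OF True] by simp
        then obtain N where N: "\<And>m n. m \<ge> N \<Longrightarrow> n \<ge> N \<Longrightarrow>
            nrm (op_alg A) (s m \<ominus>\<^bsub>op_alg A\<^esub> s n) < \<epsilon> / (nrm A x + 1)"
          using cauchy by meson
        have "nrm A (s m x \<ominus> s n x) < \<epsilon>" if "m \<ge> N" "n \<ge> N" for m n
        proof -
          have "nrm A (s m x \<ominus> s n x) \<le> \<epsilon> / (nrm A x + 1) * nrm A x"
            using order_trans[OF diff[OF True] mult_right_mono[OF less_imp_le[OF N[OF that]] nrm_nonneg[OF True]]] .
          also have "\<dots> < \<epsilon>" using \<open>\<epsilon> > 0\<close> nrm_nonneg[OF True] by (simp add: field_simps)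
          finally show ?thesis .
        qed
        then show ?thesis by blast
      qed
      then show ?thesis
        using bounded_opsD(1)[OF sB]
        by (intro complete[unfolded mcomplete_iff_nrm, THEN spec[of _ "\<lambda>n. s n x"], THEN mp]) simp
    next
      case False
      then show ?thesis using bounded_opsD(2)[OF sB] by (intro bexI[of _ \<zero>]) auto
    qed
    then obtain l where l: "\<And>x. l x \<in> carrier A" "\<And>x. (\<lambda>n. nrm A (s n x \<ominus> l x)) \<longlonglongrightarrow> 0"
      by metis
    \<comment> \<open>The pointwise limit, reset to zero off the carrier as
      \<open>bounded_ops\<close> demands.\<close>
    define T where "T x = (if x \<in> carrier A then l x else \<zero>)" for x
    have T: "T x \<in> carrier A" "x \<in> carrier A \<Longrightarrow> (\<lambda>n. nrm A (s n x \<ominus> T x)) \<longlonglongrightarrow> 0" for x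
      using l by (auto simp: T_def)
    have unique: "u = v" if "u \<in> carrier A" "v \<in> carrier A" "\<And>n. nrm A (u \<ominus> v) \<le> e n" "e \<longlonglongrightarrow> 0" for u v and e :: "nat \<Rightarrow> real"
    proof -
      have "nrm A (u \<ominus> v) \<le> 0" using that by (intro LIMSEQ_le_const[of e 0]) auto
      then have "u \<ominus> v = \<zero>" using that nrm_nonneg[of "u \<ominus> v"] nrm_eq_0_iff[of "u \<ominus> v"] by simp
      then show ?thesis using that by (simp add: diff_eq_iff)
    qed
    note sD = bounded_opsD[OF sB]
    have T_add: "T (x \<oplus> y) = T x \<oplus> T y" if x: "x \<in> carrier A" and y: "y \<in> carrier A" for x y
    proof (rule unique)
      let ?e = "\<lambda>n. nrm A (s n (x \<oplus> y) \<ominus> T (x \<oplus> y)) + (nrm A (s n x \<ominus> T x) + nrm A (s n y \<ominus> T y))"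
      have "?e \<longlonglongrightarrow> 0 + (0 + 0)" using x y by (intro tendsto_add T) auto
      then show "?e \<longlonglongrightarrow> 0" by simp
      show "nrm A (T (x \<oplus> y) \<ominus> (T x \<oplus> T y)) \<le> ?e n" for n
      proof -
        have "nrm A (T (x \<oplus> y) \<ominus> (T x \<oplus> T y))
            \<le> nrm A (T (x \<oplus> y) \<ominus> s n (x \<oplus> y)) + nrm A (s n (x \<oplus> y) \<ominus> (T x \<oplus> T y))"
          using T sD by (intro nrm_diff_triangle) auto
        also have "s n (x \<oplus> y) \<ominus> (T x \<oplus> T y) = (s n x \<ominus> T x) \<oplus> (s n y \<ominus> T y)"
          using T sD x y by (simp add: add_diff_interchange)
        also have "nrm A \<dots> \<le> nrm A (s n x \<ominus> T x) + nrm A (s n y \<ominus> T y)"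
          using T sD by (intro nrm_triangle) auto
        finally show ?thesis using T sD by (simp add: nrm_diff_commute)
      qed
    qed (use T in auto)
    have T_scale: "T (c \<odot> x) = c \<odot> T x" if x: "x \<in> carrier A" for c x
    proof (rule unique)
      let ?e = "\<lambda>n. nrm A (s n (c \<odot> x) \<ominus> T (c \<odot> x)) + cmod c * nrm A (s n x \<ominus> T x)"
      have "?e \<longlonglongrightarrow> 0 + cmod c * 0" using x by (intro tendsto_add tendsto_mult tendsto_const T) auto
      then show "?e \<longlonglongrightarrow> 0" by simp
      show "nrm A (T (c \<odot> x) \<ominus> c \<odot> T x) \<le> ?e n" for n
      proof -
        have "nrm A (T (c \<odot> x) \<ominus> c \<odot> T x)
            \<le> nrm A (T (c \<odot> x) \<ominus> s n (c \<odot> x)) + nrm A (s n (c \<odot> x) \<ominus> c \<odot> T x)"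
          using T sD by (intro nrm_diff_triangle) auto
        also have "s n (c \<odot> x) \<ominus> c \<odot> T x = c \<odot> (s n x \<ominus> T x)"
          using T sD x by (simp add: scale_diff_right)
        finally show ?thesis using T sD by (simp add: nrm_diff_commute nrm_smult)
      qed
    qed (use T in auto)
    \<comment> \<open>Letting \<open>m\<close> tend to infinity in the Cauchy estimate gives a bound
      uniform in \<open>x\<close>. It yields boundedness of \<open>T\<close> (with
      \<open>\<epsilon> = 1\<close>) as well as convergence in operator norm.\<close>
    have close: "nrm A (s n x \<ominus> T x) \<le> \<epsilon> * nrm A x"
      if n: "\<And>m. m \<ge> n \<Longrightarrow> nrm (op_alg A) (s n \<ominus>\<^bsub>op_alg A\<^esub> s m) \<le> \<epsilon>" and x: "x \<in> carrier A" for n \<epsilon> x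
    proof -
      have "nrm A (s n x \<ominus> T x) \<le> \<epsilon> * nrm A x + nrm A (s m x \<ominus> T x)" if "m \<ge> n" for m
      proof -
        have "nrm A (s n x \<ominus> s m x) \<le> \<epsilon> * nrm A x"
          using order_trans[OF diff[OF x] mult_right_mono[OF n[OF that] nrm_nonneg[OF x]]] .
        then show ?thesis
          using nrm_diff_triangle[of "s n x" "s m x" "T x"] T sD by fastforce
      qed
      moreover have "(\<lambda>m. \<epsilon> * nrm A x + nrm A (s m x \<ominus> T x)) \<longlonglongrightarrow> \<epsilon> * nrm A x + 0"
        using x by (intro tendsto_add tendsto_const T)
      ultimately show ?thesis
        by (intro LIMSEQ_le_const[of _ "\<epsilon> * nrm A x"]) auto
    qed
    obtain N where N: "\<And>m. m \<ge> N \<Longrightarrow> nrm (op_alg A) (s N \<ominus>\<^bsub>op_alg A\<^esub> s m) \<le> 1"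
      using cauchy by (metis less_imp_le zero_less_one order_refl)
    have TB: "T \<in> bounded_ops A"
    proof (rule bounded_opsI[where K = "op_norm A (s N) + 1"])
      show "nrm A (T x) \<le> (op_norm A (s N) + 1) * nrm A x" if "x \<in> carrier A" for x
        using nrm_reverse_triangle[OF T(1) sD(1), of x N x] close[OF N that] nrm_op_le[OF sB that, of N]
          nrm_diff_commute[OF T(1) sD(1), of x N x] by (simp add: distrib_right)
      show "0 \<le> op_norm A (s N) + 1" using op_norm_nonneg[OF sB] by (simp add: add_nonneg_nonneg)
    qed (use T T_add T_scale in \<open>auto simp: T_def\<close>)
    have "(\<lambda>n. nrm (op_alg A) (s n \<ominus>\<^bsub>op_alg A\<^esub> T)) \<longlonglongrightarrow> 0"
    proof (rule LIMSEQ_I)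
      fix r :: real assume "r > 0"
      then obtain M where M: "\<And>m n. m \<ge> M \<Longrightarrow> n \<ge> M \<Longrightarrow> nrm (op_alg A) (s m \<ominus>\<^bsub>op_alg A\<^esub> s n) < r / 2"
        using cauchy by (meson half_gt_zero)
      have "nrm (op_alg A) (s n \<ominus>\<^bsub>op_alg A\<^esub> T) \<le> r / 2" if n: "n \<ge> M" for n
      proof -
        have "nrm A (s n x \<ominus> T x) \<le> r / 2 * nrm A x" if "x \<in> carrier A" for x
          using that n by (intro close less_imp_le[OF M]) auto
        then have "op_norm A (\<lambda>x. s n x \<ominus> T x) \<le> r / 2"
          using \<open>r > 0\<close> by (intro op_norm_le) auto
        then show ?thesis by (simp add: op_alg_diff[OF sB TB])
      qed
      moreover have "0 \<le> nrm (op_alg A) (s n \<ominus>\<^bsub>op_alg A\<^esub> T)" for n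
        using B.minus_closed[of "s n" T] sB TB by (intro B.nrm_nonneg) simp
      ultimately show "\<exists>M. \<forall>n\<ge>M. norm (nrm (op_alg A) (s n \<ominus>\<^bsub>op_alg A\<^esub> T) - 0) < r"
        using \<open>r > 0\<close> by (intro exI[of _ M]) fastforce
    qed
    then show ?thesis using TB by auto
  qed
  then have "B.mcomplete" unfolding B.mcomplete_iff_nrm by blast
  then show ?thesis by (intro complex_banach_algebra.intro complex_banach_algebra_axioms.intro op_alg_normed)
qed

end

section \<open>Pullbacks of Banach algebras along a contractive homomorphism\<close>

context ring
begin

lemma additive_subgroupI_ring:
  assumes "L \<subseteq> carrier R" "\<zero> \<in> L" "\<And>x y. x \<in> L \<Longrightarrow> y \<in> L \<Longrightarrow> x \<oplus> y \<in> L"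
    "\<And>x. x \<in> L \<Longrightarrow> \<ominus> x \<in> L"
  shows "additive_subgroup L R"
  by (rule additive_subgroupI, rule add.subgroupI) (use assms in \<open>auto simp: a_inv_def\<close>)

lemma left_idealI:
  assumes L: "L \<subseteq> carrier R" "\<zero> \<in> L" "\<And>x y. x \<in> L \<Longrightarrow> y \<in> L \<Longrightarrow> x \<oplus> y \<in> L"
    "\<And>x l. x \<in> carrier R \<Longrightarrow> l \<in> L \<Longrightarrow> x \<otimes> l \<in> L"
  shows "left_ideal L R"
proof -
  have "\<ominus> x \<in> L" if "x \<in> L" for x
    using L(4)[of "\<ominus> \<one>" x] that L(1) by (auto simp: l_minus)
  then show ?thesis
    unfolding left_ideal_def using additive_subgroupI_ring[OF L(1-3)] L(4) by blast
qed

lemma left_idealD: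
  assumes "left_ideal L R"
  shows "L \<subseteq> carrier R" "\<zero> \<in> L" "\<And>x y. x \<in> L \<Longrightarrow> y \<in> L \<Longrightarrow> x \<oplus> y \<in> L"
    "\<And>x l. x \<in> carrier R \<Longrightarrow> l \<in> L \<Longrightarrow> x \<otimes> l \<in> L" "\<And>x y. x \<in> L \<Longrightarrow> y \<in> L \<Longrightarrow> x \<ominus> y \<in> L"
proof -
  interpret additive_subgroup L R using assms by (simp add: left_ideal_def)
  show "L \<subseteq> carrier R" by (rule a_subset)
  show "\<zero> \<in> L" by (rule zero_closed)
  show "\<And>x y. x \<in> L \<Longrightarrow> y \<in> L \<Longrightarrow> x \<oplus> y \<in> L" by (rule a_closed)
  show "\<And>x l. x \<in> carrier R \<Longrightarrow> l \<in> L \<Longrightarrow> x \<otimes> l \<in> L" using assms by (simp add: left_ideal_def)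
  show "\<And>x y. x \<in> L \<Longrightarrow> y \<in> L \<Longrightarrow> x \<ominus> y \<in> L" by (simp add: a_minus_def abelian_group_axioms a_closed a_inv_closed)
qed

lemma maximal_left_idealI:
  assumes "left_ideal L R" "L \<noteq> carrier R"
    and "\<And>N n. \<lbrakk>left_ideal N R; L \<subseteq> N; n \<in> N; n \<notin> L\<rbrakk> \<Longrightarrow> carrier R \<subseteq> N"
  shows "maximal_left_ideal L R"
  unfolding maximal_left_ideal_def using assms left_idealD(1) by blast

lemma zero_in_jacobson_radical: "\<zero> \<in> jacobson_radical R"
  unfolding jacobson_radical_def maximal_left_ideal_def using left_idealD(2) by blast

end

text \<open>A left ideal strictly above the preimage has an image strictly above \<open>L\<close>,
  hence all of \<open>S\<close>; since it also contains the kernel, it is everything. Used for the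
  projection of the pullback onto \<open>Y\<close>.\<close>

lemma (in ring_hom_ring) maximal_left_ideal_vimage:
  assumes surj: "h ` carrier R = carrier S" and L: "maximal_left_ideal L S"
  shows "maximal_left_ideal {x \<in> carrier R. h x \<in> L} R"
proof (rule R.maximal_left_idealI)
  have Ll: "left_ideal L S" and Ln: "L \<noteq> carrier S"
    and Lm: "\<And>N. left_ideal N S \<Longrightarrow> L \<subseteq> N \<Longrightarrow> N = L \<or> N = carrier S"
    using L unfolding maximal_left_ideal_def by auto
  note D = S.left_idealD[OF Ll]
  show "left_ideal {x \<in> carrier R. h x \<in> L} R"
    by (rule R.left_idealI) (use D in auto)
  obtain y where "y \<in> carrier S" "y \<notin> L" using Ln D(1) by blast
  moreover from this obtain x where "x \<in> carrier R" "h x = y" using surj by (metis imageE)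
  ultimately show "{x \<in> carrier R. h x \<in> L} \<noteq> carrier R" by blast
  fix N n assume N: "left_ideal N R" "{x \<in> carrier R. h x \<in> L} \<subseteq> N" "n \<in> N" "n \<notin> {x \<in> carrier R. h x \<in> L}"
  note ND = R.left_idealD[OF N(1)]
  have "left_ideal (h ` N) S"
  proof (rule S.left_idealI)
    show "h ` N \<subseteq> carrier S" by (auto dest: subsetD[OF ND(1)])
    show "\<zero>\<^bsub>S\<^esub> \<in> h ` N" using ND(2) by (metis hom_zero imageI)
    show "x \<oplus>\<^bsub>S\<^esub> y \<in> h ` N" if xy: "x \<in> h ` N" "y \<in> h ` N" for x y
    proof -
      obtain x' y' where "x' \<in> N" "x = h x'" "y' \<in> N" "y = h y'" using xy by blast
      moreover from this have "x' \<in> carrier R" "y' \<in> carrier R" using ND(1) by blast+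
      ultimately show ?thesis using ND(3) by (intro image_eqI[of _ _ "x' \<oplus> y'"]) auto
    qed
    show "x \<otimes>\<^bsub>S\<^esub> l \<in> h ` N" if xl: "x \<in> carrier S" "l \<in> h ` N" for x l
    proof -
      obtain x' l' where "x' \<in> carrier R" "x = h x'" "l' \<in> N" "l = h l'"
        using xl unfolding surj[symmetric] by blast
      moreover from this have "l' \<in> carrier R" using ND(1) by blast
      ultimately show ?thesis using ND(4) by (intro image_eqI[of _ _ "x' \<otimes> l'"]) auto
    qed
  qed
  moreover have "L \<subseteq> h ` N"
  proof
    fix l assume l: "l \<in> L"
    then obtain x where "x \<in> carrier R" "h x = l" using D(1) surj by (metis imageE subsetD)
    then show "l \<in> h ` N" using l N(2) by blast
  qed
  moreover have "h ` N \<noteq> L" using N(3,4) ND(1) by blast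
  ultimately have hN: "h ` N = carrier S" using Lm by blast
  show "carrier R \<subseteq> N"
  proof
    fix x assume x: "x \<in> carrier R"
    then obtain m where m: "m \<in> N" "h m = h x" using hN by (metis hom_closed imageE)
    have mc: "m \<in> carrier R" using m ND(1) by blast
    \<comment> \<open>The difference lies in the kernel, which is part of the preimage of
      \<open>L\<close> and so of \<open>N\<close>.\<close>
    have "h (x \<ominus> m) = \<zero>\<^bsub>S\<^esub>" using x mc m(2) by (simp add: a_minus_def S.r_neg)
    then have "x \<ominus> m \<in> N" using N(2) x mc D(2) by auto
    then have "(x \<ominus> m) \<oplus> m \<in> N" using ND(3) m(1) by blast
    then show "x \<in> N" using x mc by (simp add: a_minus_def R.a_assoc R.l_neg)
  qed
qed

text \<open>The fibre product of \<open>Y\<close> and \<open>B\<close> over \<open>B/J\<close>,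
  where \<open>Y\<close> maps by \<open>L\<close> followed by the quotient map.\<close>

definition pullback_alg ::
    "'a normed_alg \<Rightarrow> 'b normed_alg \<Rightarrow> ('a \<Rightarrow> 'b) \<Rightarrow> 'b set \<Rightarrow> ('a \<times> 'b) normed_alg"
  where "pullback_alg Y B L J =
    \<lparr>carrier = {p. fst p \<in> carrier Y \<and> snd p \<in> carrier B \<and> snd p \<ominus>\<^bsub>B\<^esub> L (fst p) \<in> J},
     mult = (\<lambda>p q. (fst p \<otimes>\<^bsub>Y\<^esub> fst q, snd p \<otimes>\<^bsub>B\<^esub> snd q)), one = (\<one>\<^bsub>Y\<^esub>, \<one>\<^bsub>B\<^esub>),
     zero = (\<zero>\<^bsub>Y\<^esub>, \<zero>\<^bsub>B\<^esub>), add = (\<lambda>p q. (fst p \<oplus>\<^bsub>Y\<^esub> fst q, snd p \<oplus>\<^bsub>B\<^esub> snd q)),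
     smult = (\<lambda>c p. (c \<odot>\<^bsub>Y\<^esub> fst p, c \<odot>\<^bsub>B\<^esub> snd p)),
     nrm = (\<lambda>p. max (nrm Y (fst p)) (nrm B (snd p)))\<rparr>"

locale alg_pullback = Y: complex_banach_algebra Y + B: complex_banach_algebra B +
    L: ring_hom_ring Y B L + J: ideal J B
  for Y :: "'a normed_alg" and B :: "'b normed_alg" and L :: "'a \<Rightarrow> 'b" and J :: "'b set" +
  assumes L_scale: "y \<in> carrier Y \<Longrightarrow> L (c \<odot>\<^bsub>Y\<^esub> y) = c \<odot>\<^bsub>B\<^esub> L y"
    and L_contraction: "y \<in> carrier Y \<Longrightarrow> nrm B (L y) \<le> nrm Y y"
    and J_closed: "closedin (alg_topology B) J"
begin

abbreviation A :: "('a \<times> 'b) normed_alg" where "A \<equiv> pullback_alg Y B L J"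

definition ker_ideal :: "('a \<times> 'b) set" where "ker_ideal = {\<zero>\<^bsub>Y\<^esub>} \<times> J"

lemma A_simps [simp]:
  "(y, T) \<in> carrier A \<longleftrightarrow> y \<in> carrier Y \<and> T \<in> carrier B \<and> T \<ominus>\<^bsub>B\<^esub> L y \<in> J"
  "p \<otimes>\<^bsub>A\<^esub> q = (fst p \<otimes>\<^bsub>Y\<^esub> fst q, snd p \<otimes>\<^bsub>B\<^esub> snd q)" "\<one>\<^bsub>A\<^esub> = (\<one>\<^bsub>Y\<^esub>, \<one>\<^bsub>B\<^esub>)" "\<zero>\<^bsub>A\<^esub> = (\<zero>\<^bsub>Y\<^esub>, \<zero>\<^bsub>B\<^esub>)"
  "p \<oplus>\<^bsub>A\<^esub> q = (fst p \<oplus>\<^bsub>Y\<^esub> fst q, snd p \<oplus>\<^bsub>B\<^esub> snd q)" "c \<odot>\<^bsub>A\<^esub> p = (c \<odot>\<^bsub>Y\<^esub> fst p, c \<odot>\<^bsub>B\<^esub> snd p)"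
  "nrm A p = max (nrm Y (fst p)) (nrm B (snd p))"
  by (simp_all add: pullback_alg_def)

text \<open>\<open>ideal\<close> speaks of ring multiplication only; scalars are reached through
  multiples of the unit.\<close>

lemma J_scale: "T \<in> J \<Longrightarrow> c \<odot>\<^bsub>B\<^esub> T \<in> J"
  using J.I_l_closed[of T "c \<odot>\<^bsub>B\<^esub> \<one>\<^bsub>B\<^esub>"] J.a_Hcarr by (simp add: B.smult_mult_left)

lemma J_diff: "S \<in> J \<Longrightarrow> T \<in> J \<Longrightarrow> S \<ominus>\<^bsub>B\<^esub> T \<in> J"
  by (simp add: a_minus_def J.a_closed J.a_inv_closed B.abelian_group_axioms)

lemma A_mult_closed:
  assumes "y \<in> carrier Y" "T \<in> carrier B" "T \<ominus>\<^bsub>B\<^esub> L y \<in> J" "z \<in> carrier Y" "S \<in> carrier B" "S \<ominus>\<^bsub>B\<^esub> L z \<in> J"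
  shows "T \<otimes>\<^bsub>B\<^esub> S \<ominus>\<^bsub>B\<^esub> L (y \<otimes>\<^bsub>Y\<^esub> z) \<in> J"
proof -
  \<comment> \<open>Product rule for the defect:
    \<open>T S - L y L z = (T - L y) S + L y (S - L z)\<close>.\<close>
  have "(T \<ominus>\<^bsub>B\<^esub> L y) \<otimes>\<^bsub>B\<^esub> S \<oplus>\<^bsub>B\<^esub> L y \<otimes>\<^bsub>B\<^esub> (S \<ominus>\<^bsub>B\<^esub> L z) \<in> J"
    using assms by (intro J.a_closed J.I_l_closed J.I_r_closed) auto
  then show ?thesis
    using assms by (simp add: B.diff_distrib_left B.diff_distrib_right B.diff_add_diff)
qed

lemma A_add_closed:
  assumes "y \<in> carrier Y" "T \<in> carrier B" "T \<ominus>\<^bsub>B\<^esub> L y \<in> J" "z \<in> carrier Y" "S \<in> carrier B" "S \<ominus>\<^bsub>B\<^esub> L z \<in> J"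
  shows "(T \<oplus>\<^bsub>B\<^esub> S) \<ominus>\<^bsub>B\<^esub> L (y \<oplus>\<^bsub>Y\<^esub> z) \<in> J"
  using assms J.a_closed by (simp add: B.add_diff_interchange)

lemma A_scale_closed:
  assumes "y \<in> carrier Y" "T \<in> carrier B" "T \<ominus>\<^bsub>B\<^esub> L y \<in> J"
  shows "c \<odot>\<^bsub>B\<^esub> T \<ominus>\<^bsub>B\<^esub> L (c \<odot>\<^bsub>Y\<^esub> y) \<in> J"
  using J_scale[OF assms(3), of c] assms by (simp add: L_scale B.scale_diff_right)

lemma A_normed: "complex_normed_algebra A"
proof (rule complex_normed_algebraI)
  have zero: "\<zero>\<^bsub>A\<^esub> \<in> carrier A" by (simp add: J.zero_closed)
  have one: "\<one>\<^bsub>A\<^esub> \<in> carrier A" by (simp add: J.zero_closed)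
  show "ring A"
  proof (rule ringI)
    show "abelian_group A"
    proof (rule abelian_groupI)
      show "\<exists>q\<in>carrier A. q \<oplus>\<^bsub>A\<^esub> p = \<zero>\<^bsub>A\<^esub>" if "p \<in> carrier A" for p
      proof -
        obtain y T where p: "p = (y, T)" by fastforce
        then have yT: "y \<in> carrier Y" "T \<in> carrier B" "T \<ominus>\<^bsub>B\<^esub> L y \<in> J" using that by simp_all
        have "(- 1) \<odot>\<^bsub>A\<^esub> p \<in> carrier A"
          using A_scale_closed[OF yT, of "- 1"] yT by (simp add: p del: Y.scale_minus_left B.scale_minus_left)
        moreover have "(- 1) \<odot>\<^bsub>A\<^esub> p \<oplus>\<^bsub>A\<^esub> p = \<zero>\<^bsub>A\<^esub>" using yT by (simp add: p Y.l_neg B.l_neg)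
        ultimately show ?thesis by blast
      qed
    qed (use zero in \<open>auto simp: A_add_closed Y.a_ac B.a_ac simp del: L.hom_add\<close>)
    show "monoid A"
      by (rule monoidI) (use one in \<open>auto simp: A_mult_closed Y.m_assoc B.m_assoc simp del: L.hom_mult\<close>)
  qed (auto simp: Y.l_distr B.l_distr Y.r_distr B.r_distr)
next
  fix p assume "p \<in> carrier A"
  then have c: "fst p \<in> carrier Y" "snd p \<in> carrier B" by (cases p; simp)+
  have "max a b = 0 \<longleftrightarrow> a = 0 \<and> b = 0" if "0 \<le> a" "0 \<le> b" for a b :: real
    using that by (auto simp: max_def)
  then show "nrm A p = 0 \<longleftrightarrow> p = \<zero>\<^bsub>A\<^esub>"
    using c Y.nrm_nonneg B.nrm_nonneg Y.nrm_eq_0_iff B.nrm_eq_0_iff by (cases p) simp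
next
  fix p q assume "p \<in> carrier A" "q \<in> carrier A"
  then have pq: "fst p \<in> carrier Y" "snd p \<in> carrier B" "fst q \<in> carrier Y" "snd q \<in> carrier B" by (cases p; cases q; simp)+
  show "nrm A (p \<oplus>\<^bsub>A\<^esub> q) \<le> nrm A p + nrm A q"
    using Y.nrm_triangle[OF pq(1,3)] B.nrm_triangle[OF pq(2,4)] by auto
  have "nrm Y (fst p) * nrm Y (fst q) \<le> nrm A p * nrm A q" "nrm B (snd p) * nrm B (snd q) \<le> nrm A p * nrm A q"
    using pq Y.nrm_nonneg B.nrm_nonneg by (auto intro!: mult_mono simp: le_max_iff_disj)
  then show "nrm A (p \<otimes>\<^bsub>A\<^esub> q) \<le> nrm A p * nrm A q"
    using Y.nrm_mult[OF pq(1,3)] B.nrm_mult[OF pq(2,4)] by auto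
qed (auto simp: A_scale_closed Y.scale_add_left B.scale_add_left Y.scale_add_right B.scale_add_right
    Y.smult_mult_left Y.smult_mult_right B.smult_mult_left B.smult_mult_right Y.nrm_nonneg B.nrm_nonneg
    Y.nrm_smult B.nrm_smult max_mult_distrib_left le_max_iff_disj)

sublocale A: complex_normed_algebra A by (rule A_normed)

lemma A_diff:
  assumes "p \<in> carrier A" "q \<in> carrier A"
  shows "p \<ominus>\<^bsub>A\<^esub> q = (fst p \<ominus>\<^bsub>Y\<^esub> fst q, snd p \<ominus>\<^bsub>B\<^esub> snd q)"
proof -
  have "p \<ominus>\<^bsub>A\<^esub> q = p \<oplus>\<^bsub>A\<^esub> (- 1) \<odot>\<^bsub>A\<^esub> q"
    using assms by (simp add: A.scale_minus_left a_minus_def del: A_simps)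
  then show ?thesis using assms by (cases p; cases q) (simp add: a_minus_def)
qed

lemma A_banach: "complex_banach_algebra A"
proof -
  have "\<exists>l\<in>carrier A. (\<lambda>n. nrm A (s n \<ominus>\<^bsub>A\<^esub> l)) \<longlonglongrightarrow> 0"
    if s: "\<forall>n. s n \<in> carrier A"
      and cauchy: "\<forall>\<epsilon>>0. \<exists>N. \<forall>m\<ge>N. \<forall>n\<ge>N. nrm A (s m \<ominus>\<^bsub>A\<^esub> s n) < \<epsilon>" for s
  proof -
    define u where "u n = fst (s n)" for n
    define v where "v n = snd (s n)" for n
    have sn: "s n \<in> carrier A" "s n = (u n, v n)" for n using s by (auto simp: u_def v_def)
    have uv: "u n \<in> carrier Y" "v n \<in> carrier B" "v n \<ominus>\<^bsub>B\<^esub> L (u n) \<in> J" for n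
      using sn(1)[of n] unfolding sn(2)[of n] by auto
    have d: "nrm A (s m \<ominus>\<^bsub>A\<^esub> s n) = max (nrm Y (u m \<ominus>\<^bsub>Y\<^esub> u n)) (nrm B (v m \<ominus>\<^bsub>B\<^esub> v n))" for m n
      using sn(1) by (simp add: A_diff u_def v_def)
    have "\<exists>N. \<forall>m\<ge>N. \<forall>n\<ge>N. nrm Y (u m \<ominus>\<^bsub>Y\<^esub> u n) < \<epsilon>"
      "\<exists>N. \<forall>m\<ge>N. \<forall>n\<ge>N. nrm B (v m \<ominus>\<^bsub>B\<^esub> v n) < \<epsilon>" if "\<epsilon> > 0" for \<epsilon>
      using cauchy[unfolded d] that by (auto simp del: A_simps) (meson)+
    then obtain y T where y: "y \<in> carrier Y" "(\<lambda>n. nrm Y (u n \<ominus>\<^bsub>Y\<^esub> y)) \<longlonglongrightarrow> 0"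
      and T: "T \<in> carrier B" "(\<lambda>n. nrm B (v n \<ominus>\<^bsub>B\<^esub> T)) \<longlonglongrightarrow> 0"
      using Y.complete[unfolded Y.mcomplete_iff_nrm, THEN spec[of _ u], THEN mp]
        B.complete[unfolded B.mcomplete_iff_nrm, THEN spec[of _ v], THEN mp] uv by auto
    \<comment> \<open>Contractivity of \<open>L\<close> makes the defects, all in \<open>J\<close>,
      converge to \<open>T - L y\<close>; closedness of \<open>J\<close> then keeps the limit pair
      in the carrier.\<close>
    have "(\<lambda>n. nrm B ((v n \<ominus>\<^bsub>B\<^esub> L (u n)) \<ominus>\<^bsub>B\<^esub> (T \<ominus>\<^bsub>B\<^esub> L y))) \<longlonglongrightarrow> 0"
    proof (rule tendsto_sandwich[of "\<lambda>_. 0"])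
      have "nrm B ((v n \<ominus>\<^bsub>B\<^esub> L (u n)) \<ominus>\<^bsub>B\<^esub> (T \<ominus>\<^bsub>B\<^esub> L y))
          \<le> nrm B (v n \<ominus>\<^bsub>B\<^esub> T) + nrm Y (u n \<ominus>\<^bsub>Y\<^esub> y)" for n
      proof -
        have "(v n \<ominus>\<^bsub>B\<^esub> L (u n)) \<ominus>\<^bsub>B\<^esub> (T \<ominus>\<^bsub>B\<^esub> L y) = (v n \<ominus>\<^bsub>B\<^esub> T) \<ominus>\<^bsub>B\<^esub> L (u n \<ominus>\<^bsub>Y\<^esub> y)"
          using uv y T by (simp add: a_minus_def B.minus_add B.a_ac)
        then show ?thesis
          using B.nrm_diff_le[of "v n \<ominus>\<^bsub>B\<^esub> T" "L (u n \<ominus>\<^bsub>Y\<^esub> y)"] L_contraction[of "u n \<ominus>\<^bsub>Y\<^esub> y"] uv y T by simp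
      qed
      then show "\<forall>\<^sub>F n in sequentially. nrm B ((v n \<ominus>\<^bsub>B\<^esub> L (u n)) \<ominus>\<^bsub>B\<^esub> (T \<ominus>\<^bsub>B\<^esub> L y))
          \<le> nrm B (v n \<ominus>\<^bsub>B\<^esub> T) + nrm Y (u n \<ominus>\<^bsub>Y\<^esub> y)" by simp
      show "(\<lambda>n. nrm B (v n \<ominus>\<^bsub>B\<^esub> T) + nrm Y (u n \<ominus>\<^bsub>Y\<^esub> y)) \<longlonglongrightarrow> 0"
        using tendsto_add[OF T(2) y(2)] by simp
      have "0 \<le> nrm B ((v n \<ominus>\<^bsub>B\<^esub> L (u n)) \<ominus>\<^bsub>B\<^esub> (T \<ominus>\<^bsub>B\<^esub> L y))" for n
        using uv y T by (intro B.nrm_nonneg) simp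
      then show "\<forall>\<^sub>F n in sequentially. 0 \<le> nrm B ((v n \<ominus>\<^bsub>B\<^esub> L (u n)) \<ominus>\<^bsub>B\<^esub> (T \<ominus>\<^bsub>B\<^esub> L y))" by simp
    qed simp
    from B.closedin_limit[OF J_closed uv(3) _ this] have "T \<ominus>\<^bsub>B\<^esub> L y \<in> J"
      using y T by simp
    then have l: "(y, T) \<in> carrier A" using y T by simp
    have "(\<lambda>n. max (nrm Y (u n \<ominus>\<^bsub>Y\<^esub> y)) (nrm B (v n \<ominus>\<^bsub>B\<^esub> T))) \<longlonglongrightarrow> max 0 0"
      using y T by (intro tendsto_max)
    then have "(\<lambda>n. nrm A (s n \<ominus>\<^bsub>A\<^esub> (y, T))) \<longlonglongrightarrow> 0"
      using l sn(1) by (simp add: A_diff u_def v_def)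
    with l show ?thesis by blast
  qed
  then have "A.mcomplete" unfolding A.mcomplete_iff_nrm by blast
  then show ?thesis by (intro complex_banach_algebra.intro complex_banach_algebra_axioms.intro A_normed)
qed

text \<open>The point is that the pair of inverses again lies in the carrier. Multiplying the defect
  \<open>T - L y\<close> by \<open>T^-1\<close> on the left and \<open>L (y^-1)\<close> on the right
  gives \<open>L (y^-1) - T^-1\<close>, which is therefore in \<open>J\<close>.\<close>

lemma Units_A:
  assumes p: "(y, T) \<in> carrier A"
  shows "(y, T) \<in> Units A \<longleftrightarrow> y \<in> Units Y \<and> T \<in> Units B"
proof
  assume "(y, T) \<in> Units A"
  then obtain q where "q \<in> carrier A" "q \<otimes>\<^bsub>A\<^esub> (y, T) = \<one>\<^bsub>A\<^esub>" "(y, T) \<otimes>\<^bsub>A\<^esub> q = \<one>\<^bsub>A\<^esub>"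
    unfolding Units_def by blast
  then show "y \<in> Units Y \<and> T \<in> Units B"
    using p by (cases q) (auto simp: Units_def)
next
  assume u: "y \<in> Units Y \<and> T \<in> Units B"
  let ?y = "inv\<^bsub>Y\<^esub> y" and ?T = "inv\<^bsub>B\<^esub> T"
  have c: "y \<in> carrier Y" "T \<in> carrier B" "?y \<in> carrier Y" "?T \<in> carrier B" using u by auto
  have e: "L y \<otimes>\<^bsub>B\<^esub> L ?y = \<one>\<^bsub>B\<^esub>" using u c by (simp flip: L.hom_mult)
  have "?T \<otimes>\<^bsub>B\<^esub> (T \<ominus>\<^bsub>B\<^esub> L y) \<otimes>\<^bsub>B\<^esub> L ?y \<in> J"
    using p c by (intro J.I_r_closed J.I_l_closed) auto
  also have "?T \<otimes>\<^bsub>B\<^esub> (T \<ominus>\<^bsub>B\<^esub> L y) \<otimes>\<^bsub>B\<^esub> L ?y = L ?y \<ominus>\<^bsub>B\<^esub> ?T"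
    using c u e by (simp add: B.diff_distrib_left B.diff_distrib_right B.m_assoc)
  finally have "\<zero>\<^bsub>B\<^esub> \<ominus>\<^bsub>B\<^esub> (L ?y \<ominus>\<^bsub>B\<^esub> ?T) \<in> J" by (rule J_diff[OF J.zero_closed])
  then have "?T \<ominus>\<^bsub>B\<^esub> L ?y \<in> J"
    using c by (simp add: a_minus_def B.minus_add B.a_comm)
  then show "(y, T) \<in> Units A"
    using p c u by (intro A.Units_I[of _ "(?y, ?T)"]) auto
qed

lemma spectrum_A:
  assumes p: "(y, T) \<in> carrier A"
  shows "spectrum A (y, T) = spectrum Y y \<union> spectrum B T"
proof -
  have "z \<odot>\<^bsub>A\<^esub> \<one>\<^bsub>A\<^esub> \<ominus>\<^bsub>A\<^esub> (y, T) = (z \<odot>\<^bsub>Y\<^esub> \<one>\<^bsub>Y\<^esub> \<ominus>\<^bsub>Y\<^esub> y, z \<odot>\<^bsub>B\<^esub> \<one>\<^bsub>B\<^esub> \<ominus>\<^bsub>B\<^esub> T)" for z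
    using A_diff[OF A.scale_closed[OF A.one_closed] p] by simp
  moreover have "z \<odot>\<^bsub>A\<^esub> \<one>\<^bsub>A\<^esub> \<ominus>\<^bsub>A\<^esub> (y, T) \<in> carrier A" for z
    using p by (intro A.minus_closed A.scale_closed A.one_closed)
  ultimately show ?thesis
    unfolding spectrum_def using Units_A by auto
qed

lemma embed_closed: "y \<in> carrier Y \<Longrightarrow> (y, L y) \<in> carrier A"
  by (simp add: J.zero_closed)

lemma embed_isometric: "isometric_embedding Y A (\<lambda>y. (y, L y))"
  unfolding isometric_embedding_def
  by (auto simp: ring_hom_def J.zero_closed L_scale L_contraction max_absorb1)

text \<open>A unital homomorphism preserves units, so the spectrum of \<open>L y\<close> adds
  nothing to the union in \<open>spectrum_A\<close>.\<close>

lemma spectrum_embed: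
  assumes y: "y \<in> carrier Y"
  shows "spectrum A (y, L y) = spectrum Y y"
proof -
  have "L x \<in> Units B" if x: "x \<in> Units Y" for x
  proof (rule B.Units_I[of _ "L (inv\<^bsub>Y\<^esub> x)"])
    show "L x \<otimes>\<^bsub>B\<^esub> L (inv\<^bsub>Y\<^esub> x) = \<one>\<^bsub>B\<^esub>" "L (inv\<^bsub>Y\<^esub> x) \<otimes>\<^bsub>B\<^esub> L x = \<one>\<^bsub>B\<^esub>"
      using x by (simp_all add: Y.Units_closed flip: L.hom_mult)
  qed (use x Y.Units_closed in auto)
  then have "z \<odot>\<^bsub>B\<^esub> \<one>\<^bsub>B\<^esub> \<ominus>\<^bsub>B\<^esub> L y \<in> Units B" if "z \<odot>\<^bsub>Y\<^esub> \<one>\<^bsub>Y\<^esub> \<ominus>\<^bsub>Y\<^esub> y \<in> Units Y" for z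
  proof -
    have "L (z \<odot>\<^bsub>Y\<^esub> \<one>\<^bsub>Y\<^esub> \<ominus>\<^bsub>Y\<^esub> y) = z \<odot>\<^bsub>B\<^esub> \<one>\<^bsub>B\<^esub> \<ominus>\<^bsub>B\<^esub> L y"
      using y by (simp add: a_minus_def L_scale)
    then show ?thesis using that \<open>\<And>x. x \<in> Units Y \<Longrightarrow> L x \<in> Units B\<close> by metis
  qed
  then have "spectrum B (L y) \<subseteq> spectrum Y y" unfolding spectrum_def by auto
  then show ?thesis using spectrum_A[OF embed_closed[OF y]] by auto
qed

lemma ker_ideal_iff: "p \<in> ker_ideal \<longleftrightarrow> p \<in> carrier A \<and> fst p = \<zero>\<^bsub>Y\<^esub>"
  by (cases p) (auto simp: ker_ideal_def J.a_Hcarr J.zero_closed)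

lemma fst_hom: "ring_hom_ring A Y fst"
proof (rule ring_hom_ringI)
  show "fst p \<in> carrier Y" if "p \<in> carrier A" for p using that by (cases p) simp
qed (use A.ring_axioms Y.ring_axioms in simp_all)

lemma fst_surj: "fst ` carrier A = carrier Y"
proof
  show "fst ` carrier A \<subseteq> carrier Y" by auto
  show "carrier Y \<subseteq> fst ` carrier A"
  proof
    fix y assume "y \<in> carrier Y"
    then show "y \<in> fst ` carrier A" by (intro image_eqI[OF _ embed_closed]) simp_all
  qed
qed

lemma a_kernel_fst: "a_kernel A Y fst = ker_ideal"
  using ker_ideal_iff by (auto simp: a_kernel_def' simp del: A_simps)

lemma ker_ideal_ideal: "ideal ker_ideal A"
  using ring_hom_ring.kernel_is_ideal[OF fst_hom] by (simp add: a_kernel_fst)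

lemma ker_ideal_closedin: "closedin (alg_topology A) ker_ideal"
  unfolding A.closedin_iff_nrm
proof (intro conjI allI ballI impI)
  show "ker_ideal \<subseteq> carrier A" using ker_ideal_iff by blast
  fix s l assume l: "l \<in> carrier A" and s: "(\<forall>n. s n \<in> ker_ideal) \<and> (\<lambda>n. nrm A (s n \<ominus>\<^bsub>A\<^esub> l)) \<longlonglongrightarrow> 0"
  have lc: "fst l \<in> carrier Y" using l by (cases l) auto
  have "nrm Y (fst l) \<le> nrm A (s n \<ominus>\<^bsub>A\<^esub> l)" for n
  proof -
    have sn: "s n \<in> carrier A" "fst (s n) = \<zero>\<^bsub>Y\<^esub>" using s ker_ideal_iff by blast+
    have "fst (s n) \<ominus>\<^bsub>Y\<^esub> fst l = \<ominus>\<^bsub>Y\<^esub> fst l" using sn(2) lc by (simp add: a_minus_def)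
    then show ?thesis
      using A_diff[OF sn(1) l] Y.nrm_minus[OF lc] by simp
  qed
  then have "nrm Y (fst l) \<le> 0"
    using s by (intro LIMSEQ_le_const[of "\<lambda>n. nrm A (s n \<ominus>\<^bsub>A\<^esub> l)" 0]) auto
  then have "fst l = \<zero>\<^bsub>Y\<^esub>" using Y.nrm_nonneg[OF lc] Y.nrm_eq_0_iff[OF lc] by simp
  then show "l \<in> ker_ideal" using l by (simp add: ker_ideal_iff)
qed

text \<open>Seeing cosets as fibres of \<open>fst\<close> makes scalar multiples and infima of norms
  in the quotient computable.\<close>

lemma ker_ideal_coset:
  assumes p: "p \<in> carrier A"
  shows "ker_ideal +>\<^bsub>A\<^esub> p = {q \<in> carrier A. fst q = fst p}"
proof
  show "ker_ideal +>\<^bsub>A\<^esub> p \<subseteq> {q \<in> carrier A. fst q = fst p}"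
  proof
    fix q assume "q \<in> ker_ideal +>\<^bsub>A\<^esub> p"
    then obtain k where k: "k \<in> ker_ideal" "q = k \<oplus>\<^bsub>A\<^esub> p" by (auto simp: a_r_coset_def' simp del: A_simps)
    then have "q \<in> carrier A" using p A.a_closed unfolding ker_ideal_iff by blast
    moreover have "fst q = fst p" using k p unfolding ker_ideal_iff by (cases p) auto
    ultimately show "q \<in> {q \<in> carrier A. fst q = fst p}" by blast
  qed
  show "{q \<in> carrier A. fst q = fst p} \<subseteq> ker_ideal +>\<^bsub>A\<^esub> p"
  proof
    fix q assume q: "q \<in> {q \<in> carrier A. fst q = fst p}"
    have "fst p \<in> carrier Y" using p by (cases p) simp
    then have "fst (q \<ominus>\<^bsub>A\<^esub> p) = \<zero>\<^bsub>Y\<^esub>"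
      using q p by (simp add: A_diff)
    then have "q \<ominus>\<^bsub>A\<^esub> p \<in> ker_ideal"
      using q p by (simp add: ker_ideal_iff)
    moreover have "q = (q \<ominus>\<^bsub>A\<^esub> p) \<oplus>\<^bsub>A\<^esub> p"
      using q p by (simp del: A_simps)
    ultimately show "q \<in> ker_ideal +>\<^bsub>A\<^esub> p" unfolding a_r_coset_def' by blast
  qed
qed

text \<open>The ring part is the homomorphism theorem for \<open>fst\<close>; scalars and norm are
  then read off on the fibres.\<close>

lemma quotient_isomorphic: "isometrically_isomorphic (quotient_alg A ker_ideal) Y"
proof -
  let ?h = "\<lambda>K. the_elem (fst ` K)"
  let ?Q = "quotient_alg A ker_ideal"
  have iso: "?h \<in> ring_iso (A Quot ker_ideal) Y"
    using ring_hom_ring.FactRing_iso_set[OF fst_hom fst_surj] by (simp add: a_kernel_fst)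
  have Qc: "carrier ?Q = carrier (A Quot ker_ideal)" by (simp add: quotient_alg_def)
  have rep: "\<exists>p\<in>carrier A. K = {q \<in> carrier A. fst q = fst p}" if "K \<in> carrier ?Q" for K
    using that ker_ideal_coset by (auto simp: Qc FactRing_def A_RCOSETS_def' simp del: A_simps)
  have h: "?h {q \<in> carrier A. fst q = fst p} = fst p" if "p \<in> carrier A" for p
  proof -
    have "fst ` {q \<in> carrier A. fst q = fst p} = {fst p}" using that by force
    then show ?thesis by simp
  qed
  have "?h \<in> ring_hom ?Q Y"
    using iso by (auto simp: ring_iso_def ring_hom_def quotient_alg_def)
  moreover have "bij_betw ?h (carrier ?Q) (carrier Y)"
    using iso by (simp add: ring_iso_def Qc)
  moreover have "?h (c \<odot>\<^bsub>?Q\<^esub> K) = c \<odot>\<^bsub>Y\<^esub> ?h K" if K: "K \<in> carrier ?Q" for c K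
  proof -
    obtain p where p: "p \<in> carrier A" "K = {q \<in> carrier A. fst q = fst p}" using rep[OF K] by blast
    have cp: "c \<odot>\<^bsub>A\<^esub> q \<in> carrier A" if "q \<in> carrier A" for q using that by (rule A.scale_closed)
    have "c \<odot>\<^bsub>?Q\<^esub> K = (\<Union>q\<in>K. ker_ideal +>\<^bsub>A\<^esub> (c \<odot>\<^bsub>A\<^esub> q))" by (simp add: quotient_alg_def)
    \<comment> \<open>Members of \<open>K\<close> share their first component, so the union runs
      over a constant family and collapses once \<open>K\<close> is known to be nonempty.\<close>
    also have "\<dots> = (\<Union>q\<in>K. {r \<in> carrier A. fst r = fst (c \<odot>\<^bsub>A\<^esub> p)})"
    proof (intro SUP_cong refl)
      fix q assume "q \<in> K"
      then have "q \<in> carrier A" "fst q = fst p" using p(2) by auto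
      then show "ker_ideal +>\<^bsub>A\<^esub> (c \<odot>\<^bsub>A\<^esub> q) = {r \<in> carrier A. fst r = fst (c \<odot>\<^bsub>A\<^esub> p)}"
        using ker_ideal_coset[OF cp[of q]] by simp
    qed
    also have "\<dots> = {r \<in> carrier A. fst r = fst (c \<odot>\<^bsub>A\<^esub> p)}"
    proof -
      have "K \<noteq> {}" using p by blast
      then show ?thesis by simp
    qed
    finally have "?h (c \<odot>\<^bsub>?Q\<^esub> K) = fst (c \<odot>\<^bsub>A\<^esub> p)" using h[OF cp[OF p(1)]] by simp
    then show ?thesis using h[OF p(1)] p by simp
  qed
  moreover have "nrm Y (?h K) = nrm ?Q K" if K: "K \<in> carrier ?Q" for K
  proof -
    obtain p where p: "p \<in> carrier A" "K = {q \<in> carrier A. fst q = fst p}" using rep[OF K] by blast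
    have y: "fst p \<in> carrier Y" using p(1) by (cases p) simp
    have "nrm ?Q K = Inf (nrm A ` K)" by (simp add: quotient_alg_def)
    also have "\<dots> = nrm Y (fst p)"
    proof (rule cInf_eq_minimum)
      have "(fst p, L (fst p)) \<in> K" using embed_closed[OF y] p(2) by simp
      moreover have "nrm A (fst p, L (fst p)) = nrm Y (fst p)"
        using L_contraction[OF y] by simp
      ultimately show "nrm Y (fst p) \<in> nrm A ` K" by (metis imageI)
      show "nrm Y (fst p) \<le> r" if "r \<in> nrm A ` K" for r using that p(2) by auto
    qed
    finally show ?thesis using h[OF p(1)] p(2) by simp
  qed
  ultimately show ?thesis
    unfolding isometrically_isomorphic_def isometric_embedding_def by blast
qed

end

section \<open>Approximable operators\<close>

declare op_alg_simps(2-) [simp del]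

text \<open>Unfolding the operations would dissolve ring expressions into lambda terms. Evaluating
  only at carrier points keeps operators as ring elements, to which the general lemmas
  apply.\<close>

lemma op_alg_apply [simp]:
  assumes "x \<in> carrier A"
  shows "(S \<otimes>\<^bsub>op_alg A\<^esub> T) x = S (T x)" "\<one>\<^bsub>op_alg A\<^esub> x = x" "\<zero>\<^bsub>op_alg A\<^esub> x = \<zero>\<^bsub>A\<^esub>"
    "(S \<oplus>\<^bsub>op_alg A\<^esub> T) x = S x \<oplus>\<^bsub>A\<^esub> T x" "(c \<odot>\<^bsub>op_alg A\<^esub> T) x = c \<odot>\<^bsub>A\<^esub> T x"
  using assms by (simp_all add: op_alg_simps)

definition left_mult :: "'a normed_alg \<Rightarrow> 'a \<Rightarrow> 'a \<Rightarrow> 'a"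
  where "left_mult A y x = (if x \<in> carrier A then y \<otimes>\<^bsub>A\<^esub> x else \<zero>\<^bsub>A\<^esub>)"

definition rank_one :: "'a normed_alg \<Rightarrow> 'a \<Rightarrow> ('a \<Rightarrow> complex) \<Rightarrow> 'a \<Rightarrow> 'a"
  where "rank_one A x f y = f y \<odot>\<^bsub>A\<^esub> x"

text \<open>One rank-one operator is added at a time, so that the induction rule matches the
  Sherman-Morrison update.\<close>

inductive_set finite_rank :: "'a normed_alg \<Rightarrow> ('a \<Rightarrow> 'a) set" for A where
  zero: "\<zero>\<^bsub>op_alg A\<^esub> \<in> finite_rank A"
| add: "\<lbrakk>F \<in> finite_rank A; x \<in> carrier A; f \<in> dual A\<rbrakk>
    \<Longrightarrow> F \<oplus>\<^bsub>op_alg A\<^esub> rank_one A x f \<in> finite_rank A"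

definition approximable :: "'a normed_alg \<Rightarrow> ('a \<Rightarrow> 'a) set"
  where "approximable A = {K \<in> carrier (op_alg A).
    \<forall>\<epsilon>>0. \<exists>F\<in>finite_rank A. nrm (op_alg A) (K \<ominus>\<^bsub>op_alg A\<^esub> F) < \<epsilon>}"

section \<open>The closed ideal of approximable operators and rank-one updates\<close>

context complex_banach_algebra
begin

abbreviation B where "B \<equiv> op_alg A"

interpretation B: complex_banach_algebra B by (rule op_alg_banach)

lemma op_diff_apply:
  "S \<in> bounded_ops A \<Longrightarrow> T \<in> bounded_ops A \<Longrightarrow> (S \<ominus>\<^bsub>B\<^esub> T) x = S x \<ominus> T x"
  by (simp add: op_alg_diff)

lemma op_closed [simp]:
  "S \<in> bounded_ops A \<Longrightarrow> T \<in> bounded_ops A \<Longrightarrow> S \<ominus>\<^bsub>B\<^esub> T \<in> bounded_ops A"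
  "S \<in> bounded_ops A \<Longrightarrow> T \<in> bounded_ops A \<Longrightarrow> S \<oplus>\<^bsub>B\<^esub> T \<in> bounded_ops A"
  "S \<in> bounded_ops A \<Longrightarrow> T \<in> bounded_ops A \<Longrightarrow> S \<otimes>\<^bsub>B\<^esub> T \<in> bounded_ops A"
  "T \<in> bounded_ops A \<Longrightarrow> \<ominus>\<^bsub>B\<^esub> T \<in> bounded_ops A"
  "T \<in> bounded_ops A \<Longrightarrow> c \<odot>\<^bsub>B\<^esub> T \<in> bounded_ops A" "\<zero>\<^bsub>B\<^esub> \<in> bounded_ops A" "\<one>\<^bsub>B\<^esub> \<in> bounded_ops A"
  using B.minus_closed B.a_closed B.m_closed B.a_inv_closed B.scale_closed B.zero_closed B.one_closed by simp_all

lemma op_apply_closed [simp, intro]: "T \<in> bounded_ops A \<Longrightarrow> T x \<in> carrier A"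
  by (rule bounded_opsD)

lemma op_eqI:
  assumes "S \<in> bounded_ops A" "T \<in> bounded_ops A" "\<And>x. x \<in> carrier A \<Longrightarrow> S x = T x"
  shows "S = T"
proof
  fix x show "S x = T x"
    using assms bounded_opsD(2)[OF assms(1), of x] bounded_opsD(2)[OF assms(2), of x] by (cases "x \<in> carrier A") auto
qed

lemma op_Units_bounded: "T \<in> Units B \<Longrightarrow> T \<in> bounded_ops A" "T \<in> Units B \<Longrightarrow> inv\<^bsub>B\<^esub> T \<in> bounded_ops A"
  using B.Units_closed B.Units_inv_closed unfolding op_alg_simps(1) by blast+

lemma op_inv_apply:
  assumes "T \<in> Units B" "x \<in> carrier A"
  shows "T ((inv\<^bsub>B\<^esub> T) x) = x" "(inv\<^bsub>B\<^esub> T) (T x) = x"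
proof -
  have "(T \<otimes>\<^bsub>B\<^esub> inv\<^bsub>B\<^esub> T) x = x" "(inv\<^bsub>B\<^esub> T \<otimes>\<^bsub>B\<^esub> T) x = x"
    using assms by (simp_all only: B.Units_r_inv B.Units_l_inv op_alg_apply(2))
  then show "T ((inv\<^bsub>B\<^esub> T) x) = x" "(inv\<^bsub>B\<^esub> T) (T x) = x"
    using assms(2) by (simp_all only: op_alg_apply(1))
qed

lemma op_UnitsI:
  assumes "S \<in> bounded_ops A" "T \<in> bounded_ops A" "\<And>x. x \<in> carrier A \<Longrightarrow> S (T x) = x"
    "\<And>x. x \<in> carrier A \<Longrightarrow> T (S x) = x"
  shows "S \<in> Units B" "inv\<^bsub>B\<^esub> S = T"
proof -
  have e: "S \<otimes>\<^bsub>B\<^esub> T = \<one>\<^bsub>B\<^esub>" "T \<otimes>\<^bsub>B\<^esub> S = \<one>\<^bsub>B\<^esub>"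
    using assms by (auto intro!: op_eqI)
  then show U: "S \<in> Units B" using assms by (intro B.Units_I[of S T]) auto
  show "inv\<^bsub>B\<^esub> S = T" using e U assms by (metis B.inv_unique' op_alg_simps(1))
qed

lemma left_mult_bounded:
  assumes y: "y \<in> carrier A"
  shows "left_mult A y \<in> bounded_ops A" "op_norm A (left_mult A y) \<le> nrm A y"
proof -
  have 0: "0 \<le> nrm A y" using y by (rule nrm_nonneg)
  have le: "nrm A (left_mult A y x) \<le> nrm A y * nrm A x" if "x \<in> carrier A" for x
    using that y by (simp add: left_mult_def nrm_mult)
  show "left_mult A y \<in> bounded_ops A"
    by (rule bounded_opsI[OF _ _ _ _ 0 le]) (use y in \<open>auto simp: left_mult_def r_distr smult_mult_right\<close>)
  show "op_norm A (left_mult A y) \<le> nrm A y"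
    by (rule op_norm_le[OF 0 le])
qed

lemma left_mult_apply [simp]: "x \<in> carrier A \<Longrightarrow> left_mult A y x = y \<otimes> x"
  by (simp add: left_mult_def)

lemma left_mult_hom: "ring_hom_ring A B (left_mult A)"
  by (rule ring_hom_ringI)
    (auto intro!: op_eqI simp: left_mult_bounded ring_axioms B.ring_axioms m_assoc l_distr)

lemma left_mult_scale: "y \<in> carrier A \<Longrightarrow> left_mult A (c \<odot> y) = c \<odot>\<^bsub>B\<^esub> left_mult A y"
  by (intro op_eqI) (auto simp: left_mult_bounded smult_mult_left)

text \<open>Composition on the right acts on a rank-one operator through its functional; this makes
  the finite-rank operators a right ideal.\<close>

lemma dual_comp:
  assumes f: "f \<in> dual A" and S: "S \<in> bounded_ops A"
  shows "(\<lambda>x. f (S x)) \<in> dual A"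
proof -
  obtain K where K: "K \<ge> 0" "\<And>x. x \<in> carrier A \<Longrightarrow> cmod (f x) \<le> K * nrm A x"
    using dual_bound[OF f] by blast
  show ?thesis
  proof (rule dualI[where K = "K * op_norm A S"])
    show "cmod (f (S x)) \<le> K * op_norm A S * nrm A x" if "x \<in> carrier A" for x
      using order_trans[OF K(2) mult_left_mono[OF nrm_op_le[OF S that] K(1)]] S by (simp add: mult.assoc)
  qed (use f S in \<open>auto simp: bounded_opsD dual_zero dualD(2,3)\<close>)
qed

lemma rank_one_bounded:
  assumes x: "x \<in> carrier A" and f: "f \<in> dual A"
  shows "rank_one A x f \<in> bounded_ops A"
proof -
  obtain K where K: "K \<ge> 0" "\<And>x. x \<in> carrier A \<Longrightarrow> cmod (f x) \<le> K * nrm A x"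
    using dual_bound[OF f] by blast
  show ?thesis
  proof (rule bounded_opsI[where K = "K * nrm A x"])
    show "nrm A (rank_one A x f y) \<le> K * nrm A x * nrm A y" if "y \<in> carrier A" for y
      using mult_right_mono[OF K(2)[OF that] nrm_nonneg[OF x]] x by (simp add: rank_one_def nrm_smult mult_ac)
  qed (use x f K nrm_nonneg[OF x] in \<open>auto simp: rank_one_def dualD scale_add_left\<close>)
qed

lemma finite_rank_bounded: "F \<in> finite_rank A \<Longrightarrow> F \<in> bounded_ops A"
  by (induction rule: finite_rank.induct) (simp_all add: rank_one_bounded)

lemma finite_rank_add:
  assumes "F \<in> finite_rank A" "G \<in> finite_rank A"
  shows "F \<oplus>\<^bsub>B\<^esub> G \<in> finite_rank A"
  using assms(2,1)
proof (induction rule: finite_rank.induct)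
  case zero
  then show ?case using finite_rank_bounded by simp
next
  case (add G x f)
  then show ?case
    using finite_rank.add[of "F \<oplus>\<^bsub>B\<^esub> G" A x f] finite_rank_bounded rank_one_bounded
    by (simp add: B.a_assoc)
qed

lemma finite_rank_comp_left:
  assumes F: "F \<in> finite_rank A" and S: "S \<in> bounded_ops A"
  shows "S \<otimes>\<^bsub>B\<^esub> F \<in> finite_rank A"
  using F
proof (induction rule: finite_rank.induct)
  case zero
  then show ?case using S finite_rank.zero by simp
next
  case (add F x f)
  have "S \<otimes>\<^bsub>B\<^esub> rank_one A x f = rank_one A (S x) f"
    using add S by (intro op_eqI) (auto simp: rank_one_bounded rank_one_def bounded_opsD(4))
  then show ?case
    using add S finite_rank.add[of "S \<otimes>\<^bsub>B\<^esub> F" A "S x" f]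
    by (simp add: B.r_distr finite_rank_bounded rank_one_bounded)
qed

lemma finite_rank_comp_right:
  assumes F: "F \<in> finite_rank A" and S: "S \<in> bounded_ops A"
  shows "F \<otimes>\<^bsub>B\<^esub> S \<in> finite_rank A"
  using F
proof (induction rule: finite_rank.induct)
  case zero
  then show ?case using S finite_rank.zero by simp
next
  case (add F x f)
  have "rank_one A x f \<otimes>\<^bsub>B\<^esub> S = rank_one A x (\<lambda>y. f (S y))"
    using add S dual_comp by (intro op_eqI) (auto simp: rank_one_bounded rank_one_def)
  then show ?case
    using add S finite_rank.add[of "F \<otimes>\<^bsub>B\<^esub> S" A x "\<lambda>y. f (S y)"] dual_comp
    by (simp add: B.l_distr finite_rank_bounded rank_one_bounded)
qed

lemma rank_one_finite_rank: "x \<in> carrier A \<Longrightarrow> f \<in> dual A \<Longrightarrow> rank_one A x f \<in> finite_rank A"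
  using finite_rank.add[OF finite_rank.zero, of x A f] by (simp add: rank_one_bounded)

lemma finite_rank_approximable: "F \<in> finite_rank A \<Longrightarrow> F \<in> approximable A"
  unfolding approximable_def using finite_rank_bounded B.nrm_zero by (auto intro!: bexI[of _ F])

lemma approximableD:
  assumes "K \<in> approximable A"
  shows "K \<in> bounded_ops A" "\<epsilon> > 0 \<Longrightarrow> \<exists>F\<in>finite_rank A. nrm B (K \<ominus>\<^bsub>B\<^esub> F) < \<epsilon>"
  using assms unfolding approximable_def by auto

lemma approximable_ideal: "ideal (approximable A) B"
proof -
  \<comment> \<open>Dividing by \<open>nrm B S + 1\<close> covers the case
    \<open>S = 0\<close>.\<close>
  have small: "\<exists>F\<in>finite_rank A. nrm B S * nrm B (K \<ominus>\<^bsub>B\<^esub> F) < \<epsilon>"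
    if K: "K \<in> approximable A" and S: "S \<in> bounded_ops A" and e: "\<epsilon> > 0" for K S and \<epsilon> :: real
  proof -
    have S0: "nrm B S \<ge> 0" using S B.nrm_nonneg by simp
    then obtain F where F: "F \<in> finite_rank A" "nrm B (K \<ominus>\<^bsub>B\<^esub> F) < \<epsilon> / (nrm B S + 1)"
      using approximableD(2)[OF K, of "\<epsilon> / (nrm B S + 1)"] e by auto
    have "nrm B S * nrm B (K \<ominus>\<^bsub>B\<^esub> F) \<le> nrm B S * (\<epsilon> / (nrm B S + 1))"
      using S0 F by (intro mult_left_mono) auto
    also have "\<dots> < \<epsilon>" using S0 e by (simp add: field_simps)
    finally show ?thesis using F(1) by blast
  qed
  have left: "S \<otimes>\<^bsub>B\<^esub> K \<in> approximable A" if K: "K \<in> approximable A" and S: "S \<in> bounded_ops A" for K S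
  proof -
    have "\<exists>F\<in>finite_rank A. nrm B (S \<otimes>\<^bsub>B\<^esub> K \<ominus>\<^bsub>B\<^esub> F) < \<epsilon>" if e: "\<epsilon> > 0" for \<epsilon>
    proof -
      obtain F where F: "F \<in> finite_rank A" "nrm B S * nrm B (K \<ominus>\<^bsub>B\<^esub> F) < \<epsilon>"
        using small[OF K S e] by blast
      have "S \<otimes>\<^bsub>B\<^esub> K \<ominus>\<^bsub>B\<^esub> S \<otimes>\<^bsub>B\<^esub> F = S \<otimes>\<^bsub>B\<^esub> (K \<ominus>\<^bsub>B\<^esub> F)"
        using S approximableD(1)[OF K] finite_rank_bounded[OF F(1)] by (simp add: B.diff_distrib_left)
      then have "nrm B (S \<otimes>\<^bsub>B\<^esub> K \<ominus>\<^bsub>B\<^esub> S \<otimes>\<^bsub>B\<^esub> F) < \<epsilon>"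
        using F S approximableD(1)[OF K] finite_rank_bounded[OF F(1)] B.nrm_mult[of S "K \<ominus>\<^bsub>B\<^esub> F"] by simp
      then show ?thesis using finite_rank_comp_left[OF F(1) S] by blast
    qed
    then show ?thesis using S approximableD(1)[OF K] by (simp add: approximable_def)
  qed
  have right: "K \<otimes>\<^bsub>B\<^esub> S \<in> approximable A" if K: "K \<in> approximable A" and S: "S \<in> bounded_ops A" for K S
  proof -
    have "\<exists>F\<in>finite_rank A. nrm B (K \<otimes>\<^bsub>B\<^esub> S \<ominus>\<^bsub>B\<^esub> F) < \<epsilon>" if e: "\<epsilon> > 0" for \<epsilon>
    proof -
      obtain F where F: "F \<in> finite_rank A" "nrm B S * nrm B (K \<ominus>\<^bsub>B\<^esub> F) < \<epsilon>"
        using small[OF K S e] by blast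
      have "K \<otimes>\<^bsub>B\<^esub> S \<ominus>\<^bsub>B\<^esub> F \<otimes>\<^bsub>B\<^esub> S = (K \<ominus>\<^bsub>B\<^esub> F) \<otimes>\<^bsub>B\<^esub> S"
        using S approximableD(1)[OF K] finite_rank_bounded[OF F(1)] by (simp add: B.diff_distrib_right)
      then have "nrm B (K \<otimes>\<^bsub>B\<^esub> S \<ominus>\<^bsub>B\<^esub> F \<otimes>\<^bsub>B\<^esub> S) < \<epsilon>"
        using F S approximableD(1)[OF K] finite_rank_bounded[OF F(1)] B.nrm_mult[of "K \<ominus>\<^bsub>B\<^esub> F" S]
        by (simp add: mult.commute)
      then show ?thesis using finite_rank_comp_right[OF F(1) S] by blast
    qed
    then show ?thesis using S approximableD(1)[OF K] by (simp add: approximable_def)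
  qed
  have add: "K \<oplus>\<^bsub>B\<^esub> K' \<in> approximable A" if K: "K \<in> approximable A" and K': "K' \<in> approximable A" for K K'
  proof -
    have "\<exists>F\<in>finite_rank A. nrm B ((K \<oplus>\<^bsub>B\<^esub> K') \<ominus>\<^bsub>B\<^esub> F) < \<epsilon>" if e: "\<epsilon> > 0" for \<epsilon>
    proof -
      obtain F where F: "F \<in> finite_rank A" "nrm B (K \<ominus>\<^bsub>B\<^esub> F) < \<epsilon> / 2"
        using approximableD(2)[OF K] half_gt_zero[OF e] by blast
      obtain F' where F': "F' \<in> finite_rank A" "nrm B (K' \<ominus>\<^bsub>B\<^esub> F') < \<epsilon> / 2"
        using approximableD(2)[OF K'] half_gt_zero[OF e] by blast
      note c = approximableD(1)[OF K] approximableD(1)[OF K'] finite_rank_bounded[OF F(1)] finite_rank_bounded[OF F'(1)]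
      have "(K \<oplus>\<^bsub>B\<^esub> K') \<ominus>\<^bsub>B\<^esub> (F \<oplus>\<^bsub>B\<^esub> F') = (K \<ominus>\<^bsub>B\<^esub> F) \<oplus>\<^bsub>B\<^esub> (K' \<ominus>\<^bsub>B\<^esub> F')"
        using c by (intro B.add_diff_interchange) simp_all
      then have "nrm B ((K \<oplus>\<^bsub>B\<^esub> K') \<ominus>\<^bsub>B\<^esub> (F \<oplus>\<^bsub>B\<^esub> F')) < \<epsilon>"
        using B.nrm_triangle[of "K \<ominus>\<^bsub>B\<^esub> F" "K' \<ominus>\<^bsub>B\<^esub> F'"] F(2) F'(2) c by simp
      then show ?thesis using finite_rank_add[OF F(1) F'(1)] by blast
    qed
    then show ?thesis using approximableD(1)[OF K] approximableD(1)[OF K'] by (simp add: approximable_def)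
  qed
  have neg: "\<ominus>\<^bsub>B\<^esub> K \<in> approximable A" if K: "K \<in> approximable A" for K
  proof -
    have "\<ominus>\<^bsub>B\<^esub> \<one>\<^bsub>B\<^esub> \<in> bounded_ops A" using B.a_inv_closed[OF B.one_closed] by simp
    from left[OF K this] show ?thesis using approximableD(1)[OF K] by (simp add: B.l_minus)
  qed
  show ?thesis
  proof (intro ideal.intro ideal_axioms.intro B.additive_subgroupI_ring B.ring_axioms)
    show "approximable A \<subseteq> carrier B" using approximableD(1) by auto
    show "\<zero>\<^bsub>B\<^esub> \<in> approximable A" by (intro finite_rank_approximable finite_rank.zero)
  qed (use add neg left right in auto)
qed

lemma approximable_closedin: "closedin (alg_topology B) (approximable A)"
  unfolding B.closedin_iff_nrm
proof (intro conjI allI ballI impI)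
  show "approximable A \<subseteq> carrier B" using approximableD(1) by auto
  fix s l assume l: "l \<in> carrier B" and s: "(\<forall>n. s n \<in> approximable A) \<and> (\<lambda>n. nrm B (s n \<ominus>\<^bsub>B\<^esub> l)) \<longlonglongrightarrow> 0"
  have "\<exists>F\<in>finite_rank A. nrm B (l \<ominus>\<^bsub>B\<^esub> F) < \<epsilon>" if e: "\<epsilon> > 0" for \<epsilon>
  proof -
    have "\<forall>\<^sub>F n in sequentially. nrm B (s n \<ominus>\<^bsub>B\<^esub> l) < \<epsilon> / 2"
      using s e by (intro order_tendstoD(2)[of _ 0]) auto
    then obtain n where n: "nrm B (s n \<ominus>\<^bsub>B\<^esub> l) < \<epsilon> / 2" by (meson eventually_happens trivial_limit_sequentially)
    have sn: "s n \<in> approximable A" using s by blast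
    obtain F where F: "F \<in> finite_rank A" "nrm B (s n \<ominus>\<^bsub>B\<^esub> F) < \<epsilon> / 2"
      using approximableD(2)[OF sn half_gt_zero[OF e]] by blast
    have "nrm B (l \<ominus>\<^bsub>B\<^esub> F) \<le> nrm B (l \<ominus>\<^bsub>B\<^esub> s n) + nrm B (s n \<ominus>\<^bsub>B\<^esub> F)"
      using l approximableD(1)[OF sn] finite_rank_bounded[OF F(1)] by (intro B.nrm_diff_triangle) simp_all
    moreover have "nrm B (l \<ominus>\<^bsub>B\<^esub> s n) = nrm B (s n \<ominus>\<^bsub>B\<^esub> l)"
      using l approximableD(1)[OF sn] by (intro B.nrm_diff_commute) simp_all
    ultimately have "nrm B (l \<ominus>\<^bsub>B\<^esub> F) < \<epsilon>" using n F(2) by linarith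
    then show ?thesis using F(1) by blast
  qed
  then show "l \<in> approximable A" using l by (simp add: approximable_def)
qed

lemma approximable_pullback: "alg_pullback A B (left_mult A) (approximable A)"
  by (intro alg_pullback.intro alg_pullback_axioms.intro approximable_ideal left_mult_hom
      complex_banach_algebra_axioms B.complex_banach_algebra_axioms approximable_closedin)
    (simp_all add: left_mult_scale left_mult_bounded op_alg_simps(7))

text \<open>Used twice: for the induction on the rank in \<open>analytic_fredholm\<close>, and to
  clear a neighbourhood of \<open>l\<close> of spectrum in
  \<open>pullback_discontinuity\<close>.\<close>

lemma Sherman_Morrison:
  assumes T: "T \<in> Units B" and x: "x \<in> carrier A" and f: "f \<in> dual A"
    and ne: "f ((inv\<^bsub>B\<^esub> T) x) \<noteq> 1"
  shows "T \<ominus>\<^bsub>B\<^esub> rank_one A x f \<in> Units B"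
    and "(inv\<^bsub>B\<^esub> (T \<ominus>\<^bsub>B\<^esub> rank_one A x f)) y =
      (inv\<^bsub>B\<^esub> T) y \<oplus> (f ((inv\<^bsub>B\<^esub> T) y) / (1 - f ((inv\<^bsub>B\<^esub> T) x))) \<odot> (inv\<^bsub>B\<^esub> T) x"
proof -
  let ?S = "inv\<^bsub>B\<^esub> T"
  define v where "v = ?S x"
  \<comment> \<open>A solution \<open>u\<close> of \<open>T u - f u x = y\<close> satisfies
    \<open>u = T^-1 y + f u v\<close>. Applying \<open>f\<close> determines \<open>f u\<close> as
    \<open>g y\<close>.\<close>
  define g where "g = (\<lambda>y. inverse (1 - f v) * f (?S y))"
  have TB: "T \<in> bounded_ops A" and SB: "?S \<in> bounded_ops A"
    using op_Units_bounded[OF T] by blast+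
  have v: "v \<in> carrier A" using SB by (simp add: v_def)
  have g: "g \<in> dual A" unfolding g_def by (rule dual_scale[OF dual_comp[OF f SB]])
  define S' where "S' = ?S \<oplus>\<^bsub>B\<^esub> rank_one A v g"
  have S'B: "S' \<in> bounded_ops A" using SB v g by (simp add: S'_def rank_one_bounded)
  have S'y: "S' y = ?S y \<oplus> g y \<odot> v" for y by (simp add: S'_def rank_one_def op_alg_simps)
  have RB: "rank_one A x f \<in> bounded_ops A" by (rule rank_one_bounded[OF x f])
  have nv: "1 - f v \<noteq> 0" using ne by (simp add: v_def)
  have Tv: "T v = x" using op_inv_apply(1)[OF T x] by (simp add: v_def)
  have 1: "(T \<ominus>\<^bsub>B\<^esub> rank_one A x f) (S' y) = y" if y: "y \<in> carrier A" for y
  proof -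
    have "T (S' y) = y \<oplus> g y \<odot> x"
      using y v SB TB Tv by (simp add: S'y bounded_opsD(3,4) op_inv_apply[OF T])
    moreover have "f (S' y) = f (?S y) + g y * f v"
      using v SB f by (simp add: S'y dualD)
    moreover have "f (?S y) + g y * f v = g y" using nv by (simp add: g_def field_simps)
    ultimately have "(T \<ominus>\<^bsub>B\<^esub> rank_one A x f) (S' y) = (y \<oplus> g y \<odot> x) \<ominus> g y \<odot> x"
      using TB RB by (simp add: rank_one_def op_diff_apply)
    then show ?thesis using x y by (simp add: diff_eq_iff)
  qed
  have 2: "S' ((T \<ominus>\<^bsub>B\<^esub> rank_one A x f) y) = y" if y: "y \<in> carrier A" for y
  proof -
    let ?z = "T y \<ominus> f y \<odot> x"
    have "?S ?z = y \<ominus> f y \<odot> v"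
      using x y TB SB by (simp add: a_minus_def bounded_opsD(3,4) bounded_ops_minus op_inv_apply[OF T] v_def)
    moreover have "f (y \<ominus> f y \<odot> v) = f y * (1 - f v)"
      using y v f by (simp add: dual_diff dualD(3) algebra_simps)
    ultimately have "g ?z = f y" "?S ?z = y \<ominus> f y \<odot> v" using nv by (simp_all add: g_def)
    then show ?thesis
      using x y v TB RB by (simp add: S'y rank_one_def op_diff_apply)
  qed
  have "T \<ominus>\<^bsub>B\<^esub> rank_one A x f \<in> bounded_ops A" using TB RB by simp
  note U = op_UnitsI[OF this S'B 1 2]
  show "T \<ominus>\<^bsub>B\<^esub> rank_one A x f \<in> Units B" by (rule U)
  show "(inv\<^bsub>B\<^esub> (T \<ominus>\<^bsub>B\<^esub> rank_one A x f)) y = ?S y \<oplus> (f (?S y) / (1 - f (?S x))) \<odot> ?S x"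
    using S'y[of y] by (simp add: U(2) g_def v_def divide_inverse mult.commute)
qed

end

section \<open>Analytic Fredholm theory for approximable operators\<close>

text \<open>Such a set is countable, and if infinite, any injective enumeration of it leaves each
  disc about 0 only finitely often.\<close>

lemma finite_or_null_sequence:
  fixes S :: "complex set"
  assumes fin: "\<And>r. r > 0 \<Longrightarrow> finite {z \<in> S. r \<le> cmod z}"
  shows "finite S \<or> (\<exists>s :: nat \<Rightarrow> complex. range s = S \<and> s \<longlonglongrightarrow> 0)"
proof (cases "finite S")
  case False
  have "S \<subseteq> {0} \<union> (\<Union>n. {z \<in> S. inverse (real (Suc n)) \<le> cmod z})"
  proof
    fix z assume z: "z \<in> S"
    show "z \<in> {0} \<union> (\<Union>n. {z \<in> S. inverse (real (Suc n)) \<le> cmod z})"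
    proof (cases "z = 0")
      case False
      then obtain n where "inverse (real (Suc n)) < cmod z"
        using reals_Archimedean[of "cmod z"] by auto
      then show ?thesis using z by (auto intro: less_imp_le)
    qed simp
  qed
  moreover have "countable {z \<in> S. inverse (real (Suc n)) \<le> cmod z}" for n
    by (intro countable_finite fin) simp
  then have "countable ({0} \<union> (\<Union>n. {z \<in> S. inverse (real (Suc n)) \<le> cmod z}))"
    by (intro countable_Un countable_UN) simp_all
  ultimately have "countable S" by (rule countable_subset)
  with False obtain s :: "nat \<Rightarrow> complex" where bij: "bij_betw s UNIV S"
    using bij_betw_from_nat_into by blast
  note inj = bij_betw_imp_inj_on[OF bij] and ran = bij_betw_imp_surj_on[OF bij]
  have "s \<longlonglongrightarrow> 0"
  proof (rule LIMSEQ_I)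
    fix r :: real assume "r > 0"
    \<comment> \<open>Injectivity of the enumeration matters here: finitely many values then occupy
      only finitely many indices.\<close>
    have "finite (s -` {z \<in> S. r \<le> cmod z})"
      by (rule finite_vimageI[OF fin[OF \<open>r > 0\<close>] inj])
    then obtain N where N: "\<forall>n\<in>s -` {z \<in> S. r \<le> cmod z}. n < N"
      unfolding finite_nat_set_iff_bounded by (rule exE)
    have "cmod (s n) < r" if "n \<ge> N" for n
    proof (rule ccontr)
      assume "\<not> cmod (s n) < r"
      then have "n \<in> s -` {z \<in> S. r \<le> cmod z}"
        using ran by auto
      then have "n < N" using N by (rule bspec[rotated])
      then show False using that by simp
    qed
    then show "\<exists>N. \<forall>n\<ge>N. norm (s n - 0) < r" by auto
  qed
  then show ?thesis using ran by blast
qed simp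

text \<open>Boundedness of \<open>T\<close> makes the real supremum meaningful; nonemptiness of
  \<open>S\<close> is asked because \<open>infdist\<close> to the empty set is 0 by
  convention.\<close>

lemma hausdorff_dist_ge:
  assumes "bounded T" "S \<noteq> {}" "y \<in> T" "\<And>s. s \<in> S \<Longrightarrow> r \<le> dist y s"
  shows "r \<le> hausdorff_dist S T"
proof -
  obtain s0 where s0: "s0 \<in> S" using assms(2) by blast
  obtain K where K: "\<And>z. z \<in> T \<Longrightarrow> dist s0 z \<le> K"
    using assms(1) unfolding bounded_any_center[of T s0] by blast
  have "bdd_above ((\<lambda>y. infdist y S) ` T)"
  proof (rule bdd_aboveI2)
    show "infdist z S \<le> K" if "z \<in> T" for z
      using infdist_le[OF s0, of z] K[OF that] by (simp add: dist_commute)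
  qed
  then have "infdist y S \<le> (SUP y\<in>T. infdist y S)" using assms(3) by (rule cSUP_upper2) simp
  moreover have "r \<le> infdist y S"
    using assms(2,4) by (simp add: infdist_def) (intro cINF_greatest; simp)
  ultimately show ?thesis by (simp add: hausdorff_dist_def)
qed

section \<open>Meromorphic resolvents and finiteness of the spectrum away from 0\<close>

context complex_banach_algebra
begin

interpretation B: complex_banach_algebra B by (rule op_alg_banach)

lemma dual_funpow:
  assumes f: "f \<in> dual A" and G: "G \<in> bounded_ops A"
  shows "(\<lambda>x. f ((G ^^ k) x)) \<in> dual A"
proof (induction k)
  case (Suc k)
  then show ?case using dual_comp[OF Suc G] by (simp add: funpow_Suc_right del: funpow.simps)
qed (use f in simp)

lemma nrm_funpow_le:
  assumes G: "G \<in> bounded_ops A" and x: "x \<in> carrier A"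
  shows "(G ^^ k) x \<in> carrier A" "nrm A ((G ^^ k) x) \<le> op_norm A G ^ k * nrm A x"
proof -
  have "(G ^^ k) x \<in> carrier A \<and> nrm A ((G ^^ k) x) \<le> op_norm A G ^ k * nrm A x"
  proof (induction k)
    case (Suc k)
    then show ?case
      using G order_trans[OF nrm_op_le[OF G] mult_left_mono[OF _ op_norm_nonneg[OF G]], of "(G ^^ k) x"]
      by (simp add: mult.assoc)
  qed (use x in simp)
  then show "(G ^^ k) x \<in> carrier A" "nrm A ((G ^^ k) x) \<le> op_norm A G ^ k * nrm A x" by auto
qed

text \<open>\<open>y\<close> is the Neumann sum of the terms \<open>\<mu>^k G^k x\<close>. Testing
  against \<open>f\<close> leaves a scalar power series in \<open>\<mu>\<close>, so holomorphy is
  needed for complex-valued functions only.\<close>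

lemma neumann_series_sums:
  assumes G: "G \<in> bounded_ops A" and f: "f \<in> dual A" and x: "x \<in> carrier A" and y: "y \<in> carrier A"
    and eq: "y = x \<oplus> \<mu> \<odot> G y" and lt: "cmod \<mu> * op_norm A G < 1"
  shows "(\<lambda>k. f ((G ^^ k) x) * \<mu> ^ k) sums f y"
proof -
  have step: "f ((G ^^ k) y) = f ((G ^^ k) x) + \<mu> * f ((G ^^ Suc k) y)" for k
  proof -
    note D = dualD[OF dual_funpow[OF f G, of k]]
    have "f ((G ^^ k) y) = f ((G ^^ k) (x \<oplus> \<mu> \<odot> G y))" using eq by simp
    also have "\<dots> = f ((G ^^ k) x) + \<mu> * f ((G ^^ k) (G y))"
      using D(2)[of x "\<mu> \<odot> G y"] D(3)[of "G y" \<mu>] x G by simp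
    finally show ?thesis by (simp add: funpow_Suc_right del: funpow.simps)
  qed
  have part: "(\<Sum>k<N. f ((G ^^ k) x) * \<mu> ^ k) = f y - \<mu> ^ N * f ((G ^^ N) y)" for N
  proof (induction N)
    case (Suc N)
    then show ?case using step[of N] by (simp add: algebra_simps)
  qed simp
  obtain K where K: "K \<ge> 0" "\<And>x. x \<in> carrier A \<Longrightarrow> cmod (f x) \<le> K * nrm A x"
    using dual_bound[OF f] by blast
  have "(\<lambda>N. \<mu> ^ N * f ((G ^^ N) y)) \<longlonglongrightarrow> 0"
  proof (rule Lim_null_comparison)
    have "norm (\<mu> ^ N * f ((G ^^ N) y)) \<le> (cmod \<mu> * op_norm A G) ^ N * (K * nrm A y)" for N
    proof -
      have "cmod (f ((G ^^ N) y)) \<le> K * (op_norm A G ^ N * nrm A y)"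
        using order_trans[OF K(2)[OF nrm_funpow_le(1)[OF G y]] mult_left_mono[OF nrm_funpow_le(2)[OF G y] K(1)]] .
      then have "cmod \<mu> ^ N * cmod (f ((G ^^ N) y)) \<le> cmod \<mu> ^ N * (K * (op_norm A G ^ N * nrm A y))"
        by (intro mult_left_mono) auto
      then show ?thesis by (simp add: norm_mult norm_power power_mult_distrib mult_ac)
    qed
    then show "\<forall>\<^sub>F N in sequentially. norm (\<mu> ^ N * f ((G ^^ N) y)) \<le> (cmod \<mu> * op_norm A G) ^ N * (K * nrm A y)"
      by simp
    have "(\<lambda>N. (cmod \<mu> * op_norm A G) ^ N * (K * nrm A y)) \<longlonglongrightarrow> 0 * (K * nrm A y)"
      using lt op_norm_nonneg[OF G] by (intro tendsto_intros LIMSEQ_power_zero) simp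
    then show "(\<lambda>N. (cmod \<mu> * op_norm A G) ^ N * (K * nrm A y)) \<longlonglongrightarrow> 0" by simp
  qed
  then have "(\<lambda>N. f y - \<mu> ^ N * f ((G ^^ N) y)) \<longlonglongrightarrow> f y - 0" by (intro tendsto_diff tendsto_const)
  then show ?thesis by (simp add: sums_def part)
qed

text \<open>By induction on the rank of \<open>F\<close>: a rank-one term changes the resolvent by the Sherman--Morrison
  formula, whose denominator is absorbed into \<open>d\<close>. Thus \<open>d\<close> plays the role of a determinant of
  \<open>\<one> - \<mu> (G + F)\<close>, and no determinants are needed.\<close>
lemma analytic_fredholm:
  assumes G: "G \<in> bounded_ops A" and R: "R * op_norm A G \<le> 1" and F: "F \<in> finite_rank A"
  shows "\<exists>d. d holomorphic_on ball 0 R \<and> d 0 = 1 \<and>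
    (\<forall>\<mu>\<in>ball 0 R. d \<mu> \<noteq> 0 \<longrightarrow> \<one>\<^bsub>B\<^esub> \<ominus>\<^bsub>B\<^esub> \<mu> \<odot>\<^bsub>B\<^esub> (G \<oplus>\<^bsub>B\<^esub> F) \<in> Units B) \<and>
    (\<forall>f\<in>dual A. \<forall>x\<in>carrier A. \<exists>h. h holomorphic_on ball 0 R \<and> (\<forall>\<mu>\<in>ball 0 R. d \<mu> \<noteq> 0 \<longrightarrow>
      h \<mu> = d \<mu> * f ((inv\<^bsub>B\<^esub> (\<one>\<^bsub>B\<^esub> \<ominus>\<^bsub>B\<^esub> \<mu> \<odot>\<^bsub>B\<^esub> (G \<oplus>\<^bsub>B\<^esub> F))) x)))"
  using F
proof (induction rule: finite_rank.induct)
  case zero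
  \<comment> \<open>\<open>R\<close> satisfies only a weak inequality; strictness comes from the
    open ball, apart from the trivial case of norm 0.\<close>
  have lt: "cmod \<mu> * op_norm A G < 1" if "\<mu> \<in> ball 0 R" for \<mu>
  proof (cases "op_norm A G = 0")
    case False
    then have "cmod \<mu> * op_norm A G < R * op_norm A G"
      using that op_norm_nonneg[OF G] by (intro mult_strict_right_mono) auto
    then show ?thesis using R by linarith
  qed simp
  have U: "\<one>\<^bsub>B\<^esub> \<ominus>\<^bsub>B\<^esub> \<mu> \<odot>\<^bsub>B\<^esub> G \<in> Units B" if "\<mu> \<in> ball 0 R" for \<mu>
  proof (rule B.one_minus_Units)
    show "nrm B (\<mu> \<odot>\<^bsub>B\<^esub> G) < 1"
      using B.nrm_smult[of G \<mu>] lt[OF that] G by (simp add: op_alg_simps(7))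
  qed (use G in simp)
  have "\<exists>h. h holomorphic_on ball 0 R \<and> (\<forall>\<mu>\<in>ball 0 R. h \<mu> = f ((inv\<^bsub>B\<^esub> (\<one>\<^bsub>B\<^esub> \<ominus>\<^bsub>B\<^esub> \<mu> \<odot>\<^bsub>B\<^esub> G)) x))"
    if f: "f \<in> dual A" and x: "x \<in> carrier A" for f x
  proof -
    have "(\<lambda>k. f ((G ^^ k) x) * (\<mu> - 0) ^ k) sums f ((inv\<^bsub>B\<^esub> (\<one>\<^bsub>B\<^esub> \<ominus>\<^bsub>B\<^esub> \<mu> \<odot>\<^bsub>B\<^esub> G)) x)"
      if m: "\<mu> \<in> ball 0 R" for \<mu>
    proof -
      let ?y = "(inv\<^bsub>B\<^esub> (\<one>\<^bsub>B\<^esub> \<ominus>\<^bsub>B\<^esub> \<mu> \<odot>\<^bsub>B\<^esub> G)) x"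
      have y: "?y \<in> carrier A" using op_Units_bounded(2)[OF U[OF m]] by blast
      have "?y \<ominus> \<mu> \<odot> G ?y = x"
        using op_inv_apply(1)[OF U[OF m] x] G y op_diff_apply[of "\<one>\<^bsub>B\<^esub>" "\<mu> \<odot>\<^bsub>B\<^esub> G" ?y] by simp
      then have "?y = x \<oplus> \<mu> \<odot> G ?y" using y x G diff_eq_iff by (metis op_apply_closed scale_closed)
      from neumann_series_sums[OF G f x y this lt[OF m]] show ?thesis by simp
    qed
    then have "(\<lambda>\<mu>. f ((inv\<^bsub>B\<^esub> (\<one>\<^bsub>B\<^esub> \<ominus>\<^bsub>B\<^esub> \<mu> \<odot>\<^bsub>B\<^esub> G)) x)) holomorphic_on ball 0 R"
      by (rule power_series_holomorphic)
    then show ?thesis by blast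
  qed
  then show ?case using G U by (intro exI[of _ "\<lambda>_. 1"]) simp
next
  case (add F x g)
  let ?T = "\<lambda>\<mu>. \<one>\<^bsub>B\<^esub> \<ominus>\<^bsub>B\<^esub> \<mu> \<odot>\<^bsub>B\<^esub> (G \<oplus>\<^bsub>B\<^esub> F)"
  let ?T' = "\<lambda>\<mu>. \<one>\<^bsub>B\<^esub> \<ominus>\<^bsub>B\<^esub> \<mu> \<odot>\<^bsub>B\<^esub> (G \<oplus>\<^bsub>B\<^esub> (F \<oplus>\<^bsub>B\<^esub> rank_one A x g))"
  have FB: "F \<in> bounded_ops A" and RB: "rank_one A x g \<in> bounded_ops A"
    using add finite_rank_bounded rank_one_bounded by auto
  obtain d where d: "d holomorphic_on ball 0 R" "d 0 = 1"
      and dU: "\<And>\<mu>. \<mu> \<in> ball 0 R \<Longrightarrow> d \<mu> \<noteq> 0 \<Longrightarrow> ?T \<mu> \<in> Units B"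
      and dh: "\<And>f x. f \<in> dual A \<Longrightarrow> x \<in> carrier A \<Longrightarrow> \<exists>h. h holomorphic_on ball 0 R \<and>
        (\<forall>\<mu>\<in>ball 0 R. d \<mu> \<noteq> 0 \<longrightarrow> h \<mu> = d \<mu> * f ((inv\<^bsub>B\<^esub> (?T \<mu>)) x))"
    using add.IH by blast
  obtain h where h: "h holomorphic_on ball 0 R"
      "\<And>\<mu>. \<mu> \<in> ball 0 R \<Longrightarrow> d \<mu> \<noteq> 0 \<Longrightarrow> h \<mu> = d \<mu> * g ((inv\<^bsub>B\<^esub> (?T \<mu>)) x)"
    using dh[OF add.hyps(3,2)] by blast
  \<comment> \<open>Where \<open>d\<close> is nonzero, \<open>d - \<mu> h\<close> is
    \<open>d\<close> times the Sherman-Morrison denominator. The extra factor \<open>d\<close>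
    ensures that \<open>d' \<mu> \<noteq> 0\<close> implies \<open>d \<mu> \<noteq> 0\<close> and
    clears the denominators of the products of two old resolvent values.\<close>
  define d' where "d' \<mu> = d \<mu> * (d \<mu> - \<mu> * h \<mu>)" for \<mu>
  have T': "?T' \<mu> = ?T \<mu> \<ominus>\<^bsub>B\<^esub> rank_one A (\<mu> \<odot> x) g" for \<mu>
  proof -
    have R': "rank_one A (\<mu> \<odot> x) g \<in> bounded_ops A"
      using add by (intro rank_one_bounded) auto
    have "\<mu> \<odot>\<^bsub>B\<^esub> rank_one A x g = rank_one A (\<mu> \<odot> x) g"
      using add RB by (intro op_eqI rank_one_bounded) (auto simp: rank_one_def mult.commute)
    then show ?thesis
      using G FB RB R'
      by (simp add: B.scale_add_right a_minus_def B.minus_add B.a_assoc)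
  qed
  have step: "?T' \<mu> \<in> Units B" "(inv\<^bsub>B\<^esub> (?T' \<mu>)) y = (inv\<^bsub>B\<^esub> (?T \<mu>)) y \<oplus>
      (g ((inv\<^bsub>B\<^esub> (?T \<mu>)) y) / (1 - \<mu> * g ((inv\<^bsub>B\<^esub> (?T \<mu>)) x))) \<odot> (\<mu> \<odot> (inv\<^bsub>B\<^esub> (?T \<mu>)) x)"
    if m: "\<mu> \<in> ball 0 R" "d' \<mu> \<noteq> 0" for \<mu> y
  proof -
    have dm: "d \<mu> \<noteq> 0" using m by (auto simp: d'_def)
    note U = dU[OF m(1) dm]
    have e: "(inv\<^bsub>B\<^esub> (?T \<mu>)) (\<mu> \<odot> x) = \<mu> \<odot> (inv\<^bsub>B\<^esub> (?T \<mu>)) x"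
      using bounded_opsD(4)[OF op_Units_bounded(2)[OF U] add.hyps(2)] .
    have ge: "g (\<mu> \<odot> (inv\<^bsub>B\<^esub> (?T \<mu>)) x) = \<mu> * g ((inv\<^bsub>B\<^esub> (?T \<mu>)) x)"
      using dualD(3)[OF add.hyps(3) op_apply_closed[OF op_Units_bounded(2)[OF U]]] .
    have "d' \<mu> = d \<mu> * (d \<mu> * (1 - \<mu> * g ((inv\<^bsub>B\<^esub> (?T \<mu>)) x)))"
      using h(2)[OF m(1) dm] by (simp add: d'_def algebra_simps)
    then have "g ((inv\<^bsub>B\<^esub> (?T \<mu>)) (\<mu> \<odot> x)) \<noteq> 1" using m(2) e ge by auto
    from Sherman_Morrison[OF U scale_closed[OF add.hyps(2)] add.hyps(3) this]
    show "?T' \<mu> \<in> Units B" "(inv\<^bsub>B\<^esub> (?T' \<mu>)) y = (inv\<^bsub>B\<^esub> (?T \<mu>)) y \<oplus>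
      (g ((inv\<^bsub>B\<^esub> (?T \<mu>)) y) / (1 - \<mu> * g ((inv\<^bsub>B\<^esub> (?T \<mu>)) x))) \<odot> (\<mu> \<odot> (inv\<^bsub>B\<^esub> (?T \<mu>)) x)"
      unfolding T' e ge .
  qed
  show ?case
  proof (rule exI[of _ d'], intro conjI ballI impI)
    show "d' holomorphic_on ball 0 R" unfolding d'_def by (intro holomorphic_intros d h)
    show "d' 0 = 1" using d by (simp add: d'_def)
    show "?T' \<mu> \<in> Units B" if "\<mu> \<in> ball 0 R" "d' \<mu> \<noteq> 0" for \<mu> using step(1)[OF that] .
    fix f y assume f: "f \<in> dual A" and y: "y \<in> carrier A"
    obtain p where p: "p holomorphic_on ball 0 R"
        "\<And>\<mu>. \<mu> \<in> ball 0 R \<Longrightarrow> d \<mu> \<noteq> 0 \<Longrightarrow> p \<mu> = d \<mu> * f ((inv\<^bsub>B\<^esub> (?T \<mu>)) y)"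
      using dh[OF f y] by blast
    obtain q where q: "q holomorphic_on ball 0 R"
        "\<And>\<mu>. \<mu> \<in> ball 0 R \<Longrightarrow> d \<mu> \<noteq> 0 \<Longrightarrow> q \<mu> = d \<mu> * f ((inv\<^bsub>B\<^esub> (?T \<mu>)) x)"
      using dh[OF f add.hyps(2)] by blast
    obtain r where r: "r holomorphic_on ball 0 R"
        "\<And>\<mu>. \<mu> \<in> ball 0 R \<Longrightarrow> d \<mu> \<noteq> 0 \<Longrightarrow> r \<mu> = d \<mu> * g ((inv\<^bsub>B\<^esub> (?T \<mu>)) y)"
      using dh[OF add.hyps(3) y] by blast
    \<comment> \<open>The update formula multiplied by \<open>d'\<close>: each old resolvent value
      is paired with one factor \<open>d\<close>, which makes it one of the holomorphic functions
      \<open>p\<close>, \<open>q\<close>, \<open>r\<close>.\<close>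
    have "(d \<mu> - \<mu> * h \<mu>) * p \<mu> + \<mu> * r \<mu> * q \<mu> = d' \<mu> * f ((inv\<^bsub>B\<^esub> (?T' \<mu>)) y)"
      if m: "\<mu> \<in> ball 0 R" "d' \<mu> \<noteq> 0" for \<mu>
    proof -
      have dm: "d \<mu> \<noteq> 0" using m by (auto simp: d'_def)
      note SB = op_apply_closed[OF op_Units_bounded(2)[OF dU[OF m(1) dm]]]
      define u where "u = g ((inv\<^bsub>B\<^esub> (?T \<mu>)) x)"
      have d'e: "d' \<mu> = d \<mu> * (d \<mu> * (1 - \<mu> * u))"
        using h(2)[OF m(1) dm] by (simp add: d'_def u_def algebra_simps)
      then have u: "1 - \<mu> * u \<noteq> 0" using m(2) by auto
      have fe: "f ((inv\<^bsub>B\<^esub> (?T' \<mu>)) y) = f ((inv\<^bsub>B\<^esub> (?T \<mu>)) y) +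
          g ((inv\<^bsub>B\<^esub> (?T \<mu>)) y) / (1 - \<mu> * u) * (\<mu> * f ((inv\<^bsub>B\<^esub> (?T \<mu>)) x))"
        unfolding step(2)[OF m] u_def using SB by (simp add: dualD[OF f])
      \<comment> \<open>Naming the quotient \<open>k\<close> turns this into a polynomial
        identity.\<close>
      have "D * (D * w) * (p + r / w * (m * q)) = D * w * (D * p) + m * (D * r) * (D * q)"
        if "w \<noteq> 0" for D w p r m q :: complex
      proof -
        define k where "k = r / w"
        have "r = k * w" using that by (simp add: k_def)
        then show ?thesis unfolding k_def[symmetric] by (simp add: algebra_simps)
      qed
      from this[OF u] have "d' \<mu> * f ((inv\<^bsub>B\<^esub> (?T' \<mu>)) y) = (d \<mu> * (1 - \<mu> * u)) * (d \<mu> * f ((inv\<^bsub>B\<^esub> (?T \<mu>)) y)) +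
          \<mu> * (d \<mu> * g ((inv\<^bsub>B\<^esub> (?T \<mu>)) y)) * (d \<mu> * f ((inv\<^bsub>B\<^esub> (?T \<mu>)) x))"
        unfolding d'e fe .
      also have "d \<mu> * (1 - \<mu> * u) = d \<mu> - \<mu> * h \<mu>"
        using h(2)[OF m(1) dm] by (simp add: u_def algebra_simps)
      finally show ?thesis using p(2)[OF m(1) dm] q(2)[OF m(1) dm] r(2)[OF m(1) dm] by simp
    qed
    moreover have "(\<lambda>\<mu>. (d \<mu> - \<mu> * h \<mu>) * p \<mu> + \<mu> * r \<mu> * q \<mu>) holomorphic_on ball 0 R"
      by (intro holomorphic_intros d h p q r)
    ultimately show "\<exists>h. h holomorphic_on ball 0 R \<and>
        (\<forall>\<mu>\<in>ball 0 R. d' \<mu> \<noteq> 0 \<longrightarrow> h \<mu> = d' \<mu> * f ((inv\<^bsub>B\<^esub> (?T' \<mu>)) y))"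
      by blast
  qed
qed

text \<open>Spectral values \<open>z\<close> with \<open>r \<le> cmod z\<close> become zeros
  \<open>1/z\<close> of \<open>d\<close> in the closed disc of radius \<open>1 / r\<close>.
  Approximating \<open>K\<close> within \<open>r / 2\<close> makes \<open>d\<close> holomorphic on
  the disc of twice that radius, so the closed disc is a compact subset of the domain.\<close>

lemma approximable_spectrum_finite:
  assumes K: "K \<in> approximable A" and r: "r > 0"
  shows "finite {z \<in> spectrum B K. r \<le> cmod z}"
proof -
  have KB: "K \<in> bounded_ops A" by (rule approximableD(1)[OF K])
  obtain F where F: "F \<in> finite_rank A" "nrm B (K \<ominus>\<^bsub>B\<^esub> F) < r / 2"
    using approximableD(2)[OF K half_gt_zero[OF r]] by blast
  have FB: "F \<in> bounded_ops A" by (rule finite_rank_bounded[OF F(1)])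
  let ?G = "K \<ominus>\<^bsub>B\<^esub> F"
  have G: "?G \<in> bounded_ops A" using KB FB by simp
  have GF: "?G \<oplus>\<^bsub>B\<^esub> F = K" using KB FB by simp
  have R: "2 / r * op_norm A ?G \<le> 1" using F(2) r by (simp add: op_alg_simps(7) field_simps)
  obtain d where d: "d holomorphic_on ball 0 (2 / r)" "d 0 = 1"
      "\<And>\<mu>. \<mu> \<in> ball 0 (2 / r) \<Longrightarrow> d \<mu> \<noteq> 0 \<Longrightarrow> \<one>\<^bsub>B\<^esub> \<ominus>\<^bsub>B\<^esub> \<mu> \<odot>\<^bsub>B\<^esub> K \<in> Units B"
    using analytic_fredholm[OF G R F(1)] unfolding GF by blast
  have sub: "cball 0 (1 / r) \<subseteq> ball (0::complex) (2 / r)" using r by (auto simp: field_simps)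
  have 0: "(0::complex) \<in> ball 0 (2 / r)" using r by simp
  have fin: "finite {\<mu> \<in> cball 0 (1 / r). d \<mu> = 0}"
  \<comment> \<open>Finiteness of zeros concerns nonconstant functions; a constant \<open>d\<close>
    equals \<open>d 0 = 1\<close> and has no zeros.\<close>
  proof (cases "d constant_on ball 0 (2 / r)")
    case True
    then have "d \<mu> = 1" if "\<mu> \<in> ball 0 (2 / r)" for \<mu>
      using d(2) 0 that unfolding constant_on_def by metis
    then have "{\<mu> \<in> cball 0 (1 / r). d \<mu> = 0} = {}" using sub by fastforce
    then show ?thesis by (simp only: finite.emptyI)
  next
    case False
    then show ?thesis
      by (intro holomorphic_compact_finite_zeros[OF d(1) _ _ compact_cball sub]) auto
  qed
  have "{z \<in> spectrum B K. r \<le> cmod z} \<subseteq> inverse ` {\<mu> \<in> cball 0 (1 / r). d \<mu> = 0}"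
  proof
    fix z assume z: "z \<in> {z \<in> spectrum B K. r \<le> cmod z}"
    then have z0: "z \<noteq> 0" using r by auto
    have c: "inverse z \<in> cball 0 (1 / r)" using z r z0 by (simp add: norm_inverse norm_divide field_simps)
    have "d (inverse z) = 0"
    proof (rule ccontr)
      assume "d (inverse z) \<noteq> 0"
      then have "\<one>\<^bsub>B\<^esub> \<ominus>\<^bsub>B\<^esub> inverse z \<odot>\<^bsub>B\<^esub> K \<in> Units B" using d(3) c sub by blast
      then have "z \<odot>\<^bsub>B\<^esub> (\<one>\<^bsub>B\<^esub> \<ominus>\<^bsub>B\<^esub> inverse z \<odot>\<^bsub>B\<^esub> K) \<in> Units B" using z0 by (rule B.scale_Units)
      moreover have "z \<odot>\<^bsub>B\<^esub> (\<one>\<^bsub>B\<^esub> \<ominus>\<^bsub>B\<^esub> inverse z \<odot>\<^bsub>B\<^esub> K) = z \<odot>\<^bsub>B\<^esub> \<one>\<^bsub>B\<^esub> \<ominus>\<^bsub>B\<^esub> K"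
        using KB z0 by (simp add: B.scale_diff_right)
      ultimately show False using z by (simp add: spectrum_def)
    qed
    then show "z \<in> inverse ` {\<mu> \<in> cball 0 (1 / r). d \<mu> = 0}"
      using c by (intro image_eqI[of _ _ "inverse z"]) auto
  qed
  then show ?thesis using fin finite_subset by blast
qed

end

section \<open>The pullback along the left regular representation\<close>

text \<open>Serves to move the chosen point of the hole to 0, where \<open>hole_functional\<close>
  expects it.\<close>

lemma components_translation:
  fixes a :: "'a::real_normed_vector"
  assumes "C \<in> components S"
  shows "(\<lambda>z. z - a) ` C \<in> components ((\<lambda>z. z - a) ` S)"
  unfolding in_components_maximal
proof (intro conjI allI impI)
  note C = assms[unfolded in_components_maximal]
  show "(\<lambda>z. z - a) ` C \<noteq> {}" "(\<lambda>z. z - a) ` C \<subseteq> (\<lambda>z. z - a) ` S" using C by auto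
  show "connected ((\<lambda>z. z - a) ` C)"
    using C by (intro connected_continuous_image continuous_intros) auto
  fix D assume D: "D \<noteq> {} \<and> (\<lambda>z. z - a) ` C \<subseteq> D \<and> D \<subseteq> (\<lambda>z. z - a) ` S \<and> connected D"
  have "connected ((\<lambda>z. z + a) ` D)"
    using D by (intro connected_continuous_image continuous_intros) auto
  moreover have "C \<subseteq> (\<lambda>z. z + a) ` D" using D by (force simp: image_iff)
  moreover have "(\<lambda>z. z + a) ` D \<subseteq> S" using D by auto
  ultimately have "(\<lambda>z. z + a) ` D = C" using C D by (metis image_is_empty)
  then show "D = (\<lambda>z. z - a) ` C" by (force simp: image_image)
qed

section \<open>Semisimplicity, inessentiality and spectral discontinuity\<close>

context complex_banach_algebra
begin

interpretation B: complex_banach_algebra B by (rule op_alg_banach)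

interpretation P: alg_pullback A B "left_mult A" "approximable A" by (rule approximable_pullback)

text \<open>The annihilator of a nonzero vector under an irreducible action. If \<open>n\<close>
  does not annihilate \<open>\<xi>\<close>, a rank-one operator carries its value at
  \<open>\<xi>\<close> to any prescribed vector, so every \<open>x\<close> agrees at
  \<open>\<xi>\<close> with a left multiple of \<open>n\<close>.\<close>

lemma evaluation_maximal_left_ideal:
  assumes \<xi>: "\<xi> \<in> carrier A" "\<xi> \<noteq> \<zero>"
  shows "maximal_left_ideal {p \<in> carrier P.A. snd p \<xi> = \<zero>} P.A" (is "maximal_left_ideal ?L P.A")
proof (rule P.A.maximal_left_idealI)
  have sc: "snd p \<in> bounded_ops A" if "p \<in> carrier P.A" for p using that by (cases p) simp
  show "left_ideal ?L P.A"
  proof (rule P.A.left_idealI)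
    show "\<zero>\<^bsub>P.A\<^esub> \<in> ?L" using P.A.zero_closed \<xi> by simp
    show "x \<oplus>\<^bsub>P.A\<^esub> y \<in> ?L" if "x \<in> ?L" "y \<in> ?L" for x y
      using that P.A.a_closed[of x y] \<xi> by simp
    show "x \<otimes>\<^bsub>P.A\<^esub> l \<in> ?L" if "x \<in> carrier P.A" "l \<in> ?L" for x l
      using that P.A.m_closed[of x l] \<xi> sc[of x] by simp
  qed blast
  show "?L \<noteq> carrier P.A" using P.A.one_closed \<xi> by force
  fix N n assume N: "left_ideal N P.A" "?L \<subseteq> N" "n \<in> N" "n \<notin> ?L"
  note ND = P.A.left_idealD[OF N(1)]
  have n: "n \<in> carrier P.A" "snd n \<xi> \<noteq> \<zero>" using N ND(1) by auto
  have nc: "snd n \<xi> \<in> carrier A" using sc[OF n(1)] by blast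
  obtain f where f: "f \<in> dual A" "f (snd n \<xi>) = 1"
    using normalizing_functional[OF nc n(2)] by blast
  show "carrier P.A \<subseteq> N"
  proof
    fix x assume x: "x \<in> carrier P.A"
    have xc: "snd x \<xi> \<in> carrier A" using sc[OF x] by blast
    \<comment> \<open>Chosen so that \<open>r\<close> maps \<open>snd n \<xi>\<close> to
      \<open>snd x \<xi>\<close>; hence \<open>x - r n\<close> annihilates
      \<open>\<xi>\<close>.\<close>
    define r where "r = (\<zero>, rank_one A (snd x \<xi>) f)"
    have "r \<in> P.ker_ideal"
      using finite_rank_approximable[OF rank_one_finite_rank[OF xc f(1)]] by (simp add: r_def P.ker_ideal_def)
    then have r: "r \<in> carrier P.A" using P.ker_ideal_iff by blast
    have rn: "r \<otimes>\<^bsub>P.A\<^esub> n \<in> carrier P.A" using r n(1) by (rule P.A.m_closed)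
    have rb: "rank_one A (snd x \<xi>) f \<in> bounded_ops A" by (rule rank_one_bounded[OF xc f(1)])
    have "snd (x \<ominus>\<^bsub>P.A\<^esub> r \<otimes>\<^bsub>P.A\<^esub> n) \<xi> = snd x \<xi> \<ominus> snd r (snd n \<xi>)"
      using P.A_diff[OF x rn] sc[OF x] sc[OF n(1)] rb \<xi> by (simp add: r_def op_diff_apply)
    also have "\<dots> = \<zero>" using f(2) xc by (simp add: r_def rank_one_def)
    finally have "x \<ominus>\<^bsub>P.A\<^esub> r \<otimes>\<^bsub>P.A\<^esub> n \<in> N"
      using N(2) P.A.minus_closed[OF x rn] by blast
    moreover have "r \<otimes>\<^bsub>P.A\<^esub> n \<in> N" using ND(4) r N(3) by blast
    ultimately have "(x \<ominus>\<^bsub>P.A\<^esub> r \<otimes>\<^bsub>P.A\<^esub> n) \<oplus>\<^bsub>P.A\<^esub> r \<otimes>\<^bsub>P.A\<^esub> n \<in> N" by (rule ND(3))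
    then show "x \<in> N" using P.A.diff_add_cancel[OF x rn] by simp
  qed
qed

text \<open>Two families of maximal left ideals suffice: preimages of those of \<open>Y\<close>
  force the first component to vanish, annihilators of vectors the second.\<close>

theorem pullback_semisimple:
  assumes ss: "semisimple A"
  shows "semisimple P.A"
  unfolding semisimple_def
proof
  show "{\<zero>\<^bsub>P.A\<^esub>} \<subseteq> jacobson_radical P.A" using P.A.zero_in_jacobson_radical by blast
  show "jacobson_radical P.A \<subseteq> {\<zero>\<^bsub>P.A\<^esub>}"
  proof
    fix p assume p: "p \<in> jacobson_radical P.A"
    obtain y T where pe: "p = (y, T)" by fastforce
    have pc: "(y, T) \<in> carrier P.A" and pm: "\<And>M. maximal_left_ideal M P.A \<Longrightarrow> (y, T) \<in> M"
      using p by (auto simp: jacobson_radical_def pe)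
    have "y \<in> M" if "maximal_left_ideal M A" for M
      using pm[OF ring_hom_ring.maximal_left_ideal_vimage[OF P.fst_hom P.fst_surj that]] by simp
    then have "y \<in> jacobson_radical A" using pc by (simp add: jacobson_radical_def)
    then have "y = \<zero>" using ss by (simp add: semisimple_def)
    moreover have "T \<xi> = \<zero>" if "\<xi> \<in> carrier A" for \<xi>
      using pm[OF evaluation_maximal_left_ideal[OF that]] pc by (cases "\<xi> = \<zero>") auto
    then have "T = \<zero>\<^bsub>B\<^esub>" using pc by (intro op_eqI) auto
    ultimately show "p \<in> {\<zero>\<^bsub>P.A\<^esub>}" by (simp add: pe)
  qed
qed

text \<open>The zero first component contributes at most the spectral value 0, so everything rests
  on the operator component.\<close>

theorem pullback_inessential: "inessential_ideal P.ker_ideal P.A"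
  unfolding inessential_ideal_def
proof (intro conjI ballI)
  show "ideal P.ker_ideal P.A" by (rule P.ker_ideal_ideal)
  fix p assume p: "p \<in> P.ker_ideal"
  then obtain K where K: "p = (\<zero>, K)" "K \<in> approximable A" by (auto simp: P.ker_ideal_def)
  have "finite {z \<in> spectrum P.A p. r \<le> cmod z}" if r: "r > 0" for r
  proof -
    have "(\<zero>, K) \<in> carrier P.A" using p K(1) P.ker_ideal_iff by blast
    then have e: "spectrum P.A p = spectrum A \<zero> \<union> spectrum B K"
      unfolding K(1) by (rule P.spectrum_A)
    have "spectrum A \<zero> \<subseteq> {0}" using spectrum_norm_le[of \<zero>] by auto
    then have "{z \<in> spectrum P.A p. r \<le> cmod z} \<subseteq> insert 0 {z \<in> spectrum B K. r \<le> cmod z}"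
      unfolding e by auto
    then show ?thesis using approximable_spectrum_finite[OF K(2) r] by (meson finite_insert finite_subset)
  qed
  then show "finite (spectrum P.A p) \<or> (\<exists>s :: nat \<Rightarrow> complex. range s = spectrum P.A p \<and> s \<longlonglongrightarrow> 0)"
    by (rule finite_or_null_sequence)
qed

lemma spectrum_translation:
  assumes a: "a \<in> carrier A"
  shows "spectrum A (a \<ominus> l \<odot> \<one>) = (\<lambda>z. z - l) ` spectrum A a"
proof -
  have "z \<odot> \<one> \<ominus> (a \<ominus> l \<odot> \<one>) = (z + l) \<odot> \<one> \<ominus> a" for z
    using a by (simp add: scale_add_left a_minus_def minus_add a_ac)
  then have "z \<in> spectrum A (a \<ominus> l \<odot> \<one>) \<longleftrightarrow> z + l \<in> spectrum A a" for z
    by (simp add: spectrum_def)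
  then show ?thesis by (force simp: image_iff)
qed

theorem pullback_discontinuity:
  assumes a: "a \<in> carrier A" and sep: "separates_plane (spectrum A a)"
  shows "\<exists>w\<in>P.ker_ideal. spectral_discontinuity P.A ((a, left_mult A a) \<oplus>\<^bsub>P.A\<^esub> w)"
proof -
  obtain C where C: "C \<in> components (- spectrum A a)" "bounded C"
    using sep unfolding separates_plane_def by blast
  obtain l where l: "l \<in> C" using in_components_nonempty[OF C(1)] by blast
  \<comment> \<open>Translation by \<open>l\<close> places the hole around 0.\<close>
  define c where "c = a \<ominus> l \<odot> \<one>"
  have c: "c \<in> carrier A" using a by (simp add: c_def)
  have "(\<lambda>z. z - l) ` S = {z. z + l \<in> S}" for S
    by (auto simp: image_iff) (metis add_diff_cancel)
  then have "- spectrum A c = (\<lambda>z. z - l) ` (- spectrum A a)"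
    unfolding c_def spectrum_translation[OF a] by auto
  then have C': "(\<lambda>z. z - l) ` C \<in> components (- spectrum A c)"
    using components_translation[OF C(1), of l] by simp
  have "bounded ((\<lambda>z. z - l) ` C)" using bounded_translation[OF C(2), of "- l"] by simp
  moreover have "0 \<in> (\<lambda>z. z - l) ` C" using l by force
  ultimately obtain f where cu: "c \<in> Units A" and f: "f \<in> dual A" "f (inv c) = 1"
    and fs: "\<And>\<mu> s. \<lbrakk>cmod \<mu> * nrm A (inv c) < 1; s \<in> carrier A; (c \<ominus> \<mu> \<odot> \<one>) \<otimes> s = \<one>\<rbrakk> \<Longrightarrow> f s = 1"
    using hole_functional[OF c C'] by metis
  let ?L = "left_mult A"
  define W where "W = rank_one A \<one> f"
  have WJ: "W \<in> approximable A"
    unfolding W_def by (intro finite_rank_approximable rank_one_finite_rank f) simp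
  then have WB: "W \<in> bounded_ops A" by (rule approximableD)
  define z where "z t = (a, ?L a \<ominus>\<^bsub>B\<^esub> complex_of_real t \<odot>\<^bsub>B\<^esub> W)" for t
  have LB: "?L x \<in> bounded_ops A" if "x \<in> carrier A" for x using left_mult_bounded(1)[OF that] .
  have zc: "z t \<in> carrier P.A" for t
  proof -
    have "(\<zero>, complex_of_real t \<odot>\<^bsub>B\<^esub> W) \<in> P.ker_ideal"
      using P.J_scale[OF WJ] by (simp add: P.ker_ideal_def)
    then have "(\<zero>, complex_of_real t \<odot>\<^bsub>B\<^esub> W) \<in> carrier P.A"
      using P.ker_ideal_iff by blast
    then have "(a, ?L a) \<ominus>\<^bsub>P.A\<^esub> (\<zero>, complex_of_real t \<odot>\<^bsub>B\<^esub> W) \<in> carrier P.A"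
      using P.embed_closed[OF a] by (intro P.A.minus_closed)
    then show ?thesis
      using P.A_diff[OF P.embed_closed[OF a] \<open>(\<zero>, complex_of_real t \<odot>\<^bsub>B\<^esub> W) \<in> carrier P.A\<close>] a
      by (simp add: z_def)
  qed
  have spec: "spectrum P.A (z t) = spectrum A a \<union> spectrum B (?L a \<ominus>\<^bsub>B\<^esub> complex_of_real t \<odot>\<^bsub>B\<^esub> W)" for t
    using P.spectrum_A zc[of t] unfolding z_def by blast
  \<comment> \<open>Up to sign, \<open>l + \<mu>\<close> minus the operator is left multiplication
    by \<open>c - \<mu>\<close> with a rank-one term subtracted, which is the shape
    \<open>Sherman_Morrison\<close> handles.\<close>
  have shift: "(l + \<mu>) \<odot>\<^bsub>B\<^esub> \<one>\<^bsub>B\<^esub> \<ominus>\<^bsub>B\<^esub> (?L a \<ominus>\<^bsub>B\<^esub> complex_of_real t \<odot>\<^bsub>B\<^esub> W)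
      = \<ominus>\<^bsub>B\<^esub> (?L (c \<ominus> \<mu> \<odot> \<one>) \<ominus>\<^bsub>B\<^esub> rank_one A (complex_of_real t \<odot> \<one>) f)" for \<mu> t
  proof -
    have R: "rank_one A (complex_of_real t \<odot> \<one>) f \<in> bounded_ops A"
      using f by (intro rank_one_bounded) auto
    have "rank_one A (complex_of_real t \<odot> \<one>) f = complex_of_real t \<odot>\<^bsub>B\<^esub> W"
      using R WB by (intro op_eqI) (auto simp: rank_one_def W_def mult.commute)
    moreover have "c \<ominus> \<mu> \<odot> \<one> = a \<ominus> (l + \<mu>) \<odot> \<one>"
      using a by (simp add: c_def scale_add_left a_minus_def minus_add a_assoc)
    moreover have "?L (a \<ominus> (l + \<mu>) \<odot> \<one>) = ?L a \<ominus>\<^bsub>B\<^esub> (l + \<mu>) \<odot>\<^bsub>B\<^esub> \<one>\<^bsub>B\<^esub>"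
      using a by (intro op_eqI) (simp_all add: LB op_diff_apply diff_distrib_right smult_mult_left)
    ultimately show ?thesis
      using WB LB[OF a] by (simp add: B.minus_diff) (simp add: a_minus_def B.minus_add B.a_ac)
  qed
  have b: "inv c \<in> carrier A" "inv c \<noteq> \<zero>" using cu f dual_zero[OF f(1)] by auto
  \<comment> \<open>The vector \<open>inv c\<close> is a nonzero element of the kernel:
    \<open>c\<close> times it is \<open>\<one>\<close>, and \<open>W\<close> also sends it to
    \<open>\<one>\<close> since \<open>f (inv c) = 1\<close>.\<close>
  have l_in: "l \<in> spectrum P.A (z 1)"
  proof (rule ccontr)
    assume "l \<notin> spectrum P.A (z 1)"
    then have "\<ominus>\<^bsub>B\<^esub> (?L c \<ominus>\<^bsub>B\<^esub> rank_one A \<one> f) \<in> Units B"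
      using shift[of 0 1] c unfolding spec by (simp add: spectrum_def)
    moreover have D: "?L c \<ominus>\<^bsub>B\<^esub> rank_one A \<one> f \<in> bounded_ops A"
      using LB[OF c] WB by (simp add: W_def)
    ultimately have "?L c \<ominus>\<^bsub>B\<^esub> rank_one A \<one> f \<in> Units B"
      using B.minus_Units[of "\<ominus>\<^bsub>B\<^esub> (?L c \<ominus>\<^bsub>B\<^esub> rank_one A \<one> f)"] by simp
    from op_inv_apply(2)[OF this b(1)]
    have "(inv\<^bsub>B\<^esub> (?L c \<ominus>\<^bsub>B\<^esub> rank_one A \<one> f)) ((?L c \<ominus>\<^bsub>B\<^esub> rank_one A \<one> f) (inv c)) = inv c" .
    moreover have "(?L c \<ominus>\<^bsub>B\<^esub> rank_one A \<one> f) (inv c) = \<zero>"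
      using op_diff_apply[OF LB[OF c], of "rank_one A \<one> f" "inv c"] WB b cu f(2)
      by (simp add: W_def rank_one_def)
    ultimately show False
      using b(2) bounded_ops_zero[OF op_Units_bounded(2)[OF \<open>?L c \<ominus>\<^bsub>B\<^esub> rank_one A \<one> f \<in> Units B\<close>]] by simp
  qed
  \<comment> \<open>Small enough for two purposes at once:
    \<open>cmod \<mu> * nrm A (inv c) < 1\<close> for \<open>fs\<close>, and the same with the
    factor \<open>nrm A \<one>\<close> for \<open>Units_perturb\<close>. It does not depend on
    \<open>t\<close>.\<close>
  define r where "r = 1 / (nrm A (inv c) * (nrm A \<one> + 1) + 1)"
  have nb: "nrm A (inv c) \<ge> 0" "nrm A \<one> \<ge> 0" using b nrm_nonneg by auto
  have r: "r > 0" unfolding r_def using nb by (intro divide_pos_pos add_nonneg_pos mult_nonneg_nonneg) auto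
  have free: "l + \<mu> \<notin> spectrum P.A (z t)" if m: "cmod \<mu> < r" and t: "t \<noteq> 1" for \<mu> t
  proof -
    have "cmod \<mu> * (nrm A (inv c) * (nrm A \<one> + 1) + 1) < 1"
      using m nb unfolding r_def by (subst (asm) pos_less_divide_eq) (auto intro!: add_nonneg_pos mult_nonneg_nonneg)
    then have "cmod \<mu> * nrm A (inv c) * nrm A \<one> + (cmod \<mu> * nrm A (inv c) + cmod \<mu>) < 1"
      by (simp add: algebra_simps)
    moreover have "0 \<le> cmod \<mu> * nrm A (inv c)" "0 \<le> cmod \<mu> * nrm A (inv c) * nrm A \<one>" using nb by auto
    ultimately have small: "cmod \<mu> * nrm A (inv c) < 1" "cmod \<mu> * nrm A (inv c) * nrm A \<one> < 1"
      using norm_ge_zero[of \<mu>] by linarith+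
    define e where "e = c \<ominus> \<mu> \<odot> \<one>"
    have eU: "e \<in> Units A"
      unfolding e_def using cu small(2) by (intro Units_perturb) (auto simp: nrm_smult mult_ac)
    then have e: "e \<in> carrier A" "inv e \<in> carrier A" by auto
    have f1: "f (inv e) = 1"
      using fs[OF small(1) e(2)] eU by (simp add: e_def)
    have "?L e \<in> Units B \<and> inv\<^bsub>B\<^esub> (?L e) = ?L (inv e)"
      using op_UnitsI[of "?L e" "?L (inv e)"] LB[OF e(1)] LB[OF e(2)] e eU by (simp flip: m_assoc)
    then have LU: "?L e \<in> Units B" "inv\<^bsub>B\<^esub> (?L e) = ?L (inv e)" by auto
    \<comment> \<open>The left-hand side equals \<open>t * f (inv e) = t\<close>, and
      \<open>t \<noteq> 1\<close>.\<close>
    have "f ((inv\<^bsub>B\<^esub> (?L e)) (complex_of_real t \<odot> \<one>)) \<noteq> 1"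
      using e f1 t dualD(3)[OF f(1) e(2)] by (simp add: LU(2) smult_mult_right)
    then have "?L e \<ominus>\<^bsub>B\<^esub> rank_one A (complex_of_real t \<odot> \<one>) f \<in> Units B"
      using f by (intro Sherman_Morrison(1)[OF LU(1)]) auto
    from B.minus_Units[OF this] have "l + \<mu> \<notin> spectrum B (?L a \<ominus>\<^bsub>B\<^esub> complex_of_real t \<odot>\<^bsub>B\<^esub> W)"
      unfolding spectrum_def e_def mem_Collect_eq shift by simp
    moreover have "(l + \<mu>) \<odot> \<one> \<ominus> a = \<ominus> e"
      using a by (simp add: e_def c_def scale_add_left a_minus_def minus_add a_ac)
    then have "l + \<mu> \<notin> spectrum A a"
      using minus_Units[OF eU] by (simp add: spectrum_def)
    ultimately show ?thesis by (simp add: spec)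
  qed
  interpret PB: complex_banach_algebra P.A by (rule P.A_banach)
  have "spectral_discontinuity P.A (z 1)"
    unfolding spectral_discontinuity_def
  proof (intro conjI notI)
    show "z 1 \<in> carrier P.A" by (rule zc)
    assume "\<forall>\<epsilon>>0. \<exists>\<delta>>0. \<forall>x\<in>carrier P.A. alg_dist P.A x (z 1) < \<delta> \<longrightarrow>
      hausdorff_dist (spectrum P.A x) (spectrum P.A (z 1)) < \<epsilon>"
    then obtain \<delta> where \<delta>: "\<delta> > 0" "\<And>x. x \<in> carrier P.A \<Longrightarrow> alg_dist P.A x (z 1) < \<delta> \<Longrightarrow>
      hausdorff_dist (spectrum P.A x) (spectrum P.A (z 1)) < r"
      using r by meson
    have nW: "nrm B W \<ge> 0" using WB by (intro B.nrm_nonneg) simp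
    \<comment> \<open>The points \<open>z (1 - \<eta>)\<close> and \<open>z 1\<close> differ by
      \<open>\<eta> W\<close> in the operator component, so this step keeps their distance below
      \<open>\<delta>\<close>.\<close>
    define \<eta> where "\<eta> = \<delta> / (2 * (nrm B W + 1))"
    have \<eta>: "\<eta> > 0" "\<eta> * nrm B W < \<delta>"
      using \<delta>(1) nW mult_nonneg_nonneg[of \<delta> "nrm B W"]
      by (auto simp: \<eta>_def field_simps add_nonneg_pos add_pos_nonneg)
    let ?t = "1 - \<eta>"
    have "z ?t \<ominus>\<^bsub>P.A\<^esub> z 1 = (\<zero>, complex_of_real \<eta> \<odot>\<^bsub>B\<^esub> W)"
    proof -
      have "(?L a \<ominus>\<^bsub>B\<^esub> complex_of_real ?t \<odot>\<^bsub>B\<^esub> W) \<ominus>\<^bsub>B\<^esub> (?L a \<ominus>\<^bsub>B\<^esub> complex_of_real 1 \<odot>\<^bsub>B\<^esub> W)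
          = complex_of_real \<eta> \<odot>\<^bsub>B\<^esub> W"
      proof -
        have "complex_of_real ?t \<odot>\<^bsub>B\<^esub> W = W \<ominus>\<^bsub>B\<^esub> complex_of_real \<eta> \<odot>\<^bsub>B\<^esub> W"
          using WB by (simp add: B.scale_diff_left)
        then have "?L a \<ominus>\<^bsub>B\<^esub> complex_of_real ?t \<odot>\<^bsub>B\<^esub> W = complex_of_real \<eta> \<odot>\<^bsub>B\<^esub> W \<oplus>\<^bsub>B\<^esub> (?L a \<ominus>\<^bsub>B\<^esub> W)"
          using WB LB[OF a] by (simp add: a_minus_def B.minus_add B.a_ac)
        then show ?thesis
          using WB LB[OF a] by (simp add: B.diff_eq_iff)
      qed
      then show ?thesis using P.A_diff[OF zc[of ?t] zc[of 1]] a by (simp add: z_def)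
    qed
    moreover have "nrm B (complex_of_real \<eta> \<odot>\<^bsub>B\<^esub> W) = \<eta> * nrm B W"
      using B.nrm_smult[of W "complex_of_real \<eta>"] WB \<eta>(1) by simp
    ultimately have "alg_dist P.A (z ?t) (z 1) < \<delta>"
      using zc \<eta> \<delta>(1) by (simp add: alg_dist_def)
    then have "hausdorff_dist (spectrum P.A (z ?t)) (spectrum P.A (z 1)) < r"
      by (rule \<delta>(2)[OF zc])
    moreover have "r \<le> hausdorff_dist (spectrum P.A (z ?t)) (spectrum P.A (z 1))"
    proof (rule hausdorff_dist_ge[OF _ _ l_in])
      show "bounded (spectrum P.A (z 1))" by (rule PB.bounded_spectrum[OF zc])
      \<comment> \<open>Nonemptiness comes from the hole itself: if the spectrum were empty, the
        bounded component would be the whole plane.\<close>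
      have "spectrum A a \<noteq> {}"
      proof
        assume "spectrum A a = {}"
        then have "C = UNIV" using C(1) by (simp add: components_UNIV)
        then show False using C(2) not_bounded_UNIV by blast
      qed
      then show "spectrum P.A (z ?t) \<noteq> {}" by (auto simp: spec)
      \<comment> \<open>By \<open>free\<close>, the disc of radius \<open>r\<close> about
        \<open>l\<close> contains no spectrum of the nearby point, although \<open>l\<close> is a
        spectral value of \<open>z 1\<close>.\<close>
      show "r \<le> dist l s" if s: "s \<in> spectrum P.A (z ?t)" for s
        using free[of "s - l" ?t] s \<eta>(1) by (intro leI notI) (simp add: dist_norm norm_minus_commute)
    qed
    ultimately show False by simp
  qed
  moreover have "z 1 = (a, ?L a) \<oplus>\<^bsub>P.A\<^esub> (\<zero>, (- 1) \<odot>\<^bsub>B\<^esub> W)"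
    using a WB by (simp add: z_def a_minus_def)
  moreover have "(\<zero>, (- 1) \<odot>\<^bsub>B\<^esub> W) \<in> P.ker_ideal"
    using P.J_scale[OF WJ, of "- 1"] unfolding P.ker_ideal_def by blast
  ultimately show ?thesis by metis
qed

end

theorem theorem2p2:
  fixes Y :: "'a normed_alg"
  assumes "complex_banach_algebra Y"
    and "semisimple Y"
    and "cdim_greater Y 1"
  shows "\<exists>(A :: ('a \<times> ('a \<Rightarrow> 'a)) normed_alg) \<phi> I.
    complex_banach_algebra A \<and> semisimple A \<and>
    isometric_embedding Y A \<phi> \<and>
    (\<forall>y\<in>carrier Y. spectrum A (\<phi> y) = spectrum Y y) \<and>
    closedin (alg_topology A) I \<and> inessential_ideal I A \<and>
    isometrically_isomorphic (quotient_alg A I) Y \<and>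
    (\<forall>a\<in>carrier Y. separates_plane (spectrum Y a) \<longrightarrow>
      (\<exists>w\<in>I. spectral_discontinuity A (\<phi> a \<oplus>\<^bsub>A\<^esub> w)))"
proof -
  interpret Y: complex_banach_algebra Y by fact
  interpret P: alg_pullback Y "op_alg Y" "left_mult Y" "approximable Y"
    by (rule Y.approximable_pullback)
  show ?thesis
    using P.A_banach Y.pullback_semisimple[OF assms(2)] P.embed_isometric P.spectrum_embed
      P.ker_ideal_closedin Y.pullback_inessential P.quotient_isomorphic Y.pullback_discontinuity
    by (intro exI[of _ P.A] exI[of _ "\<lambda>y. (y, left_mult Y y)"] exI[of _ P.ker_ideal]) blast
qed

end
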